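(* The problem DirectedHamiltonicity over definable structures is undecidable: there is no algorithm which, given (a finite presentation of) a definable directed graph $G$, decides whether $G$ has a doubly-infinite Hamiltonian path.
   Context: Fix a countably infinite set $\mathbb{A}$ of atoms and an infinite set of atom variables. An expression is either a variable or a formal finite (possibly empty) union of set-builder expressions $\{e \mid x_1,\dots,x_k\in\mathbb{A},\ \varphi\}$ (with $k\ge 0$), where $e$ is an expression, the $x_i$ are bound variables, and $\varphi$ is a first-order formula over the atom variables with equality as the only relation symbol (interpreted in $(\mathbb{A},=)$). An expression $e$ with set of free variables $V$, together with a valuation $\sigma:V\to\mathbb{A}$, has a value $e[\sigma]$, defined in the obvious way by induction on $e$, which is an atom or a set; the sets arising this way are called definable. Pairs, tuples, integers, constants, disjoint unions etc. are encoded by standard set-theoretic means (e.g. $(x,y)=\{x,\{x,y\}\}$). A definable set is presented to an algorithm as a pair $(e,\sigma)$. A definable directed graph is a definable pair $G=(V,E)$ with $E\subseteq V\times V$. A doubly-infinite Hamiltonian path in an infinite directed graph is a connected subgraph that meets every vertex and in which every vertex has in-degree $1$ and out-degree $1$; equivalently, an enumeration $(v_i)_{i\in\mathbb{Z}}$ of $V$ without repetitions such that $(v_i,v_{i+1})\in E$ for all $i\in\mathbb{Z}$. The path is not required to be definable. *)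

theory Defs
  imports
    "HOL-Library.Countable_Set_Type"
    "HOL-Library.Nat_Bijection"
    "Graph_Theory.Digraph_Component"
begin

section \<open>Definable sets\<close>

type_synonym atom = nat
type_synonym var = nat

text \<open>
  Hereditary sets over the atoms. Values of expressions are in general infinite sets, but always
  countable ones (lemma \<open>countable_elements\<close> below), so countable branching suffices.
\<close>

datatype hset = Atom atom | HSet "hset cset"

definition hpair :: "hset \<Rightarrow> hset \<Rightarrow> hset" where
  "hpair x y = HSet (cinsert x (cinsert (HSet (cinsert x (cinsert y cempty))) cempty))"

datatype fm = Eq var var | Neg fm | And fm fm | Ex var fm

primrec sat :: "fm \<Rightarrow> (var \<Rightarrow> atom) \<Rightarrow> bool" where
  "sat (Eq x y) \<sigma> \<longleftrightarrow> \<sigma> x = \<sigma> y"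
| "sat (Neg \<phi>) \<sigma> \<longleftrightarrow> \<not> sat \<phi> \<sigma>"
| "sat (And \<phi> \<psi>) \<sigma> \<longleftrightarrow> sat \<phi> \<sigma> \<and> sat \<psi> \<sigma>"
| "sat (Ex x \<phi>) \<sigma> \<longleftrightarrow> (\<exists>a. sat \<phi> (\<sigma>(x := a)))"

primrec fv_fm :: "fm \<Rightarrow> var set" where
  "fv_fm (Eq x y) = {x, y}"
| "fv_fm (Neg \<phi>) = fv_fm \<phi>"
| "fv_fm (And \<phi> \<psi>) = fv_fm \<phi> \<union> fv_fm \<psi>"
| "fv_fm (Ex x \<phi>) = fv_fm \<phi> - {x}"

text \<open>
  \<open>Builder e [x1, ..., xk] \<phi>\<close> stands for \<open>{e | x1, ..., xk \<in> A, \<phi>}\<close>, and \<open>EUnion\<close> for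
  a formal finite union of such set-builder expressions.
\<close>

datatype expr = EVar var | EUnion "builder list"
  and builder = Builder expr "var list" fm

primrec fv :: "expr \<Rightarrow> var set" and fv_builder :: "builder \<Rightarrow> var set" where
  "fv (EVar x) = {x}"
| "fv (EUnion bs) = \<Union> (set (map fv_builder bs))"
| "fv_builder (Builder e xs \<phi>) = (fv e \<union> fv_fm \<phi>) - set xs"

text \<open>
  Valuations are total functions here; only the values on the free variables matter
  (lemma \<open>eval_cong\<close>). In the last equation, \<open>\<tau>\<close> ranges over the valuations obtained from \<open>\<sigma>\<close>
  by assigning arbitrary atoms to the bound variables.
\<close>

fun eval :: "expr \<Rightarrow> (var \<Rightarrow> atom) \<Rightarrow> hset"
  and elements :: "builder \<Rightarrow> (var \<Rightarrow> atom) \<Rightarrow> hset set" where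
  "eval (EVar x) \<sigma> = Atom (\<sigma> x)"
| "eval (EUnion bs) \<sigma> = HSet (acset (\<Union>b\<in>set bs. elements b \<sigma>))"
| "elements (Builder e xs \<phi>) \<sigma> = {eval e \<tau> |\<tau>. (\<forall>x. x \<notin> set xs \<longrightarrow> \<tau> x = \<sigma> x) \<and> sat \<phi> \<tau>}"

lemma countable_reassign:
  fixes \<sigma> :: "var \<Rightarrow> atom"
  shows "countable {\<tau>. \<forall>x. x \<notin> set xs \<longrightarrow> \<tau> x = \<sigma> x}"
proof -
  have "{\<tau>. \<forall>x. x \<notin> set xs \<longrightarrow> \<tau> x = \<sigma> x}
        \<subseteq> (\<lambda>as x. case map_of (zip xs as) x of None \<Rightarrow> \<sigma> x | Some a \<Rightarrow> a) ` (UNIV :: atom list set)"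
  proof
    fix \<tau> assume "\<tau> \<in> {\<tau>. \<forall>x. x \<notin> set xs \<longrightarrow> \<tau> x = \<sigma> x}"
    then have *: "\<And>x. x \<notin> set xs \<Longrightarrow> \<tau> x = \<sigma> x" by simp
    have "\<tau> = (\<lambda>x. case map_of (zip xs (map \<tau> xs)) x of None \<Rightarrow> \<sigma> x | Some a \<Rightarrow> a)"
      by (auto simp: fun_eq_iff map_of_zip_map * split: option.splits)
    then show "\<tau> \<in> (\<lambda>as x. case map_of (zip xs as) x of None \<Rightarrow> \<sigma> x | Some a \<Rightarrow> a) ` UNIV"
      by blast
  qed
  then show ?thesis by (rule countable_subset) simp
qed

lemma countable_elements: "countable (elements b \<sigma>)"
proof (cases b)
  case (Builder e xs \<phi>)
  have "elements b \<sigma> \<subseteq> eval e ` {\<tau>. \<forall>x. x \<notin> set xs \<longrightarrow> \<tau> x = \<sigma> x}"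
    by (auto simp: Builder)
  then show ?thesis by (rule countable_subset) (intro countable_image countable_reassign)
qed

lemma rcset_eval_EUnion:
  assumes "eval (EUnion bs) \<sigma> = HSet S"
  shows "rcset S = (\<Union>b\<in>set bs. elements b \<sigma>)"
proof -
  have "countable (\<Union>b\<in>set bs. elements b \<sigma>)"
    by (rule countable_UN) (simp_all add: countable_elements countable_finite)
  then have "rcset (acset (\<Union>b\<in>set bs. elements b \<sigma>)) = (\<Union>b\<in>set bs. elements b \<sigma>)"
    by (intro acset_inverse) simp
  then show ?thesis using assms by simp
qed

lemma sat_cong: "(\<And>x. x \<in> fv_fm \<phi> \<Longrightarrow> \<sigma> x = \<tau> x) \<Longrightarrow> sat \<phi> \<sigma> = sat \<phi> \<tau>"
proof (induction \<phi> arbitrary: \<sigma> \<tau>)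
  case (Eq x y)
  have "\<sigma> x = \<tau> x" "\<sigma> y = \<tau> y" by (rule Eq; simp)+
  then show ?case by simp
next
  case (Neg \<phi>)
  have "sat \<phi> \<sigma> = sat \<phi> \<tau>" by (rule Neg.IH, rule Neg.prems) simp
  then show ?case by simp
next
  case (And \<phi> \<psi>)
  have "sat \<phi> \<sigma> = sat \<phi> \<tau>" by (rule And.IH(1), rule And.prems) simp
  moreover have "sat \<psi> \<sigma> = sat \<psi> \<tau>" by (rule And.IH(2), rule And.prems) simp
  ultimately show ?case by simp
next
  case (Ex x \<phi>)
  have "sat \<phi> (\<sigma>(x := a)) = sat \<phi> (\<tau>(x := a))" for a
  proof (rule Ex.IH)
    fix y assume "y \<in> fv_fm \<phi>"
    then show "(\<sigma>(x := a)) y = (\<tau>(x := a)) y"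
      by (cases "y = x") (simp_all add: Ex.prems)
  qed
  then show ?case by simp
qed

lemma elements_subset:
  assumes IH: "\<And>\<sigma> \<tau>. (\<And>x. x \<in> fv e \<Longrightarrow> \<sigma> x = \<tau> x) \<Longrightarrow> eval e \<sigma> = eval e \<tau>"
    and eq: "\<And>x. x \<in> (fv e \<union> fv_fm \<phi>) - set xs \<Longrightarrow> \<sigma> x = \<tau> x"
  shows "elements (Builder e xs \<phi>) \<sigma> \<subseteq> elements (Builder e xs \<phi>) \<tau>"
proof
  fix v assume "v \<in> elements (Builder e xs \<phi>) \<sigma>"
  then obtain \<rho> where v: "v = eval e \<rho>" and \<rho>: "\<forall>x. x \<notin> set xs \<longrightarrow> \<rho> x = \<sigma> x" and s: "sat \<phi> \<rho>"
    by auto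
  define \<rho>' where "\<rho>' = (\<lambda>x. if x \<in> set xs then \<rho> x else \<tau> x)"
  have *: "\<rho> x = \<rho>' x" if "x \<in> fv e \<union> fv_fm \<phi>" for x
    using \<rho> eq[of x] that by (cases "x \<in> set xs") (simp_all add: \<rho>'_def)
  have "eval e \<rho> = eval e \<rho>'" by (rule IH, rule *) simp
  moreover have "sat \<phi> \<rho> = sat \<phi> \<rho>'" by (rule sat_cong, rule *) simp
  moreover have "\<forall>x. x \<notin> set xs \<longrightarrow> \<rho>' x = \<tau> x" by (simp add: \<rho>'_def)
  ultimately show "v \<in> elements (Builder e xs \<phi>) \<tau>"
    unfolding elements.simps using v s by blast
qed

lemma eval_cong:
  "(\<And>x. x \<in> fv e \<Longrightarrow> \<sigma> x = \<tau> x) \<Longrightarrow> eval e \<sigma> = eval e \<tau>"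
  and elements_cong:
  "(\<And>x. x \<in> fv_builder b \<Longrightarrow> \<sigma> x = \<tau> x) \<Longrightarrow> elements b \<sigma> = elements b \<tau>"
proof (induction e and b arbitrary: \<sigma> \<tau> and \<sigma> \<tau>)
  case (EVar x)
  have "\<sigma> x = \<tau> x" by (rule EVar) simp
  then show ?case by simp
next
  case (EUnion bs)
  have "elements b \<sigma> = elements b \<tau>" if "b \<in> set bs" for b
    by (rule EUnion.IH[OF that], rule EUnion.prems) (use that in auto)
  then have "(\<Union>b\<in>set bs. elements b \<sigma>) = (\<Union>b\<in>set bs. elements b \<tau>)"
    by (rule SUP_cong[OF refl])
  then show ?case by (simp only: eval.simps)
next
  case (Builder e xs \<phi>)
  have eq: "\<sigma> x = \<tau> x" if "x \<in> (fv e \<union> fv_fm \<phi>) - set xs" for x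
    by (rule Builder.prems) (use that in simp)
  show ?case
  proof (rule subset_antisym)
    show "elements (Builder e xs \<phi>) \<sigma> \<subseteq> elements (Builder e xs \<phi>) \<tau>"
      by (rule elements_subset) (erule Builder.IH, erule eq)
    show "elements (Builder e xs \<phi>) \<tau> \<subseteq> elements (Builder e xs \<phi>) \<sigma>"
      by (rule elements_subset) (erule Builder.IH, erule eq[symmetric])
  qed
qed

lemma hset_mem_asym: "x \<in> rcset S \<Longrightarrow> y = HSet S \<Longrightarrow> y \<in> rcset T \<Longrightarrow> x \<noteq> HSet T"
proof (induction x arbitrary: y S T)
  case (HSet X)
  show ?case
  proof
    assume "HSet X = HSet T"
    then have "y \<in> rcset X" using HSet.prems(3) by simp
    from HSet.IH[OF this HSet.prems(3)[folded \<open>HSet X = HSet T\<close>[THEN hset.inject(2)[THEN iffD1]]] refl HSet.prems(1)]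
    show False using HSet.prems(2) by simp
  qed
qed simp

lemma rcset_pair: "rcset (cinsert x (cinsert y cempty)) = {x, y}"
  by (simp add: cinsert.rep_eq bot_cset.rep_eq)

lemma hpair_inject: "hpair x y = hpair x' y' \<longleftrightarrow> x = x' \<and> y = y'"
proof
  let ?S = "\<lambda>x y. cinsert x (cinsert y cempty)"
  assume "hpair x y = hpair x' y'"
  then have "rcset (?S x (HSet (?S x y))) = rcset (?S x' (HSet (?S x' y')))"
    by (simp add: hpair_def)
  then have "{x, HSet (?S x y)} = {x', HSet (?S x' y')}"
    by (simp only: rcset_pair)
  moreover have "\<not> (x = HSet (?S x' y') \<and> HSet (?S x y) = x')"
    using hset_mem_asym[of x "?S x y" "HSet (?S x y)" "?S x' y'"] by (auto simp: rcset_pair)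
  ultimately have x: "x = x'" and "HSet (?S x y) = HSet (?S x' y')"
    by (auto simp: doubleton_eq_iff)
  then have "rcset (?S x y) = rcset (?S x' y')" by simp
  then have "{x, y} = {x', y'}" by (simp only: rcset_pair)
  then show "x = x' \<and> y = y'" using x by (auto simp: doubleton_eq_iff)
qed simp

text \<open>Finite valuations are presented as association lists.\<close>

type_synonym presentation = "expr \<times> (var \<times> atom) list"

definition valuation :: "(var \<times> atom) list \<Rightarrow> var \<Rightarrow> atom" where
  "valuation s x = (case map_of s x of Some a \<Rightarrow> a | None \<Rightarrow> 0)"

definition wf_presentation :: "presentation \<Rightarrow> bool" where
  "wf_presentation = (\<lambda>(e, s). distinct (map fst s) \<and> set (map fst s) = fv e)"

definition presented_set :: "presentation \<Rightarrow> hset" where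
  "presented_set = (\<lambda>(e, s). eval e (valuation s))"


section \<open>Definable directed graphs and Hamiltonian paths\<close>

text \<open>The set \<open>v\<close> is the pair (V, E) of the vertex set and the edge set of \<open>G\<close>.\<close>

definition is_digraph_set :: "hset \<Rightarrow> hset pair_pre_digraph \<Rightarrow> bool" where
  "is_digraph_set v G \<longleftrightarrow>
     (\<exists>V E. v = hpair (HSet V) (HSet E)
          \<and> pverts G = rcset V
          \<and> (\<lambda>(x, y). hpair x y) ` parcs G = rcset E
          \<and> parcs G \<subseteq> pverts G \<times> pverts G)"

lemma is_digraph_set_unique:
  assumes "is_digraph_set v G" "is_digraph_set v G'"
  shows "G = G'"
proof -
  from assms have 1: "pverts G = pverts G'"
    and 2: "(\<lambda>(x, y). hpair x y) ` parcs G = (\<lambda>(x, y). hpair x y) ` parcs G'"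
    unfolding is_digraph_set_def by (auto simp: hpair_inject)
  have "inj (\<lambda>(x, y). hpair x y)" by (auto simp: inj_def hpair_inject)
  with 2 have "parcs G = parcs G'" by (simp only: inj_image_eq_iff)
  with 1 show ?thesis by simp
qed

definition presents_digraph :: "presentation \<Rightarrow> hset pair_pre_digraph \<Rightarrow> bool" where
  "presents_digraph p G \<longleftrightarrow> wf_presentation p \<and> is_digraph_set (presented_set p) G"

text \<open>
  \<open>connected\<close> refers to the underlying undirected graph. Finite graphs have no doubly-infinite
  path; without the first conjunct, Hamiltonian cycles of finite graphs would be included.
  Lemma \<open>has_doubly_infinite_hamiltonian_path_iff\<close> below gives the equivalent description by
  enumerations indexed by the integers.
\<close>

definition doubly_infinite_hamiltonian_path ::
  "'a pair_pre_digraph \<Rightarrow> 'a pair_pre_digraph \<Rightarrow> bool" where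
  "doubly_infinite_hamiltonian_path G H \<longleftrightarrow>
     infinite (pverts G) \<and> spanning (with_proj H) (with_proj G) \<and> connected (with_proj H) \<and>
     (\<forall>v \<in> pverts H. in_degree (with_proj H) v = 1 \<and> out_degree (with_proj H) v = 1)"

definition has_doubly_infinite_hamiltonian_path :: "'a pair_pre_digraph \<Rightarrow> bool" where
  "has_doubly_infinite_hamiltonian_path G \<longleftrightarrow> (\<exists>H. doubly_infinite_hamiltonian_path G H)"


lemma has_doubly_infinite_hamiltonian_path_iff:
  assumes sub: "parcs G \<subseteq> pverts G \<times> pverts G"
  shows "has_doubly_infinite_hamiltonian_path G \<longleftrightarrow>
    (\<exists>v :: int \<Rightarrow> 'a. bij_betw v UNIV (pverts G) \<and> (\<forall>i. (v i, v (i + 1)) \<in> parcs G))"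
    (is "_ = (\<exists>v. ?P v)")
proof
  assume "\<exists>v. ?P v"
  then obtain v :: "int \<Rightarrow> 'a" where bij: "bij_betw v UNIV (pverts G)"
    and E: "\<And>i. (v i, v (i + 1)) \<in> parcs G" by blast
  have inj: "v i = v j \<longleftrightarrow> i = j" for i j
    using bij by (auto simp: bij_betw_def inj_def)
  have ran: "pverts G = range v" using bij by (simp add: bij_betw_def)
  define H where "H = \<lparr>pverts = pverts G, parcs = range (\<lambda>i. (v i, v (i + 1)))\<rparr>"
  have HV: "pverts H = range v" and HE: "parcs H = range (\<lambda>i. (v i, v (i + 1)))"
    by (simp_all add: H_def ran)
  have wfH: "wf_digraph (with_proj H)"
    by unfold_locales (auto simp: HV HE)
  have wfG: "wf_digraph (with_proj G)"
    using sub by unfold_locales auto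
  have span: "spanning (with_proj H) (with_proj G)"
    using wfH wfG E by (auto simp: spanning_def subgraph_def HV HE ran compatible_def)
  interpret S: pair_wf_digraph "mk_symmetric (with_proj H)"
    using wfH by (rule wf_digraph.wellformed_mk_symmetric)
  have step: "(v i, v (i + 1)) \<in> parcs (mk_symmetric (with_proj H))"
      "(v (i + 1), v i) \<in> parcs (mk_symmetric (with_proj H))" for i
    by (auto simp: parcs_mk_symmetric HE)
  have R: "v 0 \<rightarrow>\<^sup>*\<^bsub>with_proj (mk_symmetric (with_proj H))\<^esub> v i \<and>
           v i \<rightarrow>\<^sup>*\<^bsub>with_proj (mk_symmetric (with_proj H))\<^esub> v 0" for i
  proof (induction i rule: int_induct[where k = 0])
    case base
    show ?case by (auto intro: S.reachable_refl simp: HV)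
  next
    case (step1 i)
    then show ?case using step[of i]
      using S.reachable_adj_trans[of "v 0" "v i" "v (i + 1)"]
        S.adj_reachable_trans[of "v (i + 1)" "v i" "v 0"] by simp
  next
    case (step2 i)
    then show ?case using step[of "i - 1"]
      using S.reachable_adj_trans[of "v 0" "v i" "v (i - 1)"]
        S.adj_reachable_trans[of "v (i - 1)" "v i" "v 0"] by simp
  qed
  have conn: "connected (with_proj H)"
    unfolding connected_def strongly_connected_def
    using R by (auto simp: HV intro: S.reachable_trans)
  have "in_arcs (with_proj H) (v i) = {(v (i - 1), v i)}" for i
    by (auto simp: in_arcs_def HE inj image_iff intro: exI[of _ "i - 1"])
  moreover have "out_arcs (with_proj H) (v i) = {(v i, v (i + 1))}" for i
    by (auto simp: out_arcs_def HE inj)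
  ultimately have "\<forall>x\<in>pverts H. in_degree (with_proj H) x = 1 \<and> out_degree (with_proj H) x = 1"
    by (auto simp: HV in_degree_def out_degree_def)
  moreover have "infinite (pverts G)"
    using bij_betw_finite[OF bij] infinite_UNIV_int by blast
  ultimately show "has_doubly_infinite_hamiltonian_path G"
    using span conn
    unfolding has_doubly_infinite_hamiltonian_path_def doubly_infinite_hamiltonian_path_def by blast
next
  assume "has_doubly_infinite_hamiltonian_path G"
  then obtain H where inf: "infinite (pverts G)"
    and span: "spanning (with_proj H) (with_proj G)" and conn: "connected (with_proj H)"
    and deg: "\<And>x. x \<in> pverts H \<Longrightarrow> in_degree (with_proj H) x = 1 \<and> out_degree (with_proj H) x = 1"
    unfolding has_doubly_infinite_hamiltonian_path_def doubly_infinite_hamiltonian_path_def by blast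
  from span have V: "pverts H = pverts G" and sE: "parcs H \<subseteq> parcs G"
    by (auto simp: spanning_def subgraph_def)
  have "\<exists>y. \<forall>w. (x, w) \<in> parcs H \<longleftrightarrow> w = y" if x: "x \<in> pverts G" for x
  proof -
    have "card (out_arcs (with_proj H) x) = 1" using deg[of x] x V by (simp add: out_degree_def)
    then obtain e where "out_arcs (with_proj H) x = {e}" by (rule card_1_singletonE)
    then have e: "{e \<in> parcs H. fst e = x} = {e}" by (simp add: out_arcs_def)
    have "(x, w) \<in> parcs H \<longleftrightarrow> (x, w) = e" for w using e by force
    moreover have "fst e = x" using e by blast
    ultimately show ?thesis by (intro exI[of _ "snd e"]) (auto simp: prod_eq_iff)
  qed
  then obtain f where f: "\<And>x w. x \<in> pverts G \<Longrightarrow> (x, w) \<in> parcs H \<longleftrightarrow> w = f x" by metis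
  have "\<exists>y. \<forall>w. (w, x) \<in> parcs H \<longleftrightarrow> w = y" if x: "x \<in> pverts G" for x
  proof -
    have "card (in_arcs (with_proj H) x) = 1" using deg[of x] x V by (simp add: in_degree_def)
    then obtain e where "in_arcs (with_proj H) x = {e}" by (rule card_1_singletonE)
    then have e: "{e \<in> parcs H. snd e = x} = {e}" by (simp add: in_arcs_def)
    have "(w, x) \<in> parcs H \<longleftrightarrow> (w, x) = e" for w using e by force
    moreover have "snd e = x" using e by blast
    ultimately show ?thesis by (intro exI[of _ "fst e"]) (auto simp: prod_eq_iff)
  qed
  then obtain g where g: "\<And>x w. x \<in> pverts G \<Longrightarrow> (w, x) \<in> parcs H \<longleftrightarrow> w = g x" by metis
  have HV: "x \<in> pverts G \<and> y \<in> pverts G" if "(x, y) \<in> parcs H" for x y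
    using that sE sub by blast
  have fV: "f x \<in> pverts G" and gf: "g (f x) = x" if x: "x \<in> pverts G" for x
  proof -
    have e: "(x, f x) \<in> parcs H" using f[OF x] by blast
    then show fx: "f x \<in> pverts G" using HV by blast
    show "g (f x) = x" using g[OF fx, of x] e by simp
  qed
  have gV: "g x \<in> pverts G" and fg: "f (g x) = x" if x: "x \<in> pverts G" for x
  proof -
    have e: "(g x, x) \<in> parcs H" using g[OF x] by blast
    then show gx: "g x \<in> pverts G" using HV by blast
    show "f (g x) = x" using f[OF gx, of x] e by simp
  qed
  obtain v0 where v0: "v0 \<in> pverts G" using inf by fastforce
  define v :: "int \<Rightarrow> 'a" where "v i = (if i \<ge> 0 then (f ^^ nat i) v0 else (g ^^ nat (- i)) v0)" for i
  have fn: "(f ^^ n) v0 \<in> pverts G" and gn: "(g ^^ n) v0 \<in> pverts G" for n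
    by (induction n) (auto simp: v0 fV gV)
  have vV: "v i \<in> pverts G" for i by (simp add: v_def fn gn)
  have vS: "v (i + 1) = f (v i)" for i
  proof (cases "i \<ge> 0")
    case True
    then have "nat (i + 1) = Suc (nat i)" by simp
    then show ?thesis using True by (simp add: v_def)
  next
    case False
    then have "nat (- i) = Suc (nat (- (i + 1)))" by simp
    then have "v i = g ((g ^^ nat (- (i + 1))) v0)" using False by (simp add: v_def)
    then have "f (v i) = (g ^^ nat (- (i + 1))) v0" by (simp add: fg gn)
    moreover have "\<dots> = v (i + 1)"
      using False by (cases "i = -1") (simp_all add: v_def)
    ultimately show ?thesis by simp
  qed
  have vP: "g (v i) = v (i - 1)" for i
    using vS[of "i - 1"] gf[OF vV[of "i - 1"]] by simp
  interpret S: pair_wf_digraph "mk_symmetric (with_proj H)"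
    using span by (intro wf_digraph.wellformed_mk_symmetric) (simp add: spanning_def subgraph_def)
  have surj: "x \<in> range v" if "x \<in> pverts G" for x
  proof -
    have "v0 \<rightarrow>\<^sup>*\<^bsub>with_proj (mk_symmetric (with_proj H))\<^esub> x"
      using conn that v0 V by (simp add: connected_def strongly_connected_def)
    then show ?thesis
    proof (induction rule: S.reachable_induct)
      case base
      have "v0 = v 0" by (simp add: v_def)
      then show ?case by blast
    next
      case (step x y)
      then obtain i where i: "x = v i" by blast
      from step have "(x, y) \<in> parcs H \<or> (y, x) \<in> parcs H"
        by (auto simp: parcs_mk_symmetric)
      then have "y = f (v i) \<or> y = g (v i)" using f g vV i by blast
      then have "y = v (i + 1) \<or> y = v (i - 1)" by (simp add: vS vP)
      then show ?case by blast
    qed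
  qed
  have inj: "v i \<noteq> v j" if "i < j" for i j
  proof
    assume eq: "v i = v j"
    define n where "n = j - i"
    have n: "n > 0" using that by (simp add: n_def)
    have per: "v (k + n) = v k" for k
    proof (induction k rule: int_induct[where k = i])
      case base show ?case using eq by (simp add: n_def)
    next
      case (step1 k)
      then show ?case using vS[of k] vS[of "k + n"] by (simp add: algebra_simps)
    next
      case (step2 k)
      then show ?case using vP[of k] vP[of "k + n"] by (simp add: algebra_simps)
    qed
    have per': "v (k + n * m) = v k" for k m
    proof (induction m rule: int_induct[where k = 0])
      case (step1 m)
      then show ?case using per[of "k + n * m"] by (simp add: algebra_simps)
    next
      case (step2 m)
      then show ?case using per[of "k + n * (m - 1)"] by (simp add: algebra_simps)
    qed simp
    have "v k \<in> v ` {0..<n}" for k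
    proof -
      have "v k = v (k mod n + n * (k div n))" by simp
      also have "\<dots> = v (k mod n)" by (rule per')
      finally show ?thesis using n by simp
    qed
    then have "finite (range v)" by (meson finite_atLeastLessThan_int finite_imageI finite_subset image_subsetI)
    moreover have "pverts G \<subseteq> range v" using surj by blast
    ultimately show False using inf finite_subset by blast
  qed
  have "inj v"
    by (rule injI) (metis inj linorder_neq_iff)
  moreover have "range v = pverts G" using surj vV by blast
  moreover have "(v i, v (i + 1)) \<in> parcs G" for i
    using f[OF vV[of i], of "v (i + 1)"] vS sE by auto
  ultimately show "\<exists>v. ?P v"
    by (intro exI[of _ v]) (simp add: bij_betw_def)
qed


section \<open>Algorithms\<close>

text \<open>
  Algorithms are modelled by partial recursive functions. \<open>computes f xs y\<close> says that \<open>f\<close> on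
  arguments \<open>xs\<close> halts with result \<open>y\<close>.
\<close>

datatype recf = Zero | Succ | Proj nat | Comp recf "recf list" | PrimRec recf recf | Mu recf

inductive computes :: "recf \<Rightarrow> nat list \<Rightarrow> nat \<Rightarrow> bool" where
  "computes Zero xs 0"
| "computes Succ [n] (Suc n)"
| "i < length xs \<Longrightarrow> computes (Proj i) xs (xs ! i)"
| "list_all2 (\<lambda>g y. computes g xs y) gs ys \<Longrightarrow> computes f ys z \<Longrightarrow> computes (Comp f gs) xs z"
| "computes f xs y \<Longrightarrow> computes (PrimRec f g) (0 # xs) y"
| "computes (PrimRec f g) (n # xs) r \<Longrightarrow> computes g (n # r # xs) y
    \<Longrightarrow> computes (PrimRec f g) (Suc n # xs) y"
| "computes f (n # xs) 0 \<Longrightarrow> \<forall>m<n. \<exists>y. computes f (m # xs) (Suc y) \<Longrightarrow> computes (Mu f) xs n"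

inductive_cases computes_ZeroE: "computes Zero xs y"
inductive_cases computes_SuccE: "computes Succ xs y"
inductive_cases computes_ProjE: "computes (Proj i) xs y"
inductive_cases computes_CompE: "computes (Comp f gs) xs y"
inductive_cases computes_PrimRec0E: "computes (PrimRec f g) (0 # xs) y"
inductive_cases computes_PrimRecSucE: "computes (PrimRec f g) (Suc n # xs) y"
inductive_cases computes_MuE: "computes (Mu f) xs y"

lemma computes_functional: "computes f xs y \<Longrightarrow> computes f xs z \<Longrightarrow> y = z"
proof (induction arbitrary: z rule: computes.induct)
  case (1 xs)
  then show ?case by (rule computes_ZeroE) simp
next
  case (2 n)
  then show ?case by (rule computes_SuccE) simp
next
  case (3 i xs)
  from "3.prems" show ?case by (rule computes_ProjE) simp
next
  case (4 xs gs ys f y)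
  from "4.prems" obtain ys' where ys': "list_all2 (\<lambda>g y. computes g xs y) gs ys'" "computes f ys' z"
    by (rule computes_CompE)
  have "ys = ys'"
  proof (rule nth_equalityI)
    show "length ys = length ys'"
      using "4.IH"(1) ys'(1) by (simp add: list_all2_conv_all_nth)
    fix k assume "k < length ys"
    then have "\<forall>x. computes (gs ! k) xs x \<longrightarrow> ys ! k = x" "computes (gs ! k) xs (ys' ! k)"
      using "4.IH"(1) ys'(1) by (simp_all add: list_all2_conv_all_nth)
    then show "ys ! k = ys' ! k" by blast
  qed
  then show ?case using "4.IH"(2) ys'(2) by blast
next
  case (5 f xs y g)
  from "5.prems" have "computes f xs z" by (rule computes_PrimRec0E)
  then show ?case by (rule "5.IH")
next
  case (6 f g n xs r y)
  from "6.prems" obtain r' where r': "computes (PrimRec f g) (n # xs) r'" "computes g (n # r' # xs) z"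
    by (rule computes_PrimRecSucE)
  have "r = r'" using r'(1) by (rule "6.IH"(1))
  then show ?case using r'(2) "6.IH"(2) by blast
next
  case (7 f n xs)
  from "7.prems" have z: "computes f (z # xs) 0" "\<forall>m<z. \<exists>y. computes f (m # xs) (Suc y)"
    by (rule computes_MuE, blast)+
  show ?case
  proof (rule linorder_cases[of n z])
    assume "n < z"
    then obtain y where "computes f (n # xs) (Suc y)" using z(2) by blast
    then have "0 = Suc y" by (rule "7.IH"(1))
    then show ?thesis by simp
  next
    assume "z < n"
    then obtain y where "\<forall>x. computes f (z # xs) x \<longrightarrow> Suc y = x" using "7.IH"(2) by blast
    then have "Suc y = 0" using z(1) by blast
    then show ?thesis by simp
  qed
qed

primrec code_fm :: "fm \<Rightarrow> nat" where
  "code_fm (Eq x y) = prod_encode (0, prod_encode (x, y))"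
| "code_fm (Neg \<phi>) = prod_encode (1, code_fm \<phi>)"
| "code_fm (And \<phi> \<psi>) = prod_encode (2, prod_encode (code_fm \<phi>, code_fm \<psi>))"
| "code_fm (Ex x \<phi>) = prod_encode (3, prod_encode (x, code_fm \<phi>))"

primrec code_expr :: "expr \<Rightarrow> nat" and code_builder :: "builder \<Rightarrow> nat" where
  "code_expr (EVar x) = prod_encode (0, x)"
| "code_expr (EUnion bs) = prod_encode (1, list_encode (map code_builder bs))"
| "code_builder (Builder e xs \<phi>) =
     prod_encode (code_expr e, prod_encode (list_encode xs, code_fm \<phi>))"

definition code_presentation :: "presentation \<Rightarrow> nat" where
  "code_presentation =
     (\<lambda>(e, s). prod_encode (code_expr e, list_encode (map prod_encode s)))"

lemma code_fm_inj: "code_fm \<phi> = code_fm \<psi> \<Longrightarrow> \<phi> = \<psi>"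
  by (induction \<phi> arbitrary: \<psi>; case_tac \<psi>; simp)

lemma code_expr_inj: "code_expr e = code_expr e' \<Longrightarrow> e = e'"
  and code_builder_inj: "code_builder b = code_builder b' \<Longrightarrow> b = b'"
proof (induction e and b arbitrary: e' and b')
  case (EUnion bs)
  then obtain bs' where e': "e' = EUnion bs'" and eq: "map code_builder bs = map code_builder bs'"
    by (cases e') (auto simp: list_encode_eq)
  have "bs = bs'"
    using EUnion.IH eq by (auto simp: list_eq_iff_nth_eq map_equality_iff)
  then show ?case using e' by simp
next
  case (EVar x) then show ?case by (cases e') auto
next
  case (Builder e xs \<phi>) then show ?case by (cases b') (auto dest: code_fm_inj simp: list_encode_eq)
qed

lemma inj_code_presentation: "inj code_presentation"
  by (auto simp: inj_def code_presentation_def list_encode_eq inj_map_eq_map inj_prod_encode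
      dest: code_expr_inj)

end

theory Submission
  imports Defs
begin

text \<open>
  The halting problem for register machines is reduced to Hamiltonicity. A register holding \<open>n\<close> is
  a stack of \<open>n\<close> atoms, and a vertex carries a control state together with the tops of all stacks;
  pushing \<open>a\<close> on top of \<open>b\<close> visits \<open>Psh a b\<close>, popping \<open>a\<close> to reveal \<open>b\<close> visits \<open>Pop a b\<close>. Since
  each vertex is visited once, a token \<open>a\<close> is created only once, and gadgets ensure that \<open>Pop a b\<close> can
  be used by the machine only if \<open>Psh a b\<close> is; hence a pop reveals the atom that was covered by
  the push. A ray of \<open>Lft\<close> vertices forces the path to start the machine, and all vertices that the
  computation leaves over can be absorbed once the machine has accepted, and not before.

  No universal machine is needed: the presentation of a machine with inputs \<open>m\<close>, \<open>n\<close> arises from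
  that of the machine by adding \<open>m + n\<close> blocks of builders, and its code is computable from
  \<open>m\<close>, \<open>n\<close> and the codes of the vertex and arc builders of the machine. A decision procedure gives a
  machine that asks whether the graph of the given machine, run on these two codes, is
  Hamiltonian, and that accepts if it is not. On its own codes it contradicts itself.
\<close>

section \<open>Hamiltonian paths and runs of a step system\<close>

text \<open>The obstacle is that a definable arc relation sees only boundedly many atoms at once: a
  vertex can hold the tops of the stacks but not what lies below them. A pop therefore has to guess
  the atom it reveals, and a guess can be checked against a push made arbitrarily long before only
  through the global demand that every vertex be visited exactly once. The single use of
  \<open>Tok a\<close> makes the atom under \<open>a\<close> unique, and the arc from
  \<open>Pop a b\<close> to \<open>Psh a b\<close> punishes a wrong guess \<open>b\<close>: if the
  machine takes \<open>Pop a b\<close>, then \<open>Psh a b\<close> can be entered only by a step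
  that pushes it. \<open>Glue\<close> vertices are unavoidable, since a run is finite while the path
  has to meet every vertex; the difficulty is to keep the run from escaping to them early. The
  machine has two inputs because a presentation contains two lists, of vertex builders and of arc
  builders, and each of them has to be extended by the blocks of the input phase.\<close>

type_synonym state = "nat \<times> nat"
type_synonym step = "nat \<times> state \<times> atom list"

datatype vtx = Lft atom | Start | Glue atom | Tok atom | Psh atom atom | Pop atom atom | Part nat step

fun is_resource :: "vtx \<Rightarrow> bool" where
  "is_resource (Tok a) = True"
| "is_resource (Psh a b) = True"
| "is_resource (Pop a b) = True"
| "is_resource _ = False"

locale step_system =
  fixes U :: "step set" and ini fin :: "step \<Rightarrow> bool"
    and nxt :: "step \<Rightarrow> step \<Rightarrow> bool" and res :: "step \<Rightarrow> vtx \<Rightarrow> bool"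
  assumes ini_U: "ini u \<Longrightarrow> u \<in> U"
    and fin_U: "fin u \<Longrightarrow> u \<in> U"
    and nxt_U: "nxt u u' \<Longrightarrow> u \<in> U \<and> u' \<in> U"
    and res_U: "res u r \<Longrightarrow> u \<in> U"
    and res_resource: "res u r \<Longrightarrow> is_resource r"
    and res_unique: "res u r \<Longrightarrow> res u r' \<Longrightarrow> r = r'"
begin

text \<open>
  A path traverses the six parts of a step either forward, as part of a run of the machine, in the
  order 0, 1, 2, \<open>r\<close>, 3, 4, 5 where \<open>r\<close> is the resource consumed by the step, or backward, between two
  \<open>Glue\<close> vertices. The middle vertices 1 and 4 have no other neighbours than those in their triple, and
  the arc from 3 to 2 ties the directions of both triples together; so a run that has entered a
  step can neither escape to \<open>Glue\<close> nor return from the resource into another step. The vertex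
  \<open>Psh a b\<close> is absorbed by \<open>Glue\<close> only via \<open>Pop a b\<close>.
\<close>

inductive edge :: "vtx \<Rightarrow> vtx \<Rightarrow> bool" where
  "edge (Lft a) (Lft b)"
| "edge (Lft a) Start"
| "ini u \<Longrightarrow> edge Start (Part 0 u)"
| "edge (Glue a) (Glue b)"
| "edge (Glue a) (Tok b)"
| "edge (Tok a) (Glue b)"
| "edge (Glue a) (Pop b c)"
| "edge (Pop a b) (Glue c)"
| "edge (Pop a b) (Psh a b)"
| "edge (Psh a b) (Glue c)"
| "u \<in> U \<Longrightarrow> edge (Part 0 u) (Part 1 u)"
| "u \<in> U \<Longrightarrow> edge (Part 1 u) (Part 0 u)"
| "u \<in> U \<Longrightarrow> edge (Part 1 u) (Part 2 u)"
| "u \<in> U \<Longrightarrow> edge (Part 2 u) (Part 1 u)"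
| "u \<in> U \<Longrightarrow> edge (Part 3 u) (Part 4 u)"
| "u \<in> U \<Longrightarrow> edge (Part 4 u) (Part 3 u)"
| "u \<in> U \<Longrightarrow> edge (Part 4 u) (Part 5 u)"
| "u \<in> U \<Longrightarrow> edge (Part 5 u) (Part 4 u)"
| "u \<in> U \<Longrightarrow> edge (Part 3 u) (Part 2 u)"
| "u \<in> U \<Longrightarrow> edge (Glue a) (Part 5 u)"
| "u \<in> U \<Longrightarrow> edge (Part 0 u) (Glue a)"
| "res u r \<Longrightarrow> edge (Part 2 u) r"
| "res u r \<Longrightarrow> edge r (Part 3 u)"
| "nxt u u' \<Longrightarrow> edge (Part 5 u) (Part 0 u')"
| "fin u \<Longrightarrow> edge (Part 5 u) (Glue a)"

definition verts :: "vtx set" where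
  "verts = range Lft \<union> {Start} \<union> range Glue \<union> range Tok \<union> {Psh a b |a b. True} \<union> {Pop a b |a b. True}
     \<union> {Part p u |p u. p < 6 \<and> u \<in> U}"

definition valid_run :: "step list \<Rightarrow> vtx list \<Rightarrow> bool" where
  "valid_run us rs \<longleftrightarrow> us \<noteq> [] \<and> length rs = length us \<and> ini (hd us) \<and> fin (last us) \<and>
     (\<forall>m. Suc m < length us \<longrightarrow> nxt (us ! m) (us ! Suc m)) \<and>
     (\<forall>m < length us. res (us ! m) (rs ! m)) \<and> distinct rs \<and>
     (\<forall>a b. Pop a b \<in> set rs \<longrightarrow> Psh a b \<in> set rs)"

lemma not_res [simp]: "\<not> res u (Part p w)" "\<not> res u (Glue a)" "\<not> res u (Lft a)" "\<not> res u Start"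
  by (auto dest: res_resource)

lemma edge_into_Lft: "edge x (Lft a) \<Longrightarrow> \<exists>b. x = Lft b"
  and edge_into_Start: "edge x Start \<Longrightarrow> \<exists>b. x = Lft b"
  by (erule edge.cases; auto)+

lemma edge_from_Start: "edge Start y \<Longrightarrow> \<exists>u. ini u \<and> y = Part 0 u"
  by (erule edge.cases; auto)+

lemma edge_from_Part:
  "edge (Part 0 u) y \<Longrightarrow> y = Part 1 u \<or> (\<exists>a. y = Glue a)"
  "edge (Part 1 u) y \<Longrightarrow> y = Part 0 u \<or> y = Part 2 u"
  "edge (Part (Suc 0) u) y \<Longrightarrow> y = Part 0 u \<or> y = Part 2 u"
  "edge (Part 2 u) y \<Longrightarrow> y = Part 1 u \<or> res u y"
  "edge (Part 3 u) y \<Longrightarrow> y = Part 4 u \<or> y = Part 2 u"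
  "edge (Part 4 u) y \<Longrightarrow> y = Part 3 u \<or> y = Part 5 u"
  "edge (Part 5 u) y \<Longrightarrow> y = Part 4 u \<or> (\<exists>u'. nxt u u' \<and> y = Part 0 u') \<or> (fin u \<and> (\<exists>a. y = Glue a))"
  by (erule edge.cases; auto)+

lemma edge_into_Part:
  "edge x (Part 0 u) \<Longrightarrow> x = Part 1 u \<or> (x = Start \<and> ini u) \<or> (\<exists>u'. nxt u' u \<and> x = Part 5 u')"
  "edge x (Part 1 u) \<Longrightarrow> x = Part 0 u \<or> x = Part 2 u"
  "edge x (Part 2 u) \<Longrightarrow> x = Part 1 u \<or> x = Part 3 u"
  "edge x (Part 3 u) \<Longrightarrow> x = Part 4 u \<or> res u x"
  "edge x (Part 4 u) \<Longrightarrow> x = Part 3 u \<or> x = Part 5 u"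
  "edge x (Part 5 u) \<Longrightarrow> x = Part 4 u \<or> (\<exists>a. x = Glue a)"
  by (erule edge.cases; auto)+

lemma edge_into_Psh: "edge x (Psh a b) \<Longrightarrow> x = Pop a b \<or> (\<exists>u. x = Part 2 u \<and> res u (Psh a b))"
  by (erule edge.cases; auto)+

lemma verts_simps [simp]:
  "Lft a \<in> verts" "Start \<in> verts" "Glue a \<in> verts" "Tok a \<in> verts" "Psh a b \<in> verts" "Pop a b \<in> verts"
  "Part p u \<in> verts \<longleftrightarrow> p < 6 \<and> u \<in> U"
  unfolding verts_def by blast+

lemma resource_verts: "res u r \<Longrightarrow> r \<in> verts"
  using res_resource[of u r] by (cases r) auto

lemma edge_verts: "edge x y \<Longrightarrow> x \<in> verts \<and> y \<in> verts"
  by (induction rule: edge.induct) (simp_all add: resource_verts ini_U fin_U nxt_U res_U)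

end

section \<open>From a Hamiltonian path to a run\<close>

locale hamiltonian_step_system = step_system +
  fixes v :: "int \<Rightarrow> vtx"
  assumes bij: "bij_betw v UNIV verts"
    and edge_v: "edge (v i) (v (i + 1))"
begin

definition pos :: "vtx \<Rightarrow> int" where "pos x = the_inv v x"
definition sc :: "vtx \<Rightarrow> vtx" where "sc x = v (pos x + 1)"
definition pr :: "vtx \<Rightarrow> vtx" where "pr x = v (pos x - 1)"

lemma inj_v: "inj v" and range_v: "range v = verts"
  using bij by (auto simp: bij_betw_def)

lemma pos_v [simp]: "pos (v i) = i"
  by (simp add: pos_def the_inv_f_f inj_v)

lemma v_pos [simp]: "x \<in> verts \<Longrightarrow> v (pos x) = x"
  using range_v pos_v by (metis rangeE)

lemma v_in [simp]: "v i \<in> verts"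
  using range_v by auto

lemma sc_props:
  assumes "x \<in> verts"
  shows "sc x \<in> verts" "pr x \<in> verts" "pr (sc x) = x" "sc (pr x) = x" "edge x (sc x)" "edge (pr x) x"
    "sc (sc x) \<noteq> x" "pos (sc x) = pos x + 1" "pos (pr x) = pos x - 1" "pr (pr x) \<noteq> x"
proof -
  show "sc x \<in> verts" "pr x \<in> verts" "pr (sc x) = x" "sc (pr x) = x" "pos (sc x) = pos x + 1" "pos (pr x) = pos x - 1"
    using assms by (simp_all add: sc_def pr_def)
  show "edge x (sc x)" using edge_v[of "pos x"] assms by (simp add: sc_def)
  show "edge (pr x) x" using edge_v[of "pos x - 1"] assms by (simp add: pr_def)
  have "v (pos x + 2) \<noteq> v (pos x)" "v (pos x - 2) \<noteq> v (pos x)" using injD[OF inj_v, of "pos x + 2" "pos x"] injD[OF inj_v, of "pos x - 2" "pos x"] by auto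
  then show "sc (sc x) \<noteq> x" "pr (pr x) \<noteq> x" using assms by (auto simp: sc_def pr_def algebra_simps)
qed

lemma pos_inj: "x \<in> verts \<Longrightarrow> y \<in> verts \<Longrightarrow> pos x = pos y \<Longrightarrow> x = y"
  by (metis v_pos)

text \<open>The only neighbours of part 1 are parts 0 and 2, so this one successor fixes the
  direction of the whole first triple.\<close>

definition fwd :: "step \<Rightarrow> bool" where "fwd u \<longleftrightarrow> u \<in> U \<and> sc (Part 1 u) = Part 2 u"

lemma Part_verts: "u \<in> U \<Longrightarrow> p < 6 \<Longrightarrow> Part p u \<in> verts"
  by simp

text \<open>The path has no 2-cycles, so using an arc excludes the reverse arc. At each vertex of
  the gadget this leaves a single continuation, and the direction spreads to the second triple
  because part 2, already entered from 1, is not entered from 3.\<close>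

lemma fwd_block:
  assumes "fwd u"
  shows "sc (Part 0 u) = Part 1 u" "sc (Part 1 u) = Part 2 u"
    "res u (sc (Part 2 u))" "sc (sc (Part 2 u)) = Part 3 u" "sc (Part 3 u) = Part 4 u" "sc (Part 4 u) = Part 5 u"
    "(\<exists>u'. nxt u u' \<and> sc (Part 5 u) = Part 0 u') \<or> fin u \<and> (\<exists>a. sc (Part 5 u) = Glue a)"
    "(pr (Part 0 u) = Start \<and> ini u) \<or> (\<exists>u'. nxt u' u \<and> pr (Part 0 u) = Part 5 u')"
proof -
  have U: "u \<in> U" and s1: "sc (Part 1 u) = Part 2 u" using assms by (auto simp: fwd_def)
  note P = Part_verts[OF U]
  have V: "Part 0 u \<in> verts" "Part 1 u \<in> verts" "Part 2 u \<in> verts" "Part 3 u \<in> verts" "Part 4 u \<in> verts" "Part 5 u \<in> verts"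
    by (rule P; simp)+
  note S = V[THEN sc_props(1)] V[THEN sc_props(2)] V[THEN sc_props(3)] V[THEN sc_props(4)] V[THEN sc_props(7)] V[THEN sc_props(10)]
  note eo = V[THEN sc_props(5)] note ei = V[THEN sc_props(6)]
  have p2: "pr (Part 2 u) = Part 1 u" using s1 S by metis
  have "pr (Part 1 u) \<noteq> Part 2 u" using p2 S by metis
  then have p1: "pr (Part 1 u) = Part 0 u" using edge_into_Part(2)[OF ei(2)] by blast
  show s0: "sc (Part 0 u) = Part 1 u" using p1 S by metis
  show "sc (Part 1 u) = Part 2 u" by (rule s1)
  have "sc (Part 2 u) \<noteq> Part 1 u" using p1 S by auto
  then show "res u (sc (Part 2 u))" using edge_from_Part(4)[OF eo(3)] by blast
  have "sc (Part 3 u) \<noteq> Part 2 u" using p2 S by auto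
  then show s3: "sc (Part 3 u) = Part 4 u" using edge_from_Part(5)[OF eo(4)] by blast
  have "sc (Part 4 u) \<noteq> Part 3 u" using s3 S by metis
  then show s4: "sc (Part 4 u) = Part 5 u" using edge_from_Part(6)[OF eo(5)] by blast
  have "sc (Part 5 u) \<noteq> Part 4 u" using s4 S by metis
  then show "(\<exists>u'. nxt u u' \<and> sc (Part 5 u) = Part 0 u') \<or> fin u \<and> (\<exists>a. sc (Part 5 u) = Glue a)"
    using edge_from_Part(7)[OF eo(6)] by blast
  have "pr (Part 0 u) \<noteq> Part 1 u" using s0 S by metis
  then show "(pr (Part 0 u) = Start \<and> ini u) \<or> (\<exists>u'. nxt u' u \<and> pr (Part 0 u) = Part 5 u')"
    using edge_into_Part(1)[OF ei(1)] by blast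
  \<comment> \<open>Part 3 is entered from a resource of the same step; as this resource is unique,
    it is the one that follows part 2.\<close>
  have "pr (Part 3 u) \<noteq> Part 4 u" using s4 S by auto
  then have "res u (pr (Part 3 u))" using edge_into_Part(4)[OF ei(4)] by blast
  then have "pr (Part 3 u) = sc (Part 2 u)" using \<open>res u (sc (Part 2 u))\<close> res_unique by blast
  then show "sc (sc (Part 2 u)) = Part 3 u" using S by metis
qed

text \<open>A backward traversal uses the arcs from 1 to 0, from 2 to 1 and from 5 to 4. Missing any
  one of them, that is, being entered at 0 from outside or left from 2 or 5 to the outside, forces
  the forward direction.\<close>

lemma fwd_in: "u \<in> U \<Longrightarrow> pr (Part 0 u) \<noteq> Part 1 u \<Longrightarrow> fwd u"
  and fwd_res: "u \<in> U \<Longrightarrow> sc (Part 2 u) \<noteq> Part 1 u \<Longrightarrow> fwd u"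
  and fwd_out: "u \<in> U \<Longrightarrow> sc (Part 5 u) \<noteq> Part 4 u \<Longrightarrow> fwd u"
proof -
  assume U: "u \<in> U"
  note P = Part_verts[OF U]
  have V: "Part 0 u \<in> verts" "Part 1 u \<in> verts" "Part 2 u \<in> verts" "Part 3 u \<in> verts" "Part 4 u \<in> verts" "Part 5 u \<in> verts"
    by (rule P; simp)+
  note S = V[THEN sc_props(1)] V[THEN sc_props(2)] V[THEN sc_props(3)] V[THEN sc_props(4)] V[THEN sc_props(7)] V[THEN sc_props(10)]
  note eo = V[THEN sc_props(5)] note ei = V[THEN sc_props(6)]
  show *: "fwd u" if "pr (Part 0 u) \<noteq> Part 1 u"
  proof -
    have "sc (Part 1 u) \<noteq> Part 0 u" using that S by metis
    then show ?thesis using edge_from_Part(2)[OF eo(2)] U by (auto simp: fwd_def)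
  qed
  show **: "fwd u" if "sc (Part 2 u) \<noteq> Part 1 u"
  proof -
    have "pr (Part 1 u) \<noteq> Part 2 u" using that S by metis
    then have "pr (Part 1 u) = Part 0 u" using edge_into_Part(2)[OF ei(2)] by blast
    then have "sc (Part 0 u) = Part 1 u" using S by metis
    then have "pr (Part 0 u) \<noteq> Part 1 u" using S by metis
    then show ?thesis by (rule *)
  qed
  show "fwd u" if "sc (Part 5 u) \<noteq> Part 4 u"
  proof -
    have "pr (Part 4 u) \<noteq> Part 5 u" using that S by metis
    then have "pr (Part 4 u) = Part 3 u" using edge_into_Part(5)[OF ei(5)] by blast
    then have "sc (Part 3 u) = Part 4 u" using S by metis
    \<comment> \<open>The arc from 3 to 2 carries the direction from the second triple to the first:
      as 3 is left towards 4, only 1 can precede 2.\<close>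
    then have "pr (Part 2 u) \<noteq> Part 3 u" using S by auto
    then have "pr (Part 2 u) = Part 1 u" using edge_into_Part(3)[OF ei(3)] by blast
    then have "sc (Part 1 u) = Part 2 u" using S by metis
    then show ?thesis using U by (simp add: fwd_def)
  qed
qed

lemma Start_verts: "Start \<in> verts" by (simp add: verts_def)

text \<open>Arcs into \<open>Start\<close> and into \<open>Lft\<close> vertices come only from
  \<open>Lft\<close> vertices, so going backwards from \<open>Start\<close> never leaves the
  ray.\<close>

lemma before_Start: "pos x < pos Start \<Longrightarrow> x \<in> verts \<Longrightarrow> \<exists>a. x = Lft a"
proof -
  have "\<exists>a. v i = Lft a" if "i \<le> pos Start - 1" for i
    using that
  proof (induction rule: int_le_induct)
    case base
    show ?case using edge_v[of "pos Start - 1"] Start_verts edge_into_Start by simp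
  next
    case (step i)
    then show ?case using edge_v[of "i - 1"] edge_into_Lft by auto
  qed
  then show "pos x < pos Start \<Longrightarrow> x \<in> verts \<Longrightarrow> \<exists>a. x = Lft a" by (metis v_pos zle_diff1_eq)
qed

lemma fwd_positions:
  assumes "fwd u"
  shows "pos (Part 1 u) = pos (Part 0 u) + 1" "pos (Part 2 u) = pos (Part 0 u) + 2"
    "pos (sc (Part 2 u)) = pos (Part 0 u) + 3" "pos (Part 3 u) = pos (Part 0 u) + 4"
    "pos (Part 4 u) = pos (Part 0 u) + 5" "pos (Part 5 u) = pos (Part 0 u) + 6"
proof -
  have U: "u \<in> U" using assms by (simp add: fwd_def)
  have V: "Part p u \<in> verts" if "p < 6" for p using Part_verts[OF U that] .
  note B = fwd_block[OF assms]
  show 1: "pos (Part 1 u) = pos (Part 0 u) + 1" using sc_props(8)[OF V, of 0] B(1) by simp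
  show 2: "pos (Part 2 u) = pos (Part 0 u) + 2" using sc_props(8)[OF V, of 1] B(2) 1 by simp
  show 3: "pos (sc (Part 2 u)) = pos (Part 0 u) + 3" using sc_props(8)[OF V, of 2] 2 by simp
  show 4: "pos (Part 3 u) = pos (Part 0 u) + 4"
    using sc_props(8)[OF sc_props(1)[OF V, of 2]] 3 B(4) by simp
  show 5: "pos (Part 4 u) = pos (Part 0 u) + 5" using sc_props(8)[OF V, of 3] B(5) 4 by simp
  show 6: "pos (Part 5 u) = pos (Part 0 u) + 6" using sc_props(8)[OF V, of 4] B(6) 5 by simp
qed

text \<open>A forward step is preceded by \<open>Start\<close> or by another forward step seven
  positions earlier (six parts and a resource), and the descent ends because no part lies before
  \<open>Start\<close>. Recording the positions makes any two chains comparable entry by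
  entry.\<close>

lemma fwd_chain:
  assumes "fwd u"
  shows "\<exists>us. us \<noteq> [] \<and> last us = u \<and> ini (hd us) \<and>
    (\<forall>m < length us. fwd (us ! m) \<and> pos (Part 0 (us ! m)) = pos Start + 1 + 7 * int m) \<and>
    (\<forall>m. Suc m < length us \<longrightarrow> nxt (us ! m) (us ! Suc m))"
  using assms
proof (induction "nat (pos (Part 0 u) - pos Start)" arbitrary: u rule: less_induct)
  case less
  have U: "u \<in> U" using less.prems by (simp add: fwd_def)
  have V0: "Part 0 u \<in> verts" using U by simp
  from fwd_block(8)[OF less.prems] show ?case
  proof
    assume h: "pr (Part 0 u) = Start \<and> ini u"
    then have "pos (Part 0 u) = pos Start + 1" using sc_props(9)[OF V0] by simp
    then show ?thesis using h less.prems by (intro exI[of _ "[u]"]) simp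
  next
    assume "\<exists>u'. nxt u' u \<and> pr (Part 0 u) = Part 5 u'"
    then obtain u' where n: "nxt u' u" and p: "pr (Part 0 u) = Part 5 u'" by blast
    have U': "u' \<in> U" using nxt_U[OF n] by simp
    have s5: "sc (Part 5 u') = Part 0 u" using p sc_props(4)[OF V0] by simp
    have f': "fwd u'" by (rule fwd_out[OF U']) (simp add: s5)
    have V0': "Part 0 u' \<in> verts" using U' by simp
    have pp: "pos (Part 0 u) = pos (Part 0 u') + 7"
      using fwd_positions(6)[OF f'] sc_props(9)[OF V0] p by simp
    have "\<not> pos (Part 0 u') < pos Start" using before_Start[OF _ V0'] by blast
    then have "nat (pos (Part 0 u') - pos Start) < nat (pos (Part 0 u) - pos Start)" using pp by simp
    from less.hyps[OF this f'] obtain us where us: "us \<noteq> []" "last us = u'" "ini (hd us)"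
      "\<And>m. m < length us \<Longrightarrow> fwd (us ! m) \<and> pos (Part 0 (us ! m)) = pos Start + 1 + 7 * int m"
      "\<And>m. Suc m < length us \<Longrightarrow> nxt (us ! m) (us ! Suc m)" by blast
    have l: "us ! (length us - 1) = u'" using us(1,2) by (simp add: last_conv_nth)
    have "pos (Part 0 u') = pos Start + 1 + 7 * int (length us - 1)"
      using us(4)[of "length us - 1"] us(1) l by simp
    then have pu: "pos (Part 0 u) = pos Start + 1 + 7 * int (length us)"
      using pp us(1) by (cases "length us") (simp_all)
    have "fwd ((us @ [u]) ! m) \<and> pos (Part 0 ((us @ [u]) ! m)) = pos Start + 1 + 7 * int m"
      if "m < length (us @ [u])" for m
      using that us(4)[of m] pu less.prems by (cases "m < length us") (auto simp: nth_append less_Suc_eq)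
    moreover have "nxt ((us @ [u]) ! m) ((us @ [u]) ! Suc m)" if "Suc m < length (us @ [u])" for m
    proof (cases "Suc m < length us")
      case True then show ?thesis using us(5) by (simp add: nth_append)
    next
      case False
      then have "Suc m = length us" using that by simp
      then have "m = length us - 1" "\<not> length us \<le> m" by auto
      then show ?thesis using l n \<open>Suc m = length us\<close> by (simp add: nth_append)
    qed
    ultimately show ?thesis using us(1,3) by (intro exI[of _ "us @ [u]"]) simp
  qed
qed

text \<open>Otherwise forward blocks would tile all positions after \<open>Start\<close>, and
  \<open>Glue 0\<close>, which cannot lie before \<open>Start\<close>, would have no place.\<close>

lemma exists_final_step: "\<exists>u a. fwd u \<and> fin u \<and> sc (Part 5 u) = Glue a"
proof (rule ccontr)
  assume no: "\<not> ?thesis"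
  have step: "\<exists>u'. fwd u' \<and> pos (Part 0 u') = pos (Part 0 u) + 7" if f: "fwd u" for u
  proof -
    obtain u' where n: "nxt u u'" and s: "sc (Part 5 u) = Part 0 u'"
      using fwd_block(7)[OF f] no f by blast
    have U: "u \<in> U" "u' \<in> U" using nxt_U[OF n] by auto
    have V: "Part 5 u \<in> verts" using U by simp
    have "pr (Part 0 u') = Part 5 u" using sc_props(3)[OF V] s by simp
    then have "fwd u'" by (intro fwd_in[OF U(2)]) simp
    moreover have "pos (Part 0 u') = pos (Part 0 u) + 7"
      using sc_props(8)[OF V] s fwd_positions(6)[OF f] by simp
    ultimately show ?thesis by blast
  qed
  have inf: "\<exists>u. fwd u \<and> pos (Part 0 u) = pos Start + 1 + 7 * int n" for n
  proof (induction n)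
    case 0
    obtain u where u: "ini u" "sc Start = Part 0 u" using edge_from_Start[OF sc_props(5)[OF Start_verts]] by blast
    have "pr (Part 0 u) = Start" using sc_props(3)[OF Start_verts] u by simp
    then have "fwd u" using fwd_in[OF ini_U[OF u(1)]] by simp
    then show ?case using sc_props(8)[OF Start_verts] u by (intro exI[of _ u]) simp
  next
    case (Suc n)
    then obtain u where "fwd u" "pos (Part 0 u) = pos Start + 1 + 7 * int n" by blast
    then show ?case using step[of u] by auto
  qed
  define p where "p = pos (Glue 0)"
  have G: "Glue 0 \<in> verts" by (simp add: verts_def)
  have "p \<noteq> pos Start" using pos_inj[OF G Start_verts] by (auto simp: p_def)
  moreover have "\<not> p < pos Start" using before_Start[OF _ G] by (auto simp: p_def)
  ultimately have pge: "p - pos Start - 1 \<ge> 0" by simp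
  \<comment> \<open>The number of the block into which \<open>Glue 0\<close> would fall.\<close>
  define n where "n = nat ((p - pos Start - 1) div 7)"
  obtain u where f: "fwd u" and pu: "pos (Part 0 u) = pos Start + 1 + 7 * int n" using inf by blast
  have U: "u \<in> U" using f by (simp add: fwd_def)
  have "7 * int n + (p - pos Start - 1) mod 7 = p - pos Start - 1"
    using pge by (simp add: n_def pos_imp_zdiv_nonneg_iff)
  moreover have "0 \<le> (p - pos Start - 1) mod 7" "(p - pos Start - 1) mod 7 < 7" by simp_all
  ultimately obtain d where d: "0 \<le> d" "d < 7" "7 * int n + d = p - pos Start - 1" by blast
  have pd: "p = pos (Part 0 u) + d" using d(3) pu by linarith
  have neqp: "p \<noteq> pos (Part q u)" if "q < 6" for q
    using pos_inj[OF G Part_verts[OF U that]] by (auto simp: p_def)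
  have "p \<noteq> pos (sc (Part 2 u))"
  proof
    assume "p = pos (sc (Part 2 u))"
    then have "Glue 0 = sc (Part 2 u)" using pos_inj[OF G sc_props(1)[OF Part_verts[OF U]]] by (simp add: p_def)
    then show False using fwd_block(3)[OF f] by (metis not_res(2))
  qed
  then have "p \<noteq> pos (Part 0 u) + 3" using fwd_positions[OF f] by simp
  moreover have "p \<noteq> pos (Part 0 u)" using neqp[of 0] by simp
  moreover have "p \<noteq> pos (Part 0 u) + 1" using neqp[of 1] fwd_positions(1)[OF f] by simp
  moreover have "p \<noteq> pos (Part 0 u) + 2" using neqp[of 2] fwd_positions(2)[OF f] by simp
  moreover have "p \<noteq> pos (Part 0 u) + 4" using neqp[of 3] fwd_positions(4)[OF f] by simp
  moreover have "p \<noteq> pos (Part 0 u) + 5" using neqp[of 4] fwd_positions(5)[OF f] by simp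
  moreover have "p \<noteq> pos (Part 0 u) + 6" using neqp[of 5] fwd_positions(6)[OF f] by simp
  moreover have "d = 0 \<or> d = 1 \<or> d = 2 \<or> d = 3 \<or> d = 4 \<or> d = 5 \<or> d = 6" using d by linarith
  ultimately show False using pd by auto
qed

theorem valid_run_exists: "\<exists>us rs. valid_run us rs"
proof -
  obtain u a where f: "fwd u" and fi: "fin u" and g: "sc (Part 5 u) = Glue a" using exists_final_step by blast
  obtain us where us: "us \<noteq> []" "last us = u" "ini (hd us)"
    and fw: "\<And>m. m < length us \<Longrightarrow> fwd (us ! m)"
    and po: "\<And>m. m < length us \<Longrightarrow> pos (Part 0 (us ! m)) = pos Start + 1 + 7 * int m"
    and nx: "\<And>m. Suc m < length us \<Longrightarrow> nxt (us ! m) (us ! Suc m)"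
    using fwd_chain[OF f] by blast
  \<comment> \<open>Positions determine vertices, so two chains agree on their common length. The
    chain of \<open>u'\<close> cannot be the longer one, because after \<open>u\<close> comes a
    \<open>Glue\<close> vertex and not a further step.\<close>
  have all: "u' \<in> set us" if f': "fwd u'" for u'
  proof -
    obtain us' where us': "us' \<noteq> []" "last us' = u'"
      and fw': "\<And>m. m < length us' \<Longrightarrow> fwd (us' ! m)"
      and po': "\<And>m. m < length us' \<Longrightarrow> pos (Part 0 (us' ! m)) = pos Start + 1 + 7 * int m"
      using fwd_chain[OF f'] by blast
    have eq: "us ! m = us' ! m" if "m < length us" "m < length us'" for m
    proof -
      have "Part 0 (us ! m) \<in> verts" "Part 0 (us' ! m) \<in> verts"
        using fw[OF that(1)] fw'[OF that(2)] Part_verts by (auto simp: fwd_def)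
      then have "Part 0 (us ! m) = Part 0 (us' ! m)"
        using po[OF that(1)] po'[OF that(2)] by (intro pos_inj) auto
      then show ?thesis by simp
    qed
    have "length us' \<le> length us"
    proof (rule ccontr)
      assume "\<not> ?thesis"
      then have l: "length us < length us'" by simp
      have V5: "Part 5 u \<in> verts" and Va: "Part 0 (us' ! length us) \<in> verts"
        using f fw'[OF l] Part_verts by (auto simp: fwd_def)
      have "us ! (length us - 1) = u" using us by (simp add: last_conv_nth)
      then have "pos (Part 0 u) = pos Start + 1 + 7 * int (length us - 1)"
        using po[of "length us - 1"] us(1) by simp
      then have "pos (Part 0 (us' ! length us)) = pos (sc (Part 5 u))"
        using po'[OF l] sc_props(8)[OF V5] fwd_positions(6)[OF f] us(1) by (cases "length us") simp_all
      then show False using pos_inj[OF Va sc_props(1)[OF V5]] g by simp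
    qed
    moreover have l: "length us' - 1 < length us'" using us'(1) by simp
    ultimately have "length us' - 1 < length us" by linarith
    moreover have "us' ! (length us' - 1) = u'" using us' by (simp add: last_conv_nth)
    ultimately show ?thesis using eq[OF _ l] nth_mem by metis
  qed
  define rs where "rs = map (\<lambda>u. sc (Part 2 u)) us"
  have res: "res (us ! m) (rs ! m)" if "m < length us" for m
    using fwd_block(3)[OF fw[OF that]] that by (simp add: rs_def)
  have "distinct rs"
  proof (unfold distinct_conv_nth, intro allI impI)
    fix i j assume ij: "i < length rs" "j < length rs" "i \<noteq> j"
    then have "pos (rs ! i) = pos Start + 4 + 7 * int i" "pos (rs ! j) = pos Start + 4 + 7 * int j"
      using fwd_positions(3)[OF fw] po by (simp_all add: rs_def)
    then show "rs ! i \<noteq> rs ! j" using ij by auto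
  qed
  moreover have "Psh b c \<in> set rs" if P: "Pop b c \<in> set rs" for b c
  proof -
    obtain m where m: "m < length us" "Pop b c = sc (Part 2 (us ! m))"
      using P by (auto simp: rs_def in_set_conv_nth)
    define w where "w = us ! m"
    have w: "Pop b c = sc (Part 2 w)" using m(2) by (simp add: w_def)
    have fwdw: "fwd w" using fw[OF m(1)] by (simp add: w_def)
    have V: "Psh b c \<in> verts" "Pop b c \<in> verts" by simp_all
    \<comment> \<open>The machine leaves \<open>Pop b c\<close> towards part 3, so
      \<open>Psh b c\<close> is entered from part 2 of a step that pushes it. That step is forward,
      hence in the run by \<open>all\<close>.\<close>
    have "sc (Pop b c) = Part 3 w" using fwd_block(4)[OF fwdw] w by simp
    then have "pr (Psh b c) \<noteq> Pop b c" using sc_props(4)[OF V(1)] by auto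
    then obtain u' where u': "pr (Psh b c) = Part 2 u'" "res u' (Psh b c)"
      using edge_into_Psh[OF sc_props(6)[OF V(1)]] by blast
    then have s: "sc (Part 2 u') = Psh b c" using sc_props(4)[OF V(1)] by simp
    then have "fwd u'" using fwd_res[OF res_U[OF u'(2)]] by simp
    then have "sc (Part 2 u') \<in> set rs" using all by (simp add: rs_def)
    then show ?thesis using s by simp
  qed
  ultimately have "valid_run us rs"
    unfolding valid_run_def using us fi nx res by (simp add: rs_def)
  then show ?thesis by blast
qed

end

section \<open>From a run to a Hamiltonian path\<close>

lemma concat_enumeration:
  fixes B :: "nat \<Rightarrow> 'a list"
  assumes ne: "\<And>n. B n \<noteq> []" and dist: "\<And>n. distinct (B n)"
    and disj: "\<And>m n. m < n \<Longrightarrow> set (B m) \<inter> set (B n) = {}"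
    and inner: "\<And>n. successively R (B n)" and link: "\<And>n. R (last (B n)) (hd (B (Suc n)))"
  shows "\<exists>h :: nat \<Rightarrow> 'a. bij_betw h UNIV (\<Union>n. set (B n)) \<and> (\<forall>i. R (h i) (h (Suc i))) \<and> h 0 = hd (B 0)"
proof -
  define P where "P n = concat (map B [0..<n])" for n
  have PS: "P (Suc n) = P n @ B n" for n by (simp add: P_def)
  have P0: "P 0 = []" by (simp add: P_def)
  have setP: "set (P n) = (\<Union>m<n. set (B m))" for n by (auto simp: P_def)
  have len: "n \<le> length (P n)" for n
  proof (induction n)
    case (Suc n)
    have "length (B n) > 0" using ne by simp
    then show ?case using Suc unfolding PS length_append by linarith
  qed simp
  have pre: "\<exists>ys. P (n + k) = P n @ ys" for n k
    by (induction k) (auto simp: PS)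
  have distP: "distinct (P n)" for n
  proof (induction n)
    case (Suc n)
    then show ?case using disj[of _ n] dist[of n] by (auto simp: PS setP)
  qed (simp add: P0)
  have succP: "successively R (P n)" for n
  proof (induction n)
    case (Suc n)
    have "last (P n) = last (B (n - 1))" if "n > 0"
      using that PS[of "n - 1"] ne by simp
    then show ?case using Suc inner link[of "n - 1"]
      by (cases "n = 0") (auto simp: PS P0 successively_append_iff)
  qed (simp add: P0)
  \<comment> \<open>No list is empty, so \<open>P (Suc i)\<close> has an entry \<open>i\<close>, and
    longer prefixes do not change it.\<close>
  define h where "h i = P (Suc i) ! i" for i
  have h: "P n ! i = h i" if "i < length (P n)" for n i
  proof (cases "n \<le> Suc i")
    case True
    then obtain ys where "P (Suc i) = P n @ ys" using pre[of n "Suc i - n"] by auto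
    then show ?thesis using that by (simp add: h_def nth_append)
  next
    case False
    then obtain ys where "P n = P (Suc i) @ ys" using pre[of "Suc i" "n - Suc i"] by auto
    then show ?thesis using len[of "Suc i"] by (simp add: h_def nth_append)
  qed
  have hP: "h i = P (Suc (i + j)) ! i" for i j
    using h[of i "Suc (i + j)"] len[of "Suc (i + j)"] by simp
  have "R (h i) (h (Suc i))" for i
  proof -
    have "Suc i < length (P (Suc (Suc i)))" using len[of "Suc (Suc i)"] by simp
    then have "R (P (Suc (Suc i)) ! i) (P (Suc (Suc i)) ! Suc i)"
      using succP[of "Suc (Suc i)"] by (simp add: successively_conv_nth)
    then show ?thesis using hP[of i 1] by (simp add: h_def)
  qed
  moreover have "inj h"
  proof (rule injI)
    fix i j assume eq: "h i = h j"
    have "i < length (P (Suc (i + j)))" "j < length (P (Suc (i + j)))" using len[of "Suc (i + j)"] by simp_all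
    then show "i = j" using eq distP[of "Suc (i + j)"] hP[of i j] hP[of j i]
      by (simp add: add.commute nth_eq_iff_index_eq)
  qed
  moreover have "range h = (\<Union>n. set (B n))"
  proof
    show "range h \<subseteq> (\<Union>n. set (B n))"
    proof
      fix x assume "x \<in> range h"
      then obtain i where "x = P (Suc i) ! i" by (auto simp: h_def)
      then have "x \<in> set (P (Suc i))" using len[of "Suc i"] by simp
      then show "x \<in> (\<Union>n. set (B n))" by (auto simp: setP)
    qed
    show "(\<Union>n. set (B n)) \<subseteq> range h"
    proof
      fix x assume "x \<in> (\<Union>n. set (B n))"
      then obtain n where "x \<in> set (P (Suc n))" by (auto simp: PS)
      then obtain i where "i < length (P (Suc n))" "x = P (Suc n) ! i" by (auto simp: in_set_conv_nth)
      then show "x \<in> range h" using h by auto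
    qed
  qed
  moreover have "h 0 = hd (B 0)" using ne[of 0] by (simp add: h_def P_def hd_conv_nth)
  ultimately show ?thesis by (intro exI[of _ h]) (simp add: bij_betw_def)
qed

instance vtx :: countable by countable_datatype

context step_system begin

definition fwd_blk :: "step \<times> vtx \<Rightarrow> vtx list" where
  "fwd_blk = (\<lambda>(u, r). [Part 0 u, Part 1 u, Part 2 u, r, Part 3 u, Part 4 u, Part 5 u])"

definition run_path :: "step list \<Rightarrow> vtx list \<Rightarrow> vtx list" where
  "run_path us rs = concat (map fwd_blk (zip us rs))"

text \<open>The vertices left over by a run are absorbed between \<open>Glue\<close> vertices, in blocks indexed
  by one of their members.\<close>

definition idle_blk :: "step list \<Rightarrow> vtx list \<Rightarrow> vtx \<Rightarrow> vtx list" where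
  "idle_blk us rs x = (case x of
     Tok a \<Rightarrow> if x \<in> set rs then [] else [x]
   | Pop a b \<Rightarrow> if x \<in> set rs then [] else if Psh a b \<in> set rs then [x] else [x, Psh a b]
   | Part p u \<Rightarrow> if p = 0 \<and> u \<in> U \<and> u \<notin> set us
       then [Part 5 u, Part 4 u, Part 3 u, Part 2 u, Part 1 u, Part 0 u] else []
   | _ \<Rightarrow> [])"

text \<open>Every block after the first owns one \<open>Glue\<close> vertex and may carry the idle
  block of the vertex coded by \<open>k\<close>. The test on \<open>to_nat\<close> discards numbers
  that code no vertex, so that no idle block is repeated.\<close>

definition segment :: "step list \<Rightarrow> vtx list \<Rightarrow> nat \<Rightarrow> vtx list" where
  "segment us rs n = (case n of 0 \<Rightarrow> Start # run_path us rs
     | Suc k \<Rightarrow> Glue k # (if to_nat (from_nat k :: vtx) = k then idle_blk us rs (from_nat k) else []))"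

text \<open>The index of the segment meant to contain a vertex. Disjointness and coverage of the
  segments are both read off from it, without comparing segments pairwise.\<close>

definition owner :: "step list \<Rightarrow> vtx list \<Rightarrow> vtx \<Rightarrow> nat" where
  "owner us rs x = (if x \<in> set rs then 0 else case x of
     Glue n \<Rightarrow> Suc n
   | Tok a \<Rightarrow> Suc (to_nat x)
   | Pop a b \<Rightarrow> Suc (to_nat x)
   | Psh a b \<Rightarrow> Suc (to_nat (Pop a b))
   | Part p u \<Rightarrow> if u \<in> set us then 0 else Suc (to_nat (Part 0 u))
   | _ \<Rightarrow> 0)"

lemma set_run_path:
  "length us = length rs \<Longrightarrow> set (run_path us rs) = set rs \<union> (\<Union>u\<in>set us. (\<lambda>p. Part p u) ` {..<6})"
proof (induction us rs rule: list_induct2)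
  case (Cons u us r rs)
  have "(\<lambda>p. Part p u) ` {..<6} = {Part 0 u, Part 1 u, Part 2 u, Part 3 u, Part 4 u, Part 5 u}"
    by (simp add: lessThan_nat_numeral lessThan_Suc insert_commute)
  then have "set (fwd_blk (u, r)) = insert r ((\<lambda>p. Part p u) ` {..<6})"
    by (simp add: fwd_blk_def insert_commute)
  moreover have "run_path (u # us) (r # rs) = fwd_blk (u, r) @ run_path us rs" by (simp add: run_path_def)
  ultimately show ?case using Cons.IH by auto
qed (simp add: run_path_def)

lemma distinct_run_path:
  "length us = length rs \<Longrightarrow> distinct us \<Longrightarrow> distinct rs \<Longrightarrow> \<forall>r\<in>set rs. is_resource r \<Longrightarrow>
   distinct (run_path us rs)"
proof (induction us rs rule: list_induct2)
  case (Cons u us r rs)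
  have "run_path (u # us) (r # rs) = fwd_blk (u, r) @ run_path us rs" by (simp add: run_path_def)
  moreover have "distinct (fwd_blk (u, r))" using Cons.prems by (auto simp: fwd_blk_def)
  moreover have "set (fwd_blk (u, r)) \<inter> set (run_path us rs) = {}"
    using Cons.prems Cons.hyps by (auto simp: set_run_path fwd_blk_def)
  ultimately show ?case using Cons by simp
qed (simp add: run_path_def)

lemma successively_fwd_blk: "res u r \<Longrightarrow> successively edge (fwd_blk (u, r))"
  by (simp add: fwd_blk_def edge.intros res_U del: One_nat_def)

lemma successively_run_path:
  "length us = length rs \<Longrightarrow> list_all2 res us rs \<Longrightarrow> successively nxt us \<Longrightarrow>
   successively edge (run_path us rs) \<and>
   (us \<noteq> [] \<longrightarrow> run_path us rs \<noteq> [] \<and> hd (run_path us rs) = Part 0 (hd us) \<and> last (run_path us rs) = Part 5 (last us))"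
proof (induction us rs rule: list_induct2)
  case (Cons u us r rs)
  have eq: "run_path (u # us) (r # rs) = fwd_blk (u, r) @ run_path us rs" by (simp add: run_path_def)
  have b: "fwd_blk (u, r) \<noteq> []" "hd (fwd_blk (u, r)) = Part 0 u" "last (fwd_blk (u, r)) = Part 5 u"
    by (simp_all add: fwd_blk_def)
  have IH: "successively edge (run_path us rs) \<and>
   (us \<noteq> [] \<longrightarrow> run_path us rs \<noteq> [] \<and> hd (run_path us rs) = Part 0 (hd us) \<and> last (run_path us rs) = Part 5 (last us))"
    using Cons by (auto simp: successively_Cons)
  have "us \<noteq> [] \<Longrightarrow> nxt u (hd us)" using Cons.prems(2) by (simp add: successively_Cons)
  moreover have "us = [] \<Longrightarrow> run_path us rs = []" by (simp add: run_path_def)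
  ultimately show ?case using IH b successively_fwd_blk[of u r] Cons.prems(1) unfolding eq
    by (auto simp: successively_append_iff edge.intros)
qed (simp add: run_path_def)

text \<open>After the ray and the run, the path alternates between \<open>Glue\<close> vertices and
  idle blocks. A \<open>Psh\<close> outside the run is absorbed after its \<open>Pop\<close>, which
  validity guarantees to be outside the run as well.\<close>

theorem valid_run_hamiltonian:
  assumes "valid_run us rs"
  shows "\<exists>v :: int \<Rightarrow> vtx. bij_betw v UNIV verts \<and> (\<forall>i. edge (v i) (v (i + 1)))"
proof -
  have ne: "us \<noteq> []" and len: "length us = length rs" and ini: "ini (hd us)" and fin: "fin (last us)"
    and nxt: "\<And>m. Suc m < length us \<Longrightarrow> nxt (us ! m) (us ! Suc m)"
    and res: "\<And>m. m < length us \<Longrightarrow> res (us ! m) (rs ! m)" and dr: "distinct rs"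
    and pp: "\<And>a b. Pop a b \<in> set rs \<Longrightarrow> Psh a b \<in> set rs"
    using assms by (auto simp: valid_run_def)
  have du: "distinct us"
  proof (unfold distinct_conv_nth, intro allI impI)
    fix i j assume "i < length us" "j < length us" "i \<noteq> j"
    then show "us ! i \<noteq> us ! j" using res[of i] res[of j] res_unique dr len by (metis nth_eq_iff_index_eq)
  qed
  have isr: "\<forall>r\<in>set rs. is_resource r" using res len res_resource by (metis in_set_conv_nth)
  have usU: "u \<in> U" if "u \<in> set us" for u using that res res_U by (metis in_set_conv_nth)
  note srp = set_run_path[OF len]
  have path: "successively edge (run_path us rs)" "run_path us rs \<noteq> []" "hd (run_path us rs) = Part 0 (hd us)"
    "last (run_path us rs) = Part 5 (last us)"
    using successively_run_path[OF len] ne nxt res len by (auto simp: list_all2_conv_all_nth successively_conv_nth)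
  let ?B = "segment us rs"
  have idle: "distinct (idle_blk us rs x)" "successively edge (idle_blk us rs x)"
    "idle_blk us rs x \<noteq> [] \<Longrightarrow> edge (Glue a) (hd (idle_blk us rs x)) \<and> edge (last (idle_blk us rs x)) (Glue b)" for x a b
    by (auto simp: idle_blk_def edge.intros simp del: One_nat_def split: vtx.splits)
  have own: "owner us rs x = n" "x \<in> verts" "x \<notin> range Lft" if "x \<in> set (?B n)" for x n
  proof -
    have "owner us rs x = n \<and> x \<in> verts \<and> x \<notin> range Lft"
    proof (cases n)
      case 0
      have "owner us rs x = 0 \<and> x \<in> verts \<and> x \<notin> range Lft" if "x \<in> set rs"
      proof -
        have "is_resource x" using isr that by blast
        then show ?thesis using that by (cases x) (auto simp: owner_def)
      qed
      moreover have "x = Start \<or> x \<in> set rs \<or> (\<exists>p<6. \<exists>u\<in>set us. x = Part p u)"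
        using that 0 unfolding segment_def by (auto simp: srp)
      ultimately show ?thesis using usU 0 by (auto simp: owner_def)
    next
      case (Suc k)
      then have "x = Glue k \<or> to_nat (from_nat k :: vtx) = k \<and> x \<in> set (idle_blk us rs (from_nat k))"
        using that by (auto simp: segment_def split: if_splits)
      then show ?thesis
      proof
        assume "x = Glue k" then show ?thesis using isr Suc by (auto simp: owner_def)
      next
        assume a: "to_nat (from_nat k :: vtx) = k \<and> x \<in> set (idle_blk us rs (from_nat k))"
        then show ?thesis using isr pp Suc
          by (cases "from_nat k :: vtx") (auto simp: owner_def idle_blk_def split: if_splits)
      qed
    qed
    then show "owner us rs x = n" "x \<in> verts" "x \<notin> range Lft" by auto
  qed
  have cover: "x \<in> set (?B (owner us rs x))" if x: "x \<in> verts" "x \<notin> range Lft" for x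
  proof (cases x)
    case (Part p u)
    then have "p = 0 \<or> p = 1 \<or> p = 2 \<or> p = 3 \<or> p = 4 \<or> p = 5" "u \<in> U" "x \<notin> set rs" using x isr by auto
    moreover have "Part q u \<in> set (run_path us rs)" if "q < 6" "u \<in> set us" for q using that by (auto simp: srp)
    ultimately show ?thesis unfolding Part by (elim disjE) (auto simp: owner_def segment_def idle_blk_def)
  qed (use x in \<open>auto simp: owner_def segment_def srp idle_blk_def dest: pp\<close>)
  have un: "(\<Union>n. set (?B n)) = verts - range Lft"
  proof
    show "(\<Union>n. set (?B n)) \<subseteq> verts - range Lft" using own(2,3) by blast
    show "verts - range Lft \<subseteq> (\<Union>n. set (?B n))" using cover by (meson DiffE UN_I UNIV_I subsetI)
  qed
  have "\<exists>h :: nat \<Rightarrow> vtx. bij_betw h UNIV (\<Union>n. set (?B n)) \<and> (\<forall>i. edge (h i) (h (Suc i))) \<and> h 0 = hd (?B 0)"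
  proof (rule concat_enumeration)
    fix n
    show "?B n \<noteq> []" by (simp add: segment_def split: nat.split)
    show "distinct (?B n)"
    proof (cases n)
      case 0
      have "Start \<notin> set (run_path us rs)" using isr by (auto simp: srp)
      then show ?thesis using 0 distinct_run_path[OF len du dr isr] by (simp add: segment_def)
    next
      case (Suc k)
      have "Glue k \<notin> set (idle_blk us rs y)" for y by (auto simp: idle_blk_def split: vtx.splits)
      then show ?thesis using Suc idle(1) by (simp add: segment_def)
    qed
    show "successively edge (?B n)"
    proof (cases n)
      case 0
      then show ?thesis using path edge.intros(3)[OF ini] by (simp add: segment_def successively_Cons)
    next
      case (Suc k)
      have "successively edge (Glue k # idle_blk us rs y)" for y
        using idle(2)[of y] idle(3)[of y k] by (auto simp: successively_Cons)
      then show ?thesis using Suc by (simp add: segment_def)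
    qed
    have "edge (last (?B n)) (Glue n)"
    proof (cases n)
      case 0
      then show ?thesis using path edge.intros(25)[OF fin] by (simp add: segment_def)
    next
      case (Suc k)
      have "edge (last (Glue k # idle_blk us rs y)) (Glue n)" for y
        using idle(3)[of y k n] edge.intros(4) by auto
      then show ?thesis using Suc edge.intros(4) unfolding segment_def by (simp only: nat.case split: if_split) simp
    qed
    then show "edge (last (?B n)) (hd (?B (Suc n)))" by (simp add: segment_def)
  next
    fix m n :: nat assume "m < n"
    then show "set (?B m) \<inter> set (?B n) = {}" using own(1) by (metis disjoint_iff less_irrefl)
  qed
  then obtain h :: "nat \<Rightarrow> vtx" where h: "bij_betw h UNIV (verts - range Lft)" "\<And>i. edge (h i) (h (Suc i))" "h 0 = Start"
    unfolding un by (auto simp: segment_def)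
  \<comment> \<open>The ray is laid out backwards: \<open>Lft 0\<close> sits at position -1, next to
    \<open>Start\<close>.\<close>
  define v where "v i = (if i < 0 then Lft (nat (- i - 1)) else h (nat i))" for i :: int
  have e: "edge (v i) (v (i + 1))" for i
  proof -
    consider "i < -1" | "i = -1" | "i \<ge> 0" by linarith
    then show ?thesis
    proof cases
      case 3
      then have "nat (i + 1) = Suc (nat i)" by simp
      then show ?thesis using 3 h(2) by (simp add: v_def)
    qed (auto simp: v_def h(3) edge.intros)
  qed
  have hin: "h k \<in> verts" "h k \<notin> range Lft" for k using h(1) by (auto simp: bij_betw_def)
  have "inj v"
  proof (rule injI)
    fix i j assume eq: "v i = v j"
    have ih: "h k = h l \<Longrightarrow> k = l" for k l using h(1) by (auto simp: bij_betw_def dest: injD)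
    have hl: "h k \<noteq> Lft a" "Lft a \<noteq> h k" for k a using hin(2)[of k] rangeI[of Lft a] by metis+
    show "i = j" using eq hl ih[of "nat i" "nat j"] by (auto simp: v_def split: if_splits)
  qed
  moreover have "range v = verts"
  proof
    show "range v \<subseteq> verts" using hin by (auto simp: v_def)
    show "verts \<subseteq> range v"
    proof
      fix x assume x: "x \<in> verts"
      show "x \<in> range v"
      proof (cases "x \<in> range Lft")
        case True
        then obtain a where "x = Lft a" by blast
        then have "x = v (- int a - 1)" by (simp add: v_def)
        then show ?thesis by blast
      next
        case False
        then have "x \<in> range h" using x h(1) by (simp add: bij_betw_def)
        then obtain k where "x = h k" by blast
        then have "x = v (int k)" by (simp add: v_def)
        then show ?thesis by blast
      qed
    qed
  qed
  ultimately show ?thesis using e by (intro exI[of _ v]) (simp add: bij_betw_def)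
qed

end

section \<open>Register machines\<close>

declare One_nat_def [simp del]

text \<open>\<open>Acc r\<close> accepts if register \<open>r\<close> is zero. It has no successor
  configuration in either case, so it always halts.\<close>

datatype instr = Inc nat state | Dec nat state state | Jmp state | Acc nat

type_synonym prog = "(state \<times> instr) list"

text \<open>The value for \<open>Jmp\<close> is a default; register 0 fits every width that occurs
  in a machine.\<close>

primrec reg_of :: "instr \<Rightarrow> nat" where
  "reg_of (Inc r q) = r"
| "reg_of (Dec r q l) = r"
| "reg_of (Jmp q) = 0"
| "reg_of (Acc r) = r"

primrec targets :: "instr \<Rightarrow> state list" where
  "targets (Inc r q) = [q]"
| "targets (Dec r q l) = [q, l]"
| "targets (Jmp q) = [q]"
| "targets (Acc r) = []"

inductive mstep :: "prog \<Rightarrow> state \<times> (nat \<Rightarrow> nat) \<Rightarrow> state \<times> (nat \<Rightarrow> nat) \<Rightarrow> bool" for P where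
  "(q, Inc r q') \<in> set P \<Longrightarrow> mstep P (q, \<rho>) (q', \<rho>(r := Suc (\<rho> r)))"
| "(q, Dec r q' l) \<in> set P \<Longrightarrow> \<rho> r = 0 \<Longrightarrow> mstep P (q, \<rho>) (l, \<rho>)"
| "(q, Dec r q' l) \<in> set P \<Longrightarrow> \<rho> r = Suc n \<Longrightarrow> mstep P (q, \<rho>) (q', \<rho>(r := n))"
| "(q, Jmp q') \<in> set P \<Longrightarrow> mstep P (q, \<rho>) (q', \<rho>)"

text \<open>The states of the input phase (first component not 0) only know registers 0 and 1, so that their
  part of the presentation does not depend on the number \<open>k\<close> of registers.\<close>

definition width :: "nat \<Rightarrow> state \<Rightarrow> nat" where
  "width k q = (if fst q = 0 then k + 2 else 4)"

text \<open>In the data of a step, entry 0 is an auxiliary atom, entry 1 the bottom of all stacks,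
  and entry \<open>r + 2\<close> the top of the stack that represents register \<open>r\<close>.\<close>

definition step_vars :: "nat \<Rightarrow> nat \<Rightarrow> nat option \<Rightarrow> var list" where
  "step_vars w w' upd = map (\<lambda>n. if n = 0 then w else if n = 1 then 1 else if upd = Some (n - 2) then 0
     else if n < w then n else 1) [0..<w']"

definition inst_step :: "(var \<Rightarrow> atom) \<Rightarrow> step \<Rightarrow> step" where
  "inst_step \<sigma> = (\<lambda>(c, q, xs). (c, q, map \<sigma> xs))"

primrec inst :: "(var \<Rightarrow> atom) \<Rightarrow> vtx \<Rightarrow> vtx" where
  "inst \<sigma> (Lft a) = Lft (\<sigma> a)"
| "inst \<sigma> Start = Start"
| "inst \<sigma> (Glue a) = Glue (\<sigma> a)"
| "inst \<sigma> (Tok a) = Tok (\<sigma> a)"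
| "inst \<sigma> (Psh a b) = Psh (\<sigma> a) (\<sigma> b)"
| "inst \<sigma> (Pop a b) = Pop (\<sigma> a) (\<sigma> b)"
| "inst \<sigma> (Part p u) = Part p (inst_step \<sigma> u)"

text \<open>
  Steps come in three kinds: 0 creates a token, 1 pops, 2 pushes the token just created. \<open>Inc\<close> is
  kind 0 followed by kind 2; \<open>Dec\<close> is kind 0 for an empty stack and kind 1 otherwise. A pop needs no
  test for nonemptiness: the initial \<open>Jmp\<close> uses up the token of the bottom atom, so that it is
  never pushed. The patterns below are steps and vertices with variables in place of atoms.
\<close>

fun res_pats :: "nat \<Rightarrow> state \<times> instr \<Rightarrow> (step \<times> vtx) list" where
  "res_pats k (q, Inc r q') = [((0, q, [0..<width k q]), Tok 0), ((2, q, [0..<width k q]), Psh 0 (r + 2))]"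
| "res_pats k (q, Dec r q' l) =
    [((0, q, [0..<width k q][r + 2 := 1]), Tok 0), ((1, q, [0..<width k q]), Pop (r + 2) 0)]"
| "res_pats k (q, Jmp q') = [((0, q, [0..<width k q]), Tok 0)]"
| "res_pats k (q, Acc r) = [((0, q, [0..<width k q][r + 2 := 1]), Tok 0)]"

text \<open>The kind of the entered step is a guess between the two ways of executing
  \<open>Dec\<close>, checked by the resource it has to consume. For the other instructions a step
  of kind 1 consumes nothing, so no run contains it.\<close>

definition enter_pats :: "nat \<Rightarrow> nat \<Rightarrow> state \<Rightarrow> state \<Rightarrow> nat option \<Rightarrow> (step \<times> step) list" where
  "enter_pats k c q q' upd =
    [((c, q, [0..<width k q]), (0, q', step_vars (width k q) (width k q') upd)),
     ((c, q, [0..<width k q]), (1, q', step_vars (width k q) (width k q') upd))]"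

fun nxt_pats :: "nat \<Rightarrow> state \<times> instr \<Rightarrow> (step \<times> step) list" where
  "nxt_pats k (q, Inc r q') = ((0, q, [0..<width k q]), (2, q, [0..<width k q])) # enter_pats k 2 q q' (Some r)"
| "nxt_pats k (q, Dec r q' l) = enter_pats k 0 q l None @ enter_pats k 1 q q' (Some r)"
| "nxt_pats k (q, Jmp q') = enter_pats k 0 q q' None"
| "nxt_pats k (q, Acc r) = []"

fun fin_pats :: "nat \<Rightarrow> state \<times> instr \<Rightarrow> step list" where
  "fin_pats k (q, Acc r) = [(0, q, [0..<width k q])]"
| "fin_pats k _ = []"

text \<open>Widths may only grow along jumps, since a register dropped from the data would lose its
  stack. An initial width of 4 makes the first data four copies of the bottom atom: both known
  registers are empty, and the auxiliary atom is the bottom itself.\<close>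

locale machine =
  fixes k :: nat and P :: prog and q0 q1 :: state
  assumes k: "k \<ge> 2"
    and q0: "(q0, Jmp q1) \<in> set P" and width_q0: "width k q0 = 4"
    and functional: "(q, i) \<in> set P \<Longrightarrow> (q, i') \<in> set P \<Longrightarrow> i = i'"
    and targets_in: "(q, i) \<in> set P \<Longrightarrow> q' \<in> set (targets i) \<Longrightarrow> q' \<in> fst ` set P \<and> width k q \<le> width k q'"
    and reg_width: "(q, i) \<in> set P \<Longrightarrow> reg_of i + 2 < width k q"
begin

definition steps :: "step set" where
  "steps = {(c, q, as). c < 3 \<and> q \<in> fst ` set P \<and> length as = width k q}"
definition start_pat :: step where "start_pat = (0, q0, [0, 0, 0, 0])"
definition mini :: "step \<Rightarrow> bool" where
  "mini u \<longleftrightarrow> (\<exists>\<sigma>. u = inst_step \<sigma> start_pat)"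
definition mfin :: "step \<Rightarrow> bool" where
  "mfin u \<longleftrightarrow> (\<exists>b\<in>set P. \<exists>s\<in>set (fin_pats k b). \<exists>\<sigma>. u = inst_step \<sigma> s)"
definition mnxt :: "step \<Rightarrow> step \<Rightarrow> bool" where
  "mnxt u u' \<longleftrightarrow> (\<exists>b\<in>set P. \<exists>(s, s')\<in>set (nxt_pats k b). \<exists>\<sigma>. u = inst_step \<sigma> s \<and> u' = inst_step \<sigma> s')"
definition mres :: "step \<Rightarrow> vtx \<Rightarrow> bool" where
  "mres u x \<longleftrightarrow> (\<exists>b\<in>set P. \<exists>(s, y)\<in>set (res_pats k b). \<exists>\<sigma>. u = inst_step \<sigma> s \<and> x = inst \<sigma> y)"

end

section \<open>The relations described by the patterns\<close>

lemma width_ge: "k \<ge> 2 \<Longrightarrow> width k q \<ge> 4"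
  by (simp add: width_def)

lemma length_step_vars [simp]: "length (step_vars w w' upd) = w'"
  by (simp add: step_vars_def)

lemma list_as_map: "length as = w \<Longrightarrow> \<exists>\<sigma>. as = map \<sigma> [0..<w]"
  by (metis map_nth)

text \<open>What \<open>step_vars\<close> imposes on the next data. Entry 0 stays open, so that the
  next auxiliary atom can be guessed; registers unknown to a narrower state start with the bottom
  atom, that is, with an empty stack.\<close>

definition follows :: "nat \<Rightarrow> nat \<Rightarrow> nat option \<Rightarrow> atom list \<Rightarrow> atom list \<Rightarrow> bool" where
  "follows w w' upd as as' \<longleftrightarrow> length as = w \<and> length as' = w' \<and> as' ! 1 = as ! 1 \<and>
    (\<forall>r. r + 2 < w' \<longrightarrow> as' ! (r + 2) =
      (if upd = Some r then as ! 0 else if r + 2 < w then as ! (r + 2) else as ! 1))"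

lemma step_vars_iff:
  assumes "w \<ge> 2" "w' \<ge> 2"
  shows "(\<exists>\<sigma>. as = map \<sigma> [0..<w] \<and> as' = map \<sigma> (step_vars w w' upd)) \<longleftrightarrow> follows w w' upd as as'"
proof
  assume "\<exists>\<sigma>. as = map \<sigma> [0..<w] \<and> as' = map \<sigma> (step_vars w w' upd)"
  then show "follows w w' upd as as'" using assms by (auto simp: follows_def step_vars_def)
next
  assume f: "follows w w' upd as as'"
  \<comment> \<open>The only variable outside the old data is \<open>w\<close>, which stands for the
    open entry 0 of the new data.\<close>
  define \<sigma> where "\<sigma> v = (if v < w then as ! v else as' ! 0)" for v
  have "as = map \<sigma> [0..<w]" using f by (intro nth_equalityI) (auto simp: \<sigma>_def follows_def)
  moreover have "as' = map \<sigma> (step_vars w w' upd)"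
  proof (rule nth_equalityI)
    fix n assume n: "n < length as'"
    have l: "length as' = w'" using f by (simp add: follows_def)
    show "as' ! n = map \<sigma> (step_vars w w' upd) ! n"
    proof (cases "n < 2")
      case True
      then have "n = 0 \<or> n = 1" by auto
      then show ?thesis using n l f assms by (auto simp: \<sigma>_def step_vars_def follows_def)
    next
      case False
      then obtain r where "n = r + 2" by (metis le_add_diff_inverse2 not_less)
      then show ?thesis using n l f assms by (auto simp: \<sigma>_def step_vars_def follows_def)
    qed
  qed (use f in \<open>simp add: follows_def\<close>)
  ultimately show "\<exists>\<sigma>. as = map \<sigma> [0..<w] \<and> as' = map \<sigma> (step_vars w w' upd)" by blast
qed

context machine begin

lemma width2: "width k q \<ge> 4" by (rule width_ge[OF k])

lemma mini_iff: "mini u \<longleftrightarrow> (\<exists>z. u = (0, q0, [z, z, z, z]))"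
  by (auto simp: mini_def start_pat_def inst_step_def)

lemma mfin_iff: "mfin (c, q, as) \<longleftrightarrow> (\<exists>r. (q, Acc r) \<in> set P \<and> c = 0 \<and> length as = width k q)"
proof
  assume "mfin (c, q, as)"
  then obtain q' i s \<sigma> where "(q', i) \<in> set P" "s \<in> set (fin_pats k (q', i))" "(c, q, as) = inst_step \<sigma> s"
    by (auto simp: mfin_def)
  then show "\<exists>r. (q, Acc r) \<in> set P \<and> c = 0 \<and> length as = width k q"
    by (cases i) (auto simp: inst_step_def)
next
  assume "\<exists>r. (q, Acc r) \<in> set P \<and> c = 0 \<and> length as = width k q"
  then obtain r \<sigma> where "(q, Acc r) \<in> set P" "c = 0" "as = map \<sigma> [0..<width k q]" using list_as_map by blast
  then show "mfin (c, q, as)"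
    unfolding mfin_def by (intro bexI[of _ "(q, Acc r)"] bexI[of _ "(0, q, [0..<width k q])"]) (auto simp: inst_step_def)
qed

lemma enter_iff:
  "(\<exists>(s, s')\<in>set (enter_pats k c q q' upd). \<exists>\<sigma>. u = inst_step \<sigma> s \<and> u' = inst_step \<sigma> s') \<longleftrightarrow>
   (\<exists>as as' c'. u = (c, q, as) \<and> u' = (c', q', as') \<and> c' < 2 \<and> follows (width k q) (width k q') upd as as')"
  (is "?L \<longleftrightarrow> ?R")
proof -
  have w: "width k q \<ge> 2" "width k q' \<ge> 2" using width2[of q] width2[of q'] by auto
  have "?L \<longleftrightarrow> (\<exists>c' as as'. u = (c, q, as) \<and> u' = (c', q', as') \<and> (c' = 0 \<or> c' = 1) \<and>
     (\<exists>\<sigma>. as = map \<sigma> [0..<width k q] \<and> as' = map \<sigma> (step_vars (width k q) (width k q') upd)))"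
    unfolding enter_pats_def inst_step_def by auto
  also have "\<dots> \<longleftrightarrow> ?R"
    unfolding step_vars_iff[OF w] by (auto simp: less_2_cases_iff)
  finally show ?thesis .
qed

text \<open>This relation and \<open>consumes\<close> below are free of patterns and valuations, so
  that runs can be analysed by rule inversion.\<close>

inductive follow :: "step \<Rightarrow> step \<Rightarrow> bool" where
  inc1: "(q, Inc r q') \<in> set P \<Longrightarrow> length as = width k q \<Longrightarrow> follow (0, q, as) (2, q, as)"
| inc2: "(q, Inc r q') \<in> set P \<Longrightarrow> c' < 2 \<Longrightarrow> follows (width k q) (width k q') (Some r) as as' \<Longrightarrow>
     follow (2, q, as) (c', q', as')"
| zero: "(q, Dec r q' l) \<in> set P \<Longrightarrow> c' < 2 \<Longrightarrow> follows (width k q) (width k l) None as as' \<Longrightarrow>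
     follow (0, q, as) (c', l, as')"
| dec: "(q, Dec r q' l) \<in> set P \<Longrightarrow> c' < 2 \<Longrightarrow> follows (width k q) (width k q') (Some r) as as' \<Longrightarrow>
     follow (1, q, as) (c', q', as')"
| jmp: "(q, Jmp q') \<in> set P \<Longrightarrow> c' < 2 \<Longrightarrow> follows (width k q) (width k q') None as as' \<Longrightarrow>
     follow (0, q, as) (c', q', as')"

lemma mnxt_iff: "mnxt u u' \<longleftrightarrow> follow u u'"
proof
  assume "mnxt u u'"
  then obtain q i where b: "(q, i) \<in> set P"
    and e: "\<exists>(s, s')\<in>set (nxt_pats k (q, i)). \<exists>\<sigma>. u = inst_step \<sigma> s \<and> u' = inst_step \<sigma> s'"
    unfolding mnxt_def by fast
  show "follow u u'"
  proof (cases i)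
    case (Inc r q')
    show ?thesis
    proof (cases "\<exists>(s, s')\<in>set (enter_pats k 2 q q' (Some r)). \<exists>\<sigma>. u = inst_step \<sigma> s \<and> u' = inst_step \<sigma> s'")
      case True
      then show ?thesis using b Inc unfolding enter_iff by (auto intro: follow.intros)
    next
      case False
      then have "\<exists>\<sigma>. u = inst_step \<sigma> (0, q, [0..<width k q]) \<and> u' = inst_step \<sigma> (2, q, [0..<width k q])"
        using e Inc by auto
      then show ?thesis using b Inc by (auto simp: inst_step_def intro: follow.intros)
    qed
  next
    case (Dec r q' l)
    then have "(\<exists>(s, s')\<in>set (enter_pats k 0 q l None). \<exists>\<sigma>. u = inst_step \<sigma> s \<and> u' = inst_step \<sigma> s') \<or>
      (\<exists>(s, s')\<in>set (enter_pats k 1 q q' (Some r)). \<exists>\<sigma>. u = inst_step \<sigma> s \<and> u' = inst_step \<sigma> s')"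
      using e by auto
    then show ?thesis using b Dec unfolding enter_iff by (auto intro: follow.intros)
  next
    case (Jmp q')
    then show ?thesis using b e by (simp only: nxt_pats.simps enter_iff) (auto intro: follow.intros)
  next
    case (Acc r)
    then show ?thesis using e by simp
  qed
next
  have I: "mnxt u u'" if "(q, i) \<in> set P" "\<exists>(s, s')\<in>set (nxt_pats k (q, i)). \<exists>\<sigma>. u = inst_step \<sigma> s \<and> u' = inst_step \<sigma> s'" for q i
    using that unfolding mnxt_def by fast
  assume "follow u u'"
  then show "mnxt u u'"
  proof cases
    case (inc1 q r q' as)
    then obtain \<sigma> where "as = map \<sigma> [0..<width k q]" using list_as_map by blast
    then show ?thesis using inc1 by (intro I[OF inc1(3)]) (auto simp: inst_step_def)
  next
    case (inc2 q r q' c' as as')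
    then have "\<exists>(s, s')\<in>set (enter_pats k 2 q q' (Some r)). \<exists>\<sigma>. u = inst_step \<sigma> s \<and> u' = inst_step \<sigma> s'"
      unfolding enter_iff by blast
    then show ?thesis by (intro I[OF inc2(3)]) auto
  next
    case (zero q r q' l c' as as')
    then have "\<exists>(s, s')\<in>set (enter_pats k 0 q l None). \<exists>\<sigma>. u = inst_step \<sigma> s \<and> u' = inst_step \<sigma> s'"
      unfolding enter_iff by blast
    then show ?thesis by (intro I[OF zero(3)]) auto
  next
    case (dec q r q' l c' as as')
    then have "\<exists>(s, s')\<in>set (enter_pats k 1 q q' (Some r)). \<exists>\<sigma>. u = inst_step \<sigma> s \<and> u' = inst_step \<sigma> s'"
      unfolding enter_iff by blast
    then show ?thesis by (intro I[OF dec(3)]) auto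
  next
    case (jmp q q' c' as as')
    then have "\<exists>(s, s')\<in>set (enter_pats k 0 q q' None). \<exists>\<sigma>. u = inst_step \<sigma> s \<and> u' = inst_step \<sigma> s'"
      unfolding enter_iff by blast
    then show ?thesis by (intro I[OF jmp(3)]) auto
  qed
qed

inductive consumes :: "step \<Rightarrow> vtx \<Rightarrow> bool" where
  "(q, Inc r q') \<in> set P \<Longrightarrow> length as = width k q \<Longrightarrow> consumes (0, q, as) (Tok (as ! 0))"
| "(q, Inc r q') \<in> set P \<Longrightarrow> length as = width k q \<Longrightarrow> consumes (2, q, as) (Psh (as ! 0) (as ! (r + 2)))"
| "(q, Dec r q' l) \<in> set P \<Longrightarrow> length as = width k q \<Longrightarrow> as ! (r + 2) = as ! 1 \<Longrightarrow> consumes (0, q, as) (Tok (as ! 0))"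
| "(q, Dec r q' l) \<in> set P \<Longrightarrow> length as = width k q \<Longrightarrow> consumes (1, q, as) (Pop (as ! (r + 2)) (as ! 0))"
| "(q, Jmp q') \<in> set P \<Longrightarrow> length as = width k q \<Longrightarrow> consumes (0, q, as) (Tok (as ! 0))"
| "(q, Acc r) \<in> set P \<Longrightarrow> length as = width k q \<Longrightarrow> as ! (r + 2) = as ! 1 \<Longrightarrow> consumes (0, q, as) (Tok (as ! 0))"

lemma mres_iff: "mres u x \<longleftrightarrow> consumes u x"
proof
  assume "mres u x"
  then obtain q i s y \<sigma> where b: "(q, i) \<in> set P" and s: "(s, y) \<in> set (res_pats k (q, i))"
    and u: "u = inst_step \<sigma> s" "x = inst \<sigma> y"
    unfolding mres_def by fast
  have w: "reg_of i + 2 < width k q" "4 \<le> width k q" by (rule reg_width[OF b], rule width2)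
  show "consumes u x"
  proof (cases i)
    case (Inc r q')
    then show ?thesis using b s u w consumes.intros(1,2)[of q r q' "map \<sigma> [0..<width k q]"]
      by (auto simp: inst_step_def)
  next
    case (Dec r q' l)
    then show ?thesis using b s u w consumes.intros(3)[of q r q' l "map \<sigma> ([0..<width k q][r + 2 := 1])"]
        consumes.intros(4)[of q r q' l "map \<sigma> [0..<width k q]"]
      by (auto simp: inst_step_def)
  next
    case (Jmp q')
    then show ?thesis using b s u w consumes.intros(5)[of q q' "map \<sigma> [0..<width k q]"]
      by (auto simp: inst_step_def)
  next
    case (Acc r)
    then show ?thesis using b s u w consumes.intros(6)[of q r "map \<sigma> ([0..<width k q][r + 2 := 1])"]
      by (auto simp: inst_step_def)
  qed
next
  have I: "mres (c, q, map \<sigma> xs) (inst \<sigma> y)" if "(q, i) \<in> set P" "((c, q, xs), y) \<in> set (res_pats k (q, i))" for c q i \<sigma> y xs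
    unfolding mres_def by (rule bexI[OF _ that(1)], rule bexI[OF _ that(2)]) (auto simp: inst_step_def)
  have upd: "as = map ((!) as) ([0..<width k q][r + 2 := 1])"
    if "length as = width k q" "as ! (r + 2) = as ! 1" for as q and r :: nat
  proof (rule nth_equalityI)
    fix i assume "i < length as"
    then show "as ! i = map ((!) as) ([0..<width k q][r + 2 := 1]) ! i"
      using that width2[of q] by (cases "i = r + 2") simp_all
  qed (use that in simp)
  have id: "as = map ((!) as) [0..<width k q]" if "length as = width k q" for as q
    using that by (metis map_nth)
  assume "consumes u x"
  then show "mres u x"
  proof cases
    case (1 q r q' as)
    then show ?thesis using I[of q _ 0 "[0..<width k q]" "Tok 0" "(!) as"] id[of as q] by auto
  next
    case (2 q r q' as)
    then show ?thesis using I[of q _ 2 "[0..<width k q]" "Psh 0 (r + 2)" "(!) as"] id[of as q] by auto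
  next
    case (3 q r q' l as)
    then show ?thesis using I[of q _ 0 "[0..<width k q][r + 2 := 1]" "Tok 0" "(!) as"] upd[of as q r] by auto
  next
    case (4 q r q' l as)
    then show ?thesis using I[of q _ 1 "[0..<width k q]" "Pop (r + 2) 0" "(!) as"] id[of as q] by auto
  next
    case (5 q q' as)
    then show ?thesis using I[of q _ 0 "[0..<width k q]" "Tok 0" "(!) as"] id[of as q] by auto
  next
    case (6 q r as)
    then show ?thesis using I[of q _ 0 "[0..<width k q][r + 2 := 1]" "Tok 0" "(!) as"] upd[of as q r] by auto
  qed
qed

sublocale step_system steps mini mfin mnxt mres
proof
  have q0P: "q0 \<in> fst ` set P" using q0 by force
  show "mini u \<Longrightarrow> u \<in> steps" for u using q0P width_q0 by (auto simp: mini_iff steps_def)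
  show "mfin u \<Longrightarrow> u \<in> steps" for u by (cases u) (force simp: mfin_iff steps_def)
  show "mnxt u u' \<Longrightarrow> u \<in> steps \<and> u' \<in> steps" for u u'
    unfolding mnxt_iff
  proof (induction rule: follow.induct)
    case (inc1 q r q' as) then show ?case by (force simp: steps_def)
  next
    case (inc2 q r q' c' as as') then show ?case using targets_in[OF inc2(1), of q'] by (force simp: steps_def follows_def)
  next
    case (zero q r q' l c' as as') then show ?case using targets_in[OF zero(1), of l] by (force simp: steps_def follows_def)
  next
    case (dec q r q' l c' as as') then show ?case using targets_in[OF dec(1), of q'] by (force simp: steps_def follows_def)
  next
    case (jmp q q' c' as as') then show ?case using targets_in[OF jmp(1), of q'] by (force simp: steps_def follows_def)
  qed
  show "mres u x \<Longrightarrow> u \<in> steps" for u x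
    unfolding mres_iff by (induction rule: consumes.induct) (force simp: steps_def)+
  show "mres u x \<Longrightarrow> is_resource x" for u x
    unfolding mres_iff by (auto elim: consumes.cases)
  show "mres u x \<Longrightarrow> mres u y \<Longrightarrow> x = y" for u x y
    unfolding mres_iff by (erule consumes.cases; erule consumes.cases; simp) (auto dest: functional)
qed

end

section \<open>From a run to an accepting computation\<close>

primrec top_of :: "atom \<Rightarrow> atom list \<Rightarrow> atom" where
  "top_of z [] = z"
| "top_of z (a # s) = a"

text \<open>With \<open>R\<close> the resources of a run, these pushes are the only record of what
  lies below the top of a stack.\<close>

primrec linked :: "vtx set \<Rightarrow> atom \<Rightarrow> atom list \<Rightarrow> bool" where
  "linked R z [] = True"
| "linked R z (a # s) = (Psh a (top_of z s) \<in> R \<and> linked R z s)"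

text \<open>Registers beyond the width count as empty, in accordance with
  \<open>follows\<close>.\<close>

definition reg :: "atom list \<Rightarrow> nat \<Rightarrow> atom" where
  "reg as r = (if r + 2 < length as then as ! (r + 2) else as ! 1)"

lemma reg_follows:
  assumes "follows w w' upd as as'" "w \<le> w'" "\<And>r'. upd = Some r' \<Longrightarrow> r' + 2 < w"
  shows "reg as' r = (if upd = Some r then as ! 0 else reg as r)" "as' ! 1 = as ! 1"
  using assms(1,2) assms(3)[of r] by (auto simp: follows_def reg_def)

context machine begin

context
  fixes us rs
  assumes run: "valid_run us rs"
begin

lemma run_facts:
  shows "us \<noteq> []" "length rs = length us" "mini (us ! 0)" "mfin (us ! (length us - 1))" "distinct rs"
    "\<And>m. Suc m < length us \<Longrightarrow> follow (us ! m) (us ! Suc m)"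
    "\<And>m. m < length us \<Longrightarrow> consumes (us ! m) (rs ! m)"
    "\<And>a b. Pop a b \<in> set rs \<Longrightarrow> Psh a b \<in> set rs"
proof -
  note D = run[unfolded valid_run_def mnxt_iff mres_iff]
  show ne: "us \<noteq> []" "length rs = length us" "distinct rs" using D by blast+
  show "mini (us ! 0)" using D by (metis hd_conv_nth)
  show "mfin (us ! (length us - 1))" using D by (metis last_conv_nth)
  show "\<And>m. Suc m < length us \<Longrightarrow> follow (us ! m) (us ! Suc m)" using D by blast
  show "\<And>m. m < length us \<Longrightarrow> consumes (us ! m) (rs ! m)" using D by blast
  show "\<And>a b. Pop a b \<in> set rs \<Longrightarrow> Psh a b \<in> set rs" using D by blast
qed

text \<open>Only kind 2 consumes a push. The run starts with kind 0, and kind 2 is entered only from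
  kind 0 of the same \<open>Inc\<close> with the same data, whose resource is the token of the
  pushed atom.\<close>

lemma push_origin:
  assumes "Psh a b \<in> set rs"
  obtains m q r q' as where "Suc m < length us" "rs ! Suc m = Psh a b" "rs ! m = Tok a"
    "us ! m = (0, q, as)" "us ! Suc m = (2, q, as)" "(q, Inc r q') \<in> set P"
proof -
  obtain n where n: "n < length us" "rs ! n = Psh a b"
    using assms run_facts(2) by (auto simp: in_set_conv_nth)
  have c: "consumes (us ! n) (Psh a b)" using run_facts(7)[OF n(1)] n(2) by simp
  from c obtain q r q' as where u: "us ! n = (2, q, as)" "a = as ! 0" by (cases) auto
  have "n \<noteq> 0"
  proof
    assume "n = 0"
    then show False using run_facts(3) u by (auto simp: mini_iff)
  qed
  then obtain m where m: "n = Suc m" by (cases n) auto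
  have "follow (us ! m) (2, q, as)" using run_facts(6)[of m] n(1) m u by simp
  then obtain r' q'' where p: "us ! m = (0, q, as)" "(q, Inc r' q'') \<in> set P"
    by cases auto
  have "consumes (us ! m) (rs ! m)" using run_facts(7) n(1) m by simp
  then have "rs ! m = Tok a" using p(1) u unfolding p(1) by cases (auto dest: functional[OF p(2)])
  then show ?thesis using that n m u p by blast
qed

definition bottom :: atom where "bottom = (THE z. us ! 0 = (0, q0, [z, z, z, z]))"

lemma first_step: "us ! 0 = (0, q0, [bottom, bottom, bottom, bottom])"
proof -
  obtain z where z: "us ! 0 = (0, q0, [z, z, z, z])" using run_facts(3) mini_iff by blast
  then have "bottom = z" unfolding bottom_def by (intro the_equality) simp_all
  then show ?thesis using z by argo
qed

text \<open>A token is consumed once, so \<open>a\<close> has a single creating step and with it a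
  single push. The token of \<open>bottom\<close> went to the initial \<open>Jmp\<close>, which is
  followed by no push of it.\<close>

lemma push_unique:
  assumes "Psh a b \<in> set rs"
  shows "a \<noteq> bottom" "Psh a b' \<in> set rs \<Longrightarrow> b' = b"
proof -
  note nth_eq = nth_eq_iff_index_eq[OF run_facts(5)]
  obtain m q r q' as where m: "Suc m < length us" "rs ! Suc m = Psh a b" "rs ! m = Tok a"
    "us ! m = (0, q, as)" "(q, Inc r q') \<in> set P" using push_origin[OF assms] by metis
  show "a \<noteq> bottom"
  proof
    assume a: "a = bottom"
    have l: "0 < length us" using run_facts(1) by simp
    have "consumes (0, q0, [bottom, bottom, bottom, bottom]) (rs ! 0)" using run_facts(7)[OF l] first_step by argo
    then have "rs ! 0 = Tok bottom" by cases (auto dest: functional[OF q0])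
    then have "m = 0" using a m run_facts(2) l nth_eq[of m 0] by simp
    then have "q = q0" using m first_step by simp
    then show False using m(5) q0 functional by blast
  qed
  assume "Psh a b' \<in> set rs"
  then obtain m' where m': "Suc m' < length us" "rs ! Suc m' = Psh a b'" "rs ! m' = Tok a"
    using push_origin by metis
  then have "m = m'" using m run_facts(2) nth_eq[of m m'] by simp
  then show "b' = b" using m(2) m'(2) by simp
qed

definition represents :: "atom list \<Rightarrow> (nat \<Rightarrow> nat) \<Rightarrow> (nat \<Rightarrow> atom list) \<Rightarrow> bool" where
  "represents as \<rho> stk \<longleftrightarrow> as ! 1 = bottom \<and> (\<forall>r. length (stk r) = \<rho> r \<and> linked (set rs) bottom (stk r) \<and>
     reg as r = top_of bottom (stk r))"

text \<open>A nonempty stack with \<open>bottom\<close> on top would require a push of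
  \<open>bottom\<close>.\<close>

lemma represents_zero:
  assumes "represents as \<rho> stk" "reg as r = bottom"
  shows "\<rho> r = 0"
proof (cases "stk r")
  case Nil
  then show ?thesis using assms(1) unfolding represents_def by (metis list.size(3))
next
  case (Cons a s)
  have "linked (set rs) bottom (stk r)" "reg as r = top_of bottom (stk r)"
    using assms(1) by (simp_all add: represents_def)
  then have "Psh a (top_of bottom s) \<in> set rs" "a = bottom" using assms(2) Cons by simp_all
  then show ?thesis using push_unique(1) by blast
qed

text \<open>The stacks are reconstructed along the run, as the data show only their tops. The
  invariant describes the configuration on arrival in the state, so the first half of
  \<open>Inc\<close> leaves it unchanged.\<close>

lemma run_simulated:
  "m < length us \<Longrightarrow> us ! m = (c, q, as) \<Longrightarrow>
   \<exists>\<rho> stk. (mstep P)\<^sup>*\<^sup>* (q0, \<lambda>_. 0) (q, \<rho>) \<and> represents as \<rho> stk"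
proof (induction m arbitrary: c q as)
  case 0
  then have "(c, q, as) = (0, q0, [bottom, bottom, bottom, bottom])" using first_step by argo
  then have "q = q0" "as = [bottom, bottom, bottom, bottom]" by blast+
  moreover have "represents [bottom, bottom, bottom, bottom] (\<lambda>_. 0) (\<lambda>_. [])"
    by (auto simp: represents_def reg_def nth_Cons' numeral_eq_Suc One_nat_def)
  ultimately show ?case by blast
next
  case (Suc m)
  obtain c' p bs where um: "us ! m = (c', p, bs)" by (cases "us ! m") auto
  obtain \<rho> stk where st: "(mstep P)\<^sup>*\<^sup>* (q0, \<lambda>_. 0) (p, \<rho>)" and rep: "represents bs \<rho> stk"
    using Suc.IH[OF _ um] Suc.prems(1) by auto
  have z: "bs ! 1 = bottom" using rep by (simp add: represents_def)
  have fo: "follow (c', p, bs) (c, q, as)" using run_facts(6)[OF Suc.prems(1)] um Suc.prems(2) by simp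
  have co: "consumes (c', p, bs) (rs ! m)" using run_facts(7)[of m] Suc.prems(1) um by simp
  have rsm: "rs ! m \<in> set rs" using Suc.prems(1) run_facts(2) by simp
  have W: "width k p \<le> width k q" if "(p, i) \<in> set P" "q \<in> set (targets i)" for i
    using targets_in[OF that] by simp
  have R: "reg bs r = bs ! (r + 2)" if "(p, i) \<in> set P" "r = reg_of i" "length bs = width k p" for i r
    using reg_width[OF that(1)] that by (simp add: reg_def)
  have keep: "represents as \<rho> stk" if "follows (width k p) (width k q) None bs as" "width k p \<le> width k q"
    using rep reg_follows[OF that] by (auto simp: represents_def)
  have ext: "\<exists>\<rho> stk. (mstep P)\<^sup>*\<^sup>* (q0, \<lambda>_. 0) (q, \<rho>) \<and> represents as \<rho> stk"
    if "mstep P (p, \<rho>) (q, \<rho>')" "represents as \<rho>' stk'" for \<rho>' stk'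
    using st that by (meson rtranclp.rtrancl_into_rtrancl)
  from fo show ?case
  proof cases
    case (inc1 r q')
    then show ?thesis using st rep by blast
  next
    case (inc2 r)
    have len: "length bs = width k p" using inc2(4) by (simp add: follows_def)
    have "rs ! m = Psh (bs ! 0) (bs ! (r + 2))"
      using co inc2 by cases (auto dest: functional[OF inc2(2)])
    then have "Psh (bs ! 0) (top_of bottom (stk r)) \<in> set rs"
      using rsm R[OF inc2(2) _ len, of r] rep by (simp add: represents_def)
    moreover have "reg as r' = (if r' = r then bs ! 0 else reg bs r')" "as ! 1 = bottom" for r'
      using reg_follows[OF inc2(4) W[OF inc2(2)]] reg_width[OF inc2(2)] inc2 z by auto
    ultimately have "represents as (\<rho>(r := Suc (\<rho> r))) (stk(r := (bs ! 0) # stk r))"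
      using rep by (auto simp: represents_def)
    then show ?thesis using ext mstep.intros(1) inc2 by metis
  next
    case (zero r q')
    have len: "length bs = width k p" using zero by (simp add: follows_def)
    have "bs ! (r + 2) = bs ! 1" using co zero by cases (auto dest: functional[OF zero(2)])
    then have "\<rho> r = 0" using represents_zero[OF rep] R[OF zero(2) _ len, of r] z by simp
    then have "mstep P (p, \<rho>) (q, \<rho>)" using mstep.intros(2) zero by metis
    then show ?thesis using ext keep W[OF zero(2)] zero by auto
  next
    case (dec r l)
    have len: "length bs = width k p" using dec by (simp add: follows_def)
    have "rs ! m = Pop (bs ! (r + 2)) (bs ! 0)" using co dec by cases (auto dest: functional[OF dec(2)])
    then have psh: "Psh (reg bs r) (bs ! 0) \<in> set rs"
      using run_facts(8) rsm R[OF dec(2) _ len, of r] by simp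
    have top: "reg bs r = top_of bottom (stk r)" and lk: "linked (set rs) bottom (stk r)" and ln: "length (stk r) = \<rho> r"
      using rep by (simp_all add: represents_def)
    have "stk r \<noteq> []" using push_unique(1)[OF psh] top by (metis top_of.simps(1))
    then obtain a s where s: "stk r = a # s" by (cases "stk r") simp_all
    \<comment> \<open>Both the guessed atom \<open>bs ! 0\<close> and the atom really under the top
      were covered by a push of the same atom, so they are equal.\<close>
    have "Psh (reg bs r) (top_of bottom s) \<in> set rs" using lk top s by simp
    from push_unique(2)[OF psh this] have b: "bs ! 0 = top_of bottom s" by (rule sym)
    have "reg as r' = (if r' = r then bs ! 0 else reg bs r')" "as ! 1 = bottom" for r'
      using reg_follows[OF dec(4) W[OF dec(2)]] reg_width[OF dec(2)] dec z by auto
    then have "represents as (\<rho>(r := length s)) (stk(r := s))"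
      using rep s b lk by (auto simp: represents_def)
    moreover have "mstep P (p, \<rho>) (q, \<rho>(r := length s))"
      using mstep.intros(3)[of p r q l P \<rho> "length s"] dec ln s by simp
    ultimately show ?thesis using ext by blast
  next
    case jmp
    then have "mstep P (p, \<rho>) (q, \<rho>)" using mstep.intros(4) by metis
    then show ?thesis using ext keep W[OF jmp(2)] jmp by auto
  qed
qed

theorem valid_run_accepts:
  "\<exists>q \<rho> r. (mstep P)\<^sup>*\<^sup>* (q0, \<lambda>_. 0) (q, \<rho>) \<and> (q, Acc r) \<in> set P \<and> \<rho> r = 0"
proof -
  define m where "m = length us - 1"
  have m: "m < length us" using run_facts(1) by (simp add: m_def)
  obtain c q as where u: "us ! m = (c, q, as)" by (cases "us ! m") auto
  obtain \<rho> stk where st: "(mstep P)\<^sup>*\<^sup>* (q0, \<lambda>_. 0) (q, \<rho>)" and rep: "represents as \<rho> stk"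
    using run_simulated[OF m u] by blast
  obtain r where r: "(q, Acc r) \<in> set P" "c = 0" "length as = width k q"
    using run_facts(4) u by (auto simp: m_def mfin_iff)
  have "consumes (0, q, as) (rs ! m)" using run_facts(7)[OF m] u r by simp
  then have "as ! (r + 2) = as ! 1" by cases (auto dest: functional[OF r(1)])
  moreover have "r + 2 < length as" using reg_width[OF r(1)] r by simp
  ultimately have "reg as r = bottom" using rep by (simp add: reg_def represents_def)
  then show ?thesis using represents_zero[OF rep] st r by blast
qed

end
end

section \<open>From an accepting computation to a run\<close>

context machine begin

definition data :: "atom \<Rightarrow> atom \<Rightarrow> (nat \<Rightarrow> atom) \<Rightarrow> nat \<Rightarrow> atom list" where
  "data a z f w = a # z # map f [0..<w - 2]"

lemma data_simps [simp]:
  "w \<ge> 2 \<Longrightarrow> length (data a z f w) = w" "data a z f w ! 0 = a" "data a z f w ! 1 = z"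
  "r + 2 < w \<Longrightarrow> data a z f w ! (r + 2) = f r" "Suc (Suc r) < w \<Longrightarrow> data a z f w ! Suc (Suc r) = f r"
  by (auto simp: data_def One_nat_def)

lemma follows_data:
  assumes "4 \<le> w" "w \<le> w'" "\<And>r. w \<le> r + 2 \<Longrightarrow> f r = z" "\<And>r. r + 2 < w' \<Longrightarrow> f' r = (if upd = Some r then a else f r)"
  shows "follows w w' upd (data a z f w) (data a' z f' w')"
  unfolding follows_def using assms by auto

definition partial_run :: "step list \<Rightarrow> vtx list \<Rightarrow> bool" where
  "partial_run us rs \<longleftrightarrow> us \<noteq> [] \<and> length rs = length us \<and> mini (hd us) \<and>
     (\<forall>m. Suc m < length us \<longrightarrow> mnxt (us ! m) (us ! Suc m)) \<and>
     (\<forall>m < length us. mres (us ! m) (rs ! m)) \<and> distinct rs \<and>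
     (\<forall>a b. Pop a b \<in> set rs \<longrightarrow> Psh a b \<in> set rs)"

lemma partial_run_snoc:
  assumes "partial_run us rs" "follow (last us) u" "consumes u x" "x \<notin> set rs"
    "\<And>a b. x = Pop a b \<Longrightarrow> Psh a b \<in> set rs"
  shows "partial_run (us @ [u]) (rs @ [x])"
proof -
  have ne: "us \<noteq> []" and len: "length rs = length us" using assms(1) by (auto simp: partial_run_def)
  have "mnxt ((us @ [u]) ! m) ((us @ [u]) ! Suc m)" if "Suc m < length (us @ [u])" for m
  proof (cases "Suc m < length us")
    case True
    then show ?thesis using assms(1) by (simp add: partial_run_def nth_append)
  next
    case False
    then have m: "m = length us - 1" "Suc m = length us" using that by auto
    then have "us ! m = last us" using ne by (simp add: last_conv_nth)
    then show ?thesis using m(2) assms(2) by (simp add: mnxt_iff nth_append)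
  qed
  moreover have "mres ((us @ [u]) ! m) ((rs @ [x]) ! m)" if "m < length (us @ [u])" for m
    using that assms(1,3) len by (cases "m < length us") (auto simp: partial_run_def nth_append mres_iff less_Suc_eq)
  ultimately show ?thesis using assms unfolding partial_run_def by (auto simp: hd_append)
qed

text \<open>The run has just completed the steps \<open>us\<close>, and is about to enter state \<open>q\<close>.\<close>

definition about_to_enter ::
  "step list \<Rightarrow> vtx list \<Rightarrow> atom \<Rightarrow> (nat \<Rightarrow> atom list) \<Rightarrow> state \<Rightarrow> (nat \<Rightarrow> nat) \<Rightarrow> bool" where
  "about_to_enter us rs z stk q \<rho> \<longleftrightarrow> partial_run us rs \<and>
     (\<forall>r. length (stk r) = \<rho> r) \<and> (\<forall>r. linked (set rs) z (stk r)) \<and> (\<forall>r. distinct (stk r)) \<and>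
     (\<forall>r r'. r \<noteq> r' \<longrightarrow> set (stk r) \<inter> set (stk r') = {}) \<and>
     (\<forall>r. \<forall>a\<in>set (stk r). Tok a \<in> set rs \<and> (\<forall>b. Pop a b \<notin> set rs)) \<and>
     (\<forall>a b. Psh a b \<in> set rs \<longrightarrow> Tok a \<in> set rs) \<and>
     (\<forall>r. width k q \<le> r + 2 \<longrightarrow> stk r = []) \<and> q \<in> fst ` set P \<and>
     (\<forall>c a. c < 2 \<longrightarrow> follow (last us) (c, q, data a z (\<lambda>r. top_of z (stk r)) (width k q)))"

lemma linked_mono: "linked R z s \<Longrightarrow> R \<subseteq> R' \<Longrightarrow> linked R' z s"
  by (induction s) auto

lemma fresh_token: "\<exists>a. Tok a \<notin> set rs"
proof -
  have "finite {a. Tok a \<in> set rs}"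
    by (rule finite_imageD[of Tok]) (auto intro: finite_subset[of _ "set rs"] inj_onI)
  then show ?thesis by (metis (mono_tags) ex_new_if_finite infinite_UNIV_nat mem_Collect_eq)
qed

lemma entered_stays:
  assumes e: "about_to_enter us rs z stk q \<rho>" and i: "(q, i) \<in> set P" "q' \<in> set (targets i)"
    and a: "Tok a \<notin> set rs"
    and co: "consumes (0, q, data a z (\<lambda>r. top_of z (stk r)) (width k q)) (Tok a)"
    and fo: "\<And>c as'. c < 2 \<Longrightarrow> follows (width k q) (width k q') None (data a z (\<lambda>r. top_of z (stk r)) (width k q)) as' \<Longrightarrow>
      follow (0, q, data a z (\<lambda>r. top_of z (stk r)) (width k q)) (c, q', as')"
  shows "about_to_enter (us @ [(0, q, data a z (\<lambda>r. top_of z (stk r)) (width k q))]) (rs @ [Tok a]) z stk q' \<rho>"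
proof -
  have T: "q' \<in> fst ` set P" "width k q \<le> width k q'" using targets_in[OF i] by auto
  have "partial_run (us @ [(0, q, data a z (\<lambda>r. top_of z (stk r)) (width k q))]) (rs @ [Tok a])"
    by (rule partial_run_snoc) (use e co a in \<open>auto simp: about_to_enter_def\<close>)
  moreover have "linked (set (rs @ [Tok a])) z (stk r)" for r
    by (rule linked_mono[of "set rs"]) (use e in \<open>auto simp: about_to_enter_def\<close>)
  moreover have "follows (width k q) (width k q') None (data a z (\<lambda>r. top_of z (stk r)) (width k q))
     (data a' z (\<lambda>r. top_of z (stk r)) (width k q'))" for a'
    by (rule follows_data) (use e T width2 in \<open>auto simp: about_to_enter_def\<close>)
  ultimately show ?thesis using e T fo unfolding about_to_enter_def by auto
qed

lemma mstep_entered: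
  assumes e: "about_to_enter us rs z stk q \<rho>" and st: "mstep P (q, \<rho>) (q', \<rho>')"
  shows "\<exists>us rs stk. about_to_enter us rs z stk q' \<rho>'"
proof -
  let ?d = "\<lambda>a. data a z (\<lambda>r. top_of z (stk r)) (width k q)"
  obtain a where a: "Tok a \<notin> set rs" using fresh_token by blast
  have pr: "partial_run us rs"
    and len: "\<And>r. length (stk r) = \<rho> r" and lk: "\<And>r. linked (set rs) z (stk r)"
    and dst: "\<And>r. distinct (stk r)" and dsj: "\<And>r r'. r \<noteq> r' \<Longrightarrow> set (stk r) \<inter> set (stk r') = {}"
    and tk: "\<And>r a. a \<in> set (stk r) \<Longrightarrow> Tok a \<in> set rs" and np: "\<And>r a b. a \<in> set (stk r) \<Longrightarrow> Pop a b \<notin> set rs"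
    and pt: "\<And>a b. Psh a b \<in> set rs \<Longrightarrow> Tok a \<in> set rs"
    and wd: "\<And>r. width k q \<le> r + 2 \<Longrightarrow> stk r = []"
    and en: "\<And>c a. c < 2 \<Longrightarrow> follow (last us) (c, q, ?d a)"
    using e unfolding about_to_enter_def by blast+
  have w4: "4 \<le> width k q" for q by (rule width2)
  have w2: "2 \<le> width k q" for q using w4[of q] by linarith
  have ld: "length (?d a) = width k q" for a using w2 by simp
  from st show ?thesis
  proof cases
    case (1 r)
    note T = targets_in[OF 1(2), of q', simplified]
    have rw: "r + 2 < width k q" using reg_width[OF 1(2)] by simp
    define u1 u2 where "u1 = (0::nat, q, ?d a)" and "u2 = (2::nat, q, ?d a)"
    define b where "b = top_of z (stk r)"
    define stk' where "stk' = stk(r := a # stk r)"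
    have p1: "partial_run (us @ [u1]) (rs @ [Tok a])"
      by (rule partial_run_snoc[OF pr])
        (use a en[of 0 a] consumes.intros(1)[OF 1(2) ld[of a]] in \<open>auto simp: u1_def\<close>)
    have "consumes u2 (Psh a b)"
      using consumes.intros(2)[OF 1(2) ld[of a]] rw by (simp add: u2_def b_def)
    moreover have "follow u1 u2" unfolding u1_def u2_def by (rule follow.inc1[OF 1(2) ld])
    moreover have "Psh a b \<notin> set (rs @ [Tok a])" using a pt by auto
    ultimately have p2: "partial_run ((us @ [u1]) @ [u2]) ((rs @ [Tok a]) @ [Psh a b])"
      by (intro partial_run_snoc[OF p1]) auto
    let ?rs = "(rs @ [Tok a]) @ [Psh a b]"
    have new: "a \<notin> set (stk r')" for r' using a tk by blast
    have lk': "linked (set ?rs) z (stk' r')" for r'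
    proof -
      have "linked (set ?rs) z (stk r'')" for r'' using lk[of r''] by (rule linked_mono) auto
      then show ?thesis by (simp add: stk'_def b_def)
    qed
    have fo: "follow u2 (c, q', data a' z (\<lambda>r. top_of z (stk' r)) (width k q'))" if "c < 2" for c a'
      unfolding u2_def
      by (rule follow.inc2[OF 1(2) that], rule follows_data)
        (use w4 T wd in \<open>auto simp: stk'_def\<close>)
    have "Pop a' b' \<notin> set ?rs" if "a' \<in> set (stk' r')" for a' b' r'
    proof -
      have "Pop a b' \<notin> set rs" using pr a pt unfolding partial_run_def by blast
      then show ?thesis using that np by (auto simp: stk'_def split: if_splits)
    qed
    moreover have "set (stk' r1) \<inter> set (stk' r2) = {}" if "r1 \<noteq> r2" for r1 r2
      using that new dsj by (auto simp: stk'_def)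
    moreover have "width k q' \<le> r' + 2 \<Longrightarrow> stk' r' = []" for r'
      using rw T wd[of r'] by (auto simp: stk'_def)
    moreover have "Tok a' \<in> set ?rs" if "a' \<in> set (stk' r')" for a' r'
      using that tk by (auto simp: stk'_def split: if_splits)
    ultimately have "about_to_enter ((us @ [u1]) @ [u2]) ?rs z stk' q' \<rho>'"
      unfolding about_to_enter_def using p2 lk' fo T len dst new pt 1 by (auto simp: stk'_def)
    then show ?thesis by blast
  next
    case (2 r q'')
    have rw: "r + 2 < width k q" using reg_width[OF 2(2)] by simp
    have "stk r = []" using len[of r] 2 by simp
    then have "?d a ! (r + 2) = ?d a ! 1" using rw by simp
    then have "consumes (0, q, ?d a) (Tok a)" using consumes.intros(3)[OF 2(2) ld] by simp
    from entered_stays[OF e 2(2) _ a this follow.zero[OF 2(2)]] show ?thesis using 2(1) by auto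
  next
    case (3 r l n)
    note T = targets_in[OF 3(2), of q', simplified]
    have rw: "r + 2 < width k q" using reg_width[OF 3(2)] by simp
    obtain x s where s: "stk r = x # s" using len[of r] 3(3) by (cases "stk r") auto
    define b where "b = top_of z s"
    define u where "u = (1::nat, q, ?d b)"
    define stk' where "stk' = stk(r := s)"
    have co: "consumes u (Pop x b)"
      using consumes.intros(4)[OF 3(2) ld[of b]] rw s by (simp add: u_def)
    have psh: "Psh x b \<in> set rs" using lk[of r] s by (simp add: b_def)
    have p: "partial_run (us @ [u]) (rs @ [Pop x b])"
      by (rule partial_run_snoc[OF pr]) (use en[of 1 b] co psh np[of x r b] s in \<open>auto simp: u_def\<close>)
    have lk': "linked (set (rs @ [Pop x b])) z (stk' r')" for r'
    proof -
      have "linked (set (rs @ [Pop x b])) z (stk r'')" for r'' using lk[of r''] by (rule linked_mono) auto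
      from this[of r] this[of r'] show ?thesis using s by (simp add: stk'_def)
    qed
    have fo: "follow u (c, q', data a' z (\<lambda>r. top_of z (stk' r)) (width k q'))" if "c < 2" for c a'
      unfolding u_def
      by (rule follow.dec[OF 3(2) that], rule follows_data)
        (use w4 T wd in \<open>auto simp: stk'_def b_def\<close>)
    have sub: "set (stk' r') \<subseteq> set (stk r')" for r' using s by (auto simp: stk'_def)
    \<comment> \<open>Stacks are disjoint and free of repetitions, so the popped atom has left all
      of them.\<close>
    have "x \<notin> set (stk' r')" for r'
      using dst[of r] dsj[of r r'] s by (auto simp: stk'_def)
    then have "Pop a' b' \<notin> set (rs @ [Pop x b])" if "a' \<in> set (stk' r')" for a' b' r'
      using that np[of a' r' b'] subsetD[OF sub, of a' r'] by auto
    moreover have "set (stk' r1) \<inter> set (stk' r2) = {}" if "r1 \<noteq> r2" for r1 r2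
      using that sub[of r1] sub[of r2] dsj[OF that] by blast
    moreover have "width k q' \<le> r' + 2 \<Longrightarrow> stk' r' = []" for r'
      using T wd[of r'] wd[of r] s by (auto simp: stk'_def)
    moreover have "Tok a' \<in> set (rs @ [Pop x b])" if "a' \<in> set (stk' r')" for a' r'
      using that tk sub by auto
    moreover have "distinct (stk' r')" for r' using dst[of r'] dst[of r] s by (simp add: stk'_def)
    moreover have "length (stk' r') = \<rho>' r'" for r' using 3 len[of r] len[of r'] s by (simp add: stk'_def)
    ultimately have "about_to_enter (us @ [u]) (rs @ [Pop x b]) z stk' q' \<rho>'"
      unfolding about_to_enter_def using p lk' fo T pt by auto
    then show ?thesis by blast
  next
    case 4
    have "consumes (0, q, ?d a) (Tok a)" using consumes.intros(5)[OF 4(2) ld] by simp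
    from entered_stays[OF e 4(2) _ a this follow.jmp[OF 4(2)]] show ?thesis using 4(1) by auto
  qed
qed

text \<open>The computation is assumed from \<open>q1\<close> on: the initial \<open>Jmp\<close> is
  the explicit first step, which makes atom 0 the bottom and uses up its token.\<close>

theorem accepts_valid_run:
  assumes "(mstep P)\<^sup>*\<^sup>* (q1, \<lambda>_. 0) (q, \<rho>)" "(q, Acc r) \<in> set P" "\<rho> r = 0"
  shows "\<exists>us rs. valid_run us rs"
proof -
  let ?u = "(0, q0, [0, 0, 0, 0]) :: step"
  have T: "q1 \<in> fst ` set P" "width k q0 \<le> width k q1" using targets_in[OF q0] by auto
  have co: "consumes ?u (Tok 0)" using consumes.intros(5)[OF q0, of "[0, 0, 0, 0]"] width_q0 by simp
  have fo: "follow ?u (c, q1, data a 0 (\<lambda>r. top_of 0 []) (width k q1))" if "c < 2" for c a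
  proof (rule follow.jmp[OF q0 that])
    have d: "data 0 0 (\<lambda>_. 0) 4 = [0, 0, 0, 0]" by (simp add: data_def upt_rec)
    show "follows (width k q0) (width k q1) None [0, 0, 0, 0] (data a 0 (\<lambda>r. top_of 0 []) (width k q1))"
      using follows_data[of 4 "width k q1" "\<lambda>_. 0" 0 "\<lambda>_. 0" None 0 a] T width_q0 d by simp
  qed
  have "about_to_enter [?u] [Tok 0] 0 (\<lambda>_. []) q1 (\<lambda>_. 0)"
    unfolding about_to_enter_def partial_run_def using T co fo by (auto simp: mini_iff mres_iff)
  then have start: "\<exists>us rs stk. about_to_enter us rs 0 stk q1 (\<lambda>_. 0)" by blast
  have "\<exists>us rs stk. about_to_enter us rs 0 stk (fst c) (snd c)" if "(mstep P)\<^sup>*\<^sup>* (q1, \<lambda>_. 0) c" for c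
    using that
  proof (induction rule: rtranclp_induct)
    case base then show ?case using start by simp
  next
    case (step c d)
    then obtain us rs stk where "about_to_enter us rs 0 stk (fst c) (snd c)" by blast
    from mstep_entered[OF this, of "fst d" "snd d"] step.hyps(2) show ?case by simp
  qed
  from this[OF assms(1)] obtain us rs stk where e: "about_to_enter us rs 0 stk q \<rho>" by auto
  obtain a where a: "Tok a \<notin> set rs" using fresh_token by blast
  define u where "u = (0::nat, q, data a 0 (\<lambda>r. top_of 0 (stk r)) (width k q))"
  have ld: "length (data a 0 (\<lambda>r. top_of 0 (stk r)) (width k q)) = width k q" using width2[of q] by simp
  have "stk r = []" using e assms(3) unfolding about_to_enter_def by (metis length_0_conv)
  then have "consumes u (Tok a)"
    using consumes.intros(6)[OF assms(2) ld] reg_width[OF assms(2)] by (simp add: u_def)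
  then have "partial_run (us @ [u]) (rs @ [Tok a])"
    by (intro partial_run_snoc) (use e a in \<open>auto simp: about_to_enter_def u_def\<close>)
  moreover have "mfin u" using assms(2) ld by (auto simp: u_def mfin_iff)
  ultimately have "valid_run (us @ [u]) (rs @ [Tok a])" unfolding partial_run_def valid_run_def by simp
  then show ?thesis by blast
qed

end

section \<open>Compiling recursive functions\<close>

text \<open>\<open>While r c\<close> decrements \<open>r\<close> before each execution of \<open>c\<close>.\<close>

datatype com = Skip | CInc nat | Seq com com | While nat com

inductive exec :: "com \<Rightarrow> (nat \<Rightarrow> nat) \<Rightarrow> (nat \<Rightarrow> nat) \<Rightarrow> bool" where
  exec_Skip: "exec Skip \<rho> \<rho>"
| exec_CInc: "exec (CInc r) \<rho> (\<rho>(r := Suc (\<rho> r)))"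
| exec_Seq: "exec c \<rho> \<rho>' \<Longrightarrow> exec d \<rho>' \<rho>'' \<Longrightarrow> exec (Seq c d) \<rho> \<rho>''"
| exec_While0: "\<rho> r = 0 \<Longrightarrow> exec (While r c) \<rho> \<rho>"
| exec_While: "\<rho> r = Suc n \<Longrightarrow> exec c (\<rho>(r := n)) \<rho>' \<Longrightarrow> exec (While r c) \<rho>' \<rho>'' \<Longrightarrow> exec (While r c) \<rho> \<rho>''"

primrec seqs :: "com list \<Rightarrow> com" where
  "seqs [] = Skip"
| "seqs (c # cs) = Seq c (seqs cs)"

definition clear :: "nat \<Rightarrow> com" where
  "clear r = While r Skip"

definition move :: "nat \<Rightarrow> nat \<Rightarrow> com" where
  "move r y = While r (CInc y)"

definition copy :: "nat \<Rightarrow> nat \<Rightarrow> nat \<Rightarrow> com" where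
  "copy r y t = Seq (While r (Seq (CInc y) (CInc t))) (move t r)"

lemma exec_eq: "exec c \<rho> \<rho>' \<Longrightarrow> \<rho>' = \<rho>'' \<Longrightarrow> exec c \<rho> \<rho>''"
  by simp

lemma exec_clear: "exec (clear r) \<rho> (\<rho>(r := 0))"
proof (induction "\<rho> r" arbitrary: \<rho>)
  case 0
  then have "\<rho>(r := 0) = \<rho>" by auto
  then show ?case using exec_While0[of \<rho> r] 0 by (simp add: clear_def)
next
  case (Suc n)
  have "exec (clear r) (\<rho>(r := n)) (\<rho>(r := 0))" using Suc.hyps(1)[of "\<rho>(r := n)"] by simp
  then show ?case using exec_While[of \<rho> r n Skip "\<rho>(r := n)" "\<rho>(r := 0)"] exec_Skip Suc.hyps(2)
    by (simp add: clear_def)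
qed

lemma exec_move: "r \<noteq> y \<Longrightarrow> exec (move r y) \<rho> (\<rho>(y := \<rho> y + \<rho> r, r := 0))"
proof (induction "\<rho> r" arbitrary: \<rho>)
  case 0
  then have "\<rho>(y := \<rho> y + \<rho> r, r := 0) = \<rho>" by auto
  then show ?case using exec_While0[of \<rho> r] 0 by (simp add: move_def)
next
  case (Suc n)
  let ?\<rho> = "\<rho>(r := n, y := Suc (\<rho> y))"
  have "exec (move r y) ?\<rho> (?\<rho>(y := ?\<rho> y + ?\<rho> r, r := 0))"
    by (rule Suc.hyps(1)) (use Suc.prems in simp_all)
  then have A: "exec (move r y) ?\<rho> (\<rho>(y := \<rho> y + \<rho> r, r := 0))"
    by (rule exec_eq) (use Suc.hyps(2)[symmetric] Suc.prems in \<open>auto simp: fun_eq_iff\<close>)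
  have "exec (CInc y) (\<rho>(r := n)) ?\<rho>"
    by (rule exec_eq[OF exec_CInc]) (use Suc.prems in simp)
  from exec_While[OF Suc.hyps(2)[symmetric] this A[unfolded move_def]] show ?case by (simp only: move_def)
qed

lemma exec_copy:
  assumes "r \<noteq> y" "r \<noteq> t" "y \<noteq> t" "\<rho> t = 0"
  shows "exec (copy r y t) \<rho> (\<rho>(y := \<rho> y + \<rho> r))"
proof -
  let ?c = "Seq (CInc y) (CInc t)"
  have "exec (While r ?c) \<rho> (\<rho>(y := \<rho> y + \<rho> r, t := \<rho> t + \<rho> r, r := 0))" for \<rho>
  proof (induction "\<rho> r" arbitrary: \<rho>)
    case 0
    then have "\<rho>(y := \<rho> y + \<rho> r, t := \<rho> t + \<rho> r, r := 0) = \<rho>" by auto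
    then show ?case using exec_While0[of \<rho> r] 0 by simp
  next
    case (Suc n)
    let ?\<rho> = "\<rho>(r := n, y := Suc (\<rho> y), t := Suc (\<rho> t))"
    have "exec (While r ?c) ?\<rho> (?\<rho>(y := ?\<rho> y + ?\<rho> r, t := ?\<rho> t + ?\<rho> r, r := 0))"
      by (rule Suc.hyps(1)) (use assms in simp)
    then have A: "exec (While r ?c) ?\<rho> (\<rho>(y := \<rho> y + \<rho> r, t := \<rho> t + \<rho> r, r := 0))"
      by (rule exec_eq) (use Suc.hyps(2)[symmetric] assms in \<open>auto simp: fun_eq_iff\<close>)
    have "exec ?c (\<rho>(r := n)) ?\<rho>"
      by (rule exec_Seq[OF exec_CInc], rule exec_eq[OF exec_CInc]) (use assms in simp)
    from exec_While[OF Suc.hyps(2)[symmetric] this A] show ?case .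
  qed
  then show ?thesis unfolding copy_def
    by (rule exec_Seq, intro exec_eq[OF exec_move]) (use assms in \<open>auto simp: fun_eq_iff\<close>)
qed

text \<open>\<open>compile f xs y b\<close> adds the value of \<open>f\<close> on the registers \<open>xs\<close> to register \<open>y\<close>; the
  registers from \<open>b\<close> on serve as scratch space, which is zero before and after.\<close>

primrec compile :: "recf \<Rightarrow> nat list \<Rightarrow> nat \<Rightarrow> nat \<Rightarrow> com" where
  "compile Zero = (\<lambda>xs y b. Skip)"
| "compile Succ = (\<lambda>xs y b. Seq (copy (hd xs) y b) (CInc y))"
| "compile (Proj i) = (\<lambda>xs y b. copy (xs ! i) y b)"
| "compile (Comp f gs) = (\<lambda>xs y b.
     Seq (seqs (map (\<lambda>(j, c). c xs (b + j) (b + length gs)) (zip [0..<length gs] (map compile gs))))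
    (Seq (compile f [b..<b + length gs] y (b + length gs))
         (seqs (map clear [b..<b + length gs]))))"
| "compile (PrimRec f g) = (\<lambda>xs y b.
     Seq (copy (hd xs) b (b + 1))
    (Seq (compile f (tl xs) (b + 2) (b + 4))
    (Seq (While b (Seq (compile g ((b + 1) # (b + 2) # tl xs) (b + 3) (b + 4))
                  (Seq (clear (b + 2))
                  (Seq (move (b + 3) (b + 2)) (CInc (b + 1))))))
    (Seq (move (b + 2) y) (clear (b + 1))))))"
| "compile (Mu f) = (\<lambda>xs y b.
     Seq (compile f (b # xs) (b + 1) (b + 2))
    (Seq (While (b + 1) (Seq (clear (b + 1)) (Seq (CInc b) (compile f (b # xs) (b + 1) (b + 2)))))
         (move b y)))"

definition fits :: "nat list \<Rightarrow> nat \<Rightarrow> nat \<Rightarrow> (nat \<Rightarrow> nat) \<Rightarrow> bool" where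
  "fits xs y b \<rho> \<longleftrightarrow> (\<forall>x\<in>set xs. x < b) \<and> y < b \<and> y \<notin> set xs \<and> (\<forall>r\<ge>b. \<rho> r = 0)"

text \<open>Only arguments on which \<open>f\<close> halts are described. This suffices for a
  decision procedure, which halts on the code of every presented digraph.\<close>

definition compiles :: "recf \<Rightarrow> bool" where
  "compiles f \<longleftrightarrow> (\<forall>vs v xs y b \<rho>. computes f vs v \<longrightarrow> map \<rho> xs = vs \<longrightarrow> fits xs y b \<rho> \<longrightarrow>
     exec (compile f xs y b) \<rho> (\<rho>(y := \<rho> y + v)))"

lemma compilesD:
  "compiles f \<Longrightarrow> computes f vs v \<Longrightarrow> map \<rho> xs = vs \<Longrightarrow> fits xs y b \<rho> \<Longrightarrow> \<rho>' = \<rho>(y := \<rho> y + v) \<Longrightarrow>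
   exec (compile f xs y b) \<rho> \<rho>'"
  by (auto simp: compiles_def)

lemma compiles_Comp:
  assumes f: "compiles f" and gs: "\<And>g. g \<in> set gs \<Longrightarrow> compiles g"
  shows "compiles (Comp f gs)"
  unfolding compiles_def
proof (intro allI impI)
  fix vs v xs y b \<rho>
  assume c: "computes (Comp f gs) vs v" and vs: "map \<rho> xs = vs" and fits: "fits xs y b \<rho>"
  from c obtain ws where ws: "list_all2 (\<lambda>g w. computes g vs w) gs ws" and fw: "computes f ws v"
    by (rule computes_CompE)
  let ?n = "length gs"
  have len: "length ws = ?n" using ws by (simp add: list_all2_lengthD)
  define st where "st j = (\<lambda>r. if b \<le> r \<and> r < b + j then ws ! (r - b) else \<rho> r)" for j
  have st0: "st 0 = \<rho>" by (auto simp: st_def)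
  have xsb: "x \<in> set xs \<Longrightarrow> x < b" for x using fits by (auto simp: fits_def)
  \<comment> \<open>Stated for the arguments from \<open>i\<close> on, with the registers before
    \<open>b + i\<close> filled, so that the induction can run backwards from the empty
    suffix.\<close>
  have args: "exec (seqs (map (\<lambda>(j, c). c xs (b + j) (b + ?n)) (zip [i..<?n] (map compile (drop i gs))))) (st i) (st ?n)"
    if "i \<le> ?n" for i
    using that
  proof (induction rule: inc_induct)
    case base
    then show ?case by (simp add: exec_Skip)
  next
    case (step i)
    have g: "compiles (gs ! i)" and cw: "computes (gs ! i) vs (ws ! i)"
      using gs step.hyps ws by (auto simp: list_all2_conv_all_nth)
    have "exec (compile (gs ! i) xs (b + i) (b + ?n)) (st i) (st (Suc i))"
      by (rule compilesD[OF g cw])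
        (use fits vs step.hyps xsb in \<open>auto simp: fits_def st_def fun_eq_iff less_Suc_eq not_less[symmetric] intro: trans_less_add1\<close>)
    moreover have "[i..<?n] = i # [Suc i..<?n]" "drop i gs = gs ! i # drop (Suc i) gs"
      using step.hyps by (simp_all add: upt_conv_Cons Cons_nth_drop_Suc)
    ultimately show ?case using step.IH by (simp add: exec_Seq)
  qed
  have main: "exec (compile f [b..<b + ?n] y (b + ?n)) (st ?n) ((st ?n)(y := \<rho> y + v))"
    by (rule compilesD[OF f fw]) (use fits len in \<open>auto simp: fits_def st_def fun_eq_iff intro!: nth_equalityI\<close>)
  have clr: "exec (seqs (map clear rs)) \<tau> (\<lambda>r. if r \<in> set rs then 0 else \<tau> r)" for rs \<tau>
  proof (induction rs arbitrary: \<tau>)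
    case Nil
    then show ?case by (simp add: exec_Skip)
  next
    case (Cons r rs)
    show ?case by simp (rule exec_Seq[OF exec_clear], rule exec_eq[OF Cons.IH], auto)
  qed
  show "exec (compile (Comp f gs) xs y b) \<rho> (\<rho>(y := \<rho> y + v))"
    unfolding compile.simps
    by (rule exec_Seq, rule args[of 0, unfolded st0 drop_0], simp, rule exec_Seq[OF main], rule exec_eq[OF clr])
      (use fits in \<open>auto simp: fits_def st_def fun_eq_iff\<close>)
qed

lemma computes_PrimRec_values:
  "computes (PrimRec f g) (n # vs) v \<Longrightarrow>
   \<exists>R. computes f vs (R 0) \<and> (\<forall>i<n. computes g (i # R i # vs) (R (Suc i))) \<and> R n = v"
proof (induction n arbitrary: v)
  case 0
  then show ?case by (auto elim!: computes_PrimRec0E)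
next
  case (Suc n)
  from Suc.prems obtain r where r: "computes (PrimRec f g) (n # vs) r" "computes g (n # r # vs) v"
    by (rule computes_PrimRecSucE)
  obtain R where R: "computes f vs (R 0)" "\<forall>i<n. computes g (i # R i # vs) (R (Suc i))" "R n = r"
    using Suc.IH[OF r(1)] by blast
  then show ?case using r(2) by (intro exI[of _ "R(Suc n := v)"]) (auto simp: less_Suc_eq)
qed

inductive_cases computes_PrimRecE: "computes (PrimRec f g) xs y"

lemma compiles_PrimRec:
  assumes f: "compiles f" and g: "compiles g"
  shows "compiles (PrimRec f g)"
  unfolding compiles_def
proof (intro allI impI)
  fix vs v xs y b \<rho>
  assume c: "computes (PrimRec f g) vs v" and vs: "map \<rho> xs = vs" and fits: "fits xs y b \<rho>"
  obtain n vs' where vs': "vs = n # vs'" using c by (auto elim: computes_PrimRecE)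
  then obtain x xs' where xs: "xs = x # xs'" "\<rho> x = n" "map \<rho> xs' = vs'" using vs by auto
  obtain R where R: "computes f vs' (R 0)" "\<And>i. i < n \<Longrightarrow> computes g (i # R i # vs') (R (Suc i))" "R n = v"
    using computes_PrimRec_values c vs' by blast
  have x: "x < b" "y < b" "x \<noteq> y" "y \<notin> set xs'" and xs'b: "\<And>z. z \<in> set xs' \<Longrightarrow> z < b" and z: "\<And>r. r \<ge> b \<Longrightarrow> \<rho> r = 0"
    using fits xs by (auto simp: fits_def)
  have xs'ne: "z \<in> set xs' \<Longrightarrow> z \<noteq> b + i" for z i using xs'b[of z] by auto
  \<comment> \<open>Register \<open>b\<close> holds the number of iterations left,
    \<open>b + 1\<close> the index, and \<open>b + 2\<close> the value reached; \<open>b + 3\<close>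
    receives the next value and is emptied by the move.\<close>
  define st where "st m i a = \<rho>(b := m, b + 1 := i, b + 2 := a)" for m i a
  let ?body = "Seq (compile g ((b + 1) # (b + 2) # xs') (b + 3) (b + 4))
    (Seq (clear (b + 2)) (Seq (move (b + 3) (b + 2)) (CInc (b + 1))))"
  have mapst: "map (st m i a) xs' = vs'" for m i a
    using xs(3) xs'ne[of _ 0] xs'ne[of _ 1] xs'ne[of _ 2] by (auto simp: st_def)
  have 1: "exec (copy x b (b + 1)) \<rho> (st n 0 0)"
    by (rule exec_eq[OF exec_copy]) (use x z xs in \<open>auto simp: st_def fun_eq_iff\<close>)
  have 2: "exec (compile f xs' (b + 2) (b + 4)) (st n 0 0) (st n 0 (R 0))"
    by (rule compilesD[OF f R(1) mapst])
      (use xs'b z in \<open>force simp: fits_def st_def fun_eq_iff\<close>)+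
  have body: "exec ?body (st m i (R i)) (st m (Suc i) (R (Suc i)))" if i: "i < n" for m i
  proof -
    let ?s1 = "st m i (R i)"
    let ?s2 = "?s1(b + 3 := R (Suc i))"
    let ?s3 = "?s2(b + 2 := 0)"
    let ?s4 = "st m i (R (Suc i))"
    have "exec (compile g ((b + 1) # (b + 2) # xs') (b + 3) (b + 4)) ?s1 ?s2"
    proof (rule compilesD[OF g R(2)[OF i]])
      show "map ?s1 ((b + 1) # (b + 2) # xs') = i # R i # vs'" using mapst by (simp add: st_def)
      show "fits ((b + 1) # (b + 2) # xs') (b + 3) (b + 4) ?s1" using xs'b z by (force simp: fits_def st_def)
      show "?s2 = ?s1(b + 3 := ?s1 (b + 3) + R (Suc i))" using z by (simp add: st_def)
    qed
    moreover have "exec (clear (b + 2)) ?s2 ?s3" by (rule exec_clear)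
    moreover have "exec (move (b + 3) (b + 2)) ?s3 ?s4"
      by (rule exec_eq[OF exec_move]) (use z in \<open>auto simp: st_def fun_eq_iff\<close>)
    moreover have "exec (CInc (b + 1)) ?s4 (st m (Suc i) (R (Suc i)))"
      by (rule exec_eq[OF exec_CInc]) (auto simp: st_def fun_eq_iff)
    ultimately show ?thesis by (blast intro: exec_Seq)
  qed
  have 3: "exec (While b ?body) (st m (n - m) (R (n - m))) (st 0 n (R n))" if "m \<le> n" for m
    using that
  proof (induction m)
    case 0
    then show ?case by (simp add: exec_While0 st_def)
  next
    case (Suc m)
    then have e: "Suc (n - Suc m) = n - m" by simp
    have "exec ?body (st m (n - Suc m) (R (n - Suc m))) (st m (n - m) (R (n - m)))"
      using body[of "n - Suc m" m] Suc.prems unfolding e by simp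
    moreover have "(st (Suc m) i a)(b := m) = st m i a" "st (Suc m) i a b = Suc m" for i a
      by (auto simp: st_def fun_eq_iff)
    ultimately show ?case using exec_While[of "st (Suc m) (n - Suc m) (R (n - Suc m))" b m] Suc by simp
  qed
  have 4: "exec (move (b + 2) y) (st 0 n v) (\<rho>(b + 1 := n, y := \<rho> y + v))"
    by (rule exec_eq[OF exec_move]) (use x z in \<open>auto simp: st_def fun_eq_iff\<close>)
  have 5: "exec (clear (b + 1)) (\<rho>(b + 1 := n, y := \<rho> y + v)) (\<rho>(y := \<rho> y + v))"
    by (rule exec_eq[OF exec_clear]) (use x z in \<open>auto simp: fun_eq_iff\<close>)
  show "exec (compile (PrimRec f g) xs y b) \<rho> (\<rho>(y := \<rho> y + v))"
    using 1 2 3[of n] 4 5 R(3) unfolding compile.simps xs list.sel by (auto intro!: exec_Seq)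
qed

lemma compiles_Mu:
  assumes f: "compiles f"
  shows "compiles (Mu f)"
  unfolding compiles_def
proof (intro allI impI)
  fix vs n xs y b \<rho>
  assume c: "computes (Mu f) vs n" and vs: "map \<rho> xs = vs" and fits: "fits xs y b \<rho>"
  have "computes f (n # vs) 0 \<and> (\<forall>m<n. \<exists>w. computes f (m # vs) (Suc w))"
    using c by (rule computes_MuE) blast
  then have "\<exists>w. \<forall>m\<le>n. computes f (m # vs) (w m) \<and> (w m = 0 \<longleftrightarrow> m = n)"
    by (intro choice_iff[THEN iffD1] allI) (metis Zero_not_Suc le_neq_implies_less)
  then obtain w where w: "\<And>m. m \<le> n \<Longrightarrow> computes f (m # vs) (w m)" "\<And>m. m \<le> n \<Longrightarrow> w m = 0 \<longleftrightarrow> m = n" by blast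
  have x: "y < b" "y \<notin> set xs" and xsb: "\<And>z. z \<in> set xs \<Longrightarrow> z < b" and z: "\<And>r. r \<ge> b \<Longrightarrow> \<rho> r = 0"
    using fits by (auto simp: fits_def)
  \<comment> \<open>Register \<open>b\<close> holds the candidate and \<open>b + 1\<close> the value
    of \<open>f\<close> there, which also serves as the loop test; what the test leaves of it is
    cleared in the body.\<close>
  define st where "st m a = \<rho>(b := m, b + 1 := a)" for m a
  have mapst: "map (st m a) (b # xs) = m # vs" for m a
    using vs xsb by (force simp: st_def)
  have ev: "exec (compile f (b # xs) (b + 1) (b + 2)) (st m 0) (st m (w m))" if "m \<le> n" for m
    by (rule compilesD[OF f w(1)[OF that] mapst]) (use xsb z in \<open>force simp: fits_def st_def fun_eq_iff\<close>)+
  let ?body = "Seq (clear (b + 1)) (Seq (CInc b) (compile f (b # xs) (b + 1) (b + 2)))"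
  have body: "exec ?body (st m a) (st (Suc m) (w (Suc m)))" if "m < n" for m a
  proof -
    have "exec (clear (b + 1)) (st m a) (st m 0)"
      by (rule exec_eq[OF exec_clear]) (auto simp: st_def fun_eq_iff)
    moreover have "exec (CInc b) (st m 0) (st (Suc m) 0)"
      by (rule exec_eq[OF exec_CInc]) (auto simp: st_def fun_eq_iff)
    ultimately show ?thesis using ev[of "Suc m"] that by (auto intro: exec_Seq)
  qed
  have loop: "exec (While (b + 1) ?body) (st m (w m)) (st n 0)" if "m \<le> n" for m
    using that
  proof (induction rule: inc_induct)
    case base
    have "w n = 0" using w(2)[of n] by simp
    then show ?case by (simp add: exec_While0 st_def)
  next
    case (step m)
    obtain x where "w m = Suc x" using w(2)[of m] step.hyps by (cases "w m") auto
    then have "st m (w m) (b + 1) = Suc x" "(st m (w m))(b + 1 := x) = st m x" by (auto simp: st_def)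
    then show ?case using exec_While[of "st m (w m)" "b + 1" x] body[OF step.hyps(2), of x] step.IH by simp
  qed
  have init: "st 0 0 = \<rho>" using z by (auto simp: st_def fun_eq_iff)
  have last: "exec (move b y) (st n 0) (\<rho>(y := \<rho> y + n))"
    by (rule exec_eq[OF exec_move]) (use x z in \<open>auto simp: st_def fun_eq_iff\<close>)
  show "exec (compile (Mu f) xs y b) \<rho> (\<rho>(y := \<rho> y + n))"
    using ev[of 0] loop[of 0] last unfolding compile.simps init by (auto intro!: exec_Seq)
qed

theorem compile_correct: "compiles f"
proof (induction f)
  case Zero
  show ?case by (auto simp: compiles_def elim!: computes_ZeroE intro: exec_eq[OF exec_Skip])
next
  case Succ
  show ?case unfolding compiles_def
  proof (intro allI impI)
    fix vs v xs y b \<rho>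
    assume c: "computes Succ vs v" and vs: "map \<rho> xs = vs" and fits: "fits xs y b \<rho>"
    from c obtain n where "vs = [n]" "v = Suc n" by (rule computes_SuccE)
    then obtain x where x: "xs = [x]" "\<rho> x = n" using vs by auto
    then have "exec (copy x y b) \<rho> (\<rho>(y := \<rho> y + n))"
      using exec_copy[of x y b \<rho>] fits by (auto simp: fits_def)
    then show "exec (compile Succ xs y b) \<rho> (\<rho>(y := \<rho> y + v))"
      using x \<open>v = Suc n\<close> exec_eq[OF exec_CInc[of y "\<rho>(y := \<rho> y + n)"]] by (auto intro!: exec_Seq)
  qed
next
  case (Proj i)
  show ?case unfolding compiles_def
  proof (intro allI impI)
    fix vs v xs y b \<rho>
    assume c: "computes (Proj i) vs v" and vs: "map \<rho> xs = vs" and fits: "fits xs y b \<rho>"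
    from c have i: "i < length xs" "v = \<rho> (xs ! i)" using vs by (auto elim!: computes_ProjE)
    then have "xs ! i < b" "xs ! i \<noteq> y" using fits by (auto simp: fits_def)
    then show "exec (compile (Proj i) xs y b) \<rho> (\<rho>(y := \<rho> y + v))"
      using exec_copy[of "xs ! i" y b \<rho>] fits i by (auto simp: fits_def)
  qed
qed (auto intro: compiles_Comp compiles_PrimRec compiles_Mu)

text \<open>\<open>flat c n\<close> leads from state \<open>n + length (flat c n)\<close> down to state \<open>n\<close>; its entry \<open>j\<close> is the
  instruction executed in state \<open>Suc (n + j)\<close>.\<close>

primrec flat :: "com \<Rightarrow> nat \<Rightarrow> instr list" where
  "flat Skip = (\<lambda>n. [])"
| "flat (CInc r) = (\<lambda>n. [Inc r (0, n)])"
| "flat (Seq c d) = (\<lambda>n. flat d n @ flat c (n + length (flat d n)))"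
| "flat (While r c) = (\<lambda>n. Jmp (0, Suc (Suc (n + length (flat c (Suc n))))) # flat c (Suc n)
     @ [Dec r (0, Suc (n + length (flat c (Suc n)))) (0, n)])"

definition has_code :: "prog \<Rightarrow> nat \<Rightarrow> instr list \<Rightarrow> bool" where
  "has_code P n is \<longleftrightarrow> (\<forall>j<length is. ((0, Suc (n + j)), is ! j) \<in> set P)"

lemma has_code_Nil [simp]: "has_code P n []"
  by (simp add: has_code_def)

lemma has_code_Cons: "has_code P n (i # is) \<longleftrightarrow> ((0, Suc n), i) \<in> set P \<and> has_code P (Suc n) is"
proof -
  have "(\<forall>j<Suc l. Q j) \<longleftrightarrow> Q 0 \<and> (\<forall>j<l. Q (Suc j))" for l Q
    by (metis less_Suc_eq_0_disj zero_less_Suc not_less_eq)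
  then show ?thesis by (simp add: has_code_def)
qed

lemma has_code_append: "has_code P n (is @ js) \<longleftrightarrow> has_code P n is \<and> has_code P (n + length is) js"
  by (induction "is" arbitrary: n) (simp_all add: has_code_Cons)

text \<open>A fragment has the exit \<open>n\<close> whatever its length. In a loop the body exits
  to the \<open>Jmp\<close> in state \<open>Suc n\<close>, which returns to the \<open>Dec\<close>
  in the topmost state.\<close>

lemma flat_correct:
  "exec c \<rho> \<rho>' \<Longrightarrow> has_code P n (flat c n) \<Longrightarrow>
   (mstep P)\<^sup>*\<^sup>* ((0, n + length (flat c n)), \<rho>) ((0, n), \<rho>')"
proof (induction arbitrary: n rule: exec.induct)
  case (exec_CInc r \<rho>)
  then have "((0, Suc n), Inc r (0, n)) \<in> set P" by (simp add: has_code_Cons)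
  then have "mstep P ((0, Suc n), \<rho>) ((0, n), \<rho>(r := Suc (\<rho> r)))" by (rule mstep.intros(1))
  then have "(mstep P)\<^sup>*\<^sup>* ((0, Suc n), \<rho>) ((0, n), \<rho>(r := Suc (\<rho> r)))" by (rule r_into_rtranclp)
  then show ?case by (simp del: fun_upd_apply)
next
  case (exec_Seq c \<rho> \<rho>' d \<rho>'')
  then have "(mstep P)\<^sup>*\<^sup>* ((0, n + length (flat d n) + length (flat c (n + length (flat d n)))), \<rho>) ((0, n + length (flat d n)), \<rho>')"
    "(mstep P)\<^sup>*\<^sup>* ((0, n + length (flat d n)), \<rho>') ((0, n), \<rho>'')"
    by (auto simp: has_code_append)
  then show ?case by (simp add: ac_simps)
next
  case (exec_While0 \<rho> r c)
  let ?l = "length (flat c (Suc n))"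
  have "((0, Suc (Suc (n + ?l))), Dec r (0, Suc (n + ?l)) (0, n)) \<in> set P"
    using exec_While0.prems by (simp add: has_code_append has_code_Cons)
  then have "mstep P ((0, Suc (Suc (n + ?l))), \<rho>) ((0, n), \<rho>)"
    using exec_While0(1) by (rule mstep.intros(2))
  then have "(mstep P)\<^sup>*\<^sup>* ((0, Suc (Suc (n + ?l))), \<rho>) ((0, n), \<rho>)" by (rule r_into_rtranclp)
  then show ?case by simp
next
  case (exec_While \<rho> r x c \<rho>' \<rho>'')
  let ?l = "length (flat c (Suc n))"
  have code: "((0, Suc (Suc (n + ?l))), Dec r (0, Suc (n + ?l)) (0, n)) \<in> set P" "has_code P (Suc n) (flat c (Suc n))"
    "((0, Suc n), Jmp (0, Suc (Suc (n + ?l)))) \<in> set P"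
    using exec_While.prems by (simp_all add: has_code_append has_code_Cons)
  have "mstep P ((0, Suc (Suc (n + ?l))), \<rho>) ((0, Suc (n + ?l)), \<rho>(r := x))"
    using code(1) exec_While.hyps(1) by (rule mstep.intros(3))
  also have "(mstep P)\<^sup>*\<^sup>* ((0, Suc (n + ?l)), \<rho>(r := x)) ((0, Suc n), \<rho>')"
    using exec_While.IH(1)[OF code(2)] by (simp del: fun_upd_apply)
  also have "mstep P ((0, Suc n), \<rho>') ((0, Suc (Suc (n + ?l))), \<rho>')"
    using code(3) by (rule mstep.intros(4))
  also have "(mstep P)\<^sup>*\<^sup>* ((0, Suc (Suc (n + ?l))), \<rho>') ((0, n), \<rho>'')"
    using exec_While.IH(2)[OF exec_While.prems] by simp
  finally show ?case by simp
qed (simp_all)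

lemma flat_targets: "i \<in> set (flat c n) \<Longrightarrow> q \<in> set (targets i) \<Longrightarrow> fst q = 0 \<and> snd q \<le> n + length (flat c n)"
  by (induction c arbitrary: n i) (fastforce)+

section \<open>Presentations\<close>

text \<open>Equalities between atoms are expressed by repeated variables in the patterns and
  inequalities never occur, so this formula serves all builders.\<close>

definition ptrue :: fm where "ptrue = Ex 0 (Eq 0 0)"

definition single :: "expr \<Rightarrow> builder" where "single e = Builder e [] ptrue"

definition epair :: "expr \<Rightarrow> expr \<Rightarrow> expr" where
  "epair e1 e2 = EUnion [single e1, single (EUnion [single e1, single e2])]"

primrec num :: "nat \<Rightarrow> expr" where
  "num 0 = EUnion []"
| "num (Suc n) = EUnion [single (num n)]"

primrec evars :: "var list \<Rightarrow> expr" where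
  "evars [] = EUnion []"
| "evars (x # xs) = epair (EVar x) (evars xs)"

primrec hnum :: "nat \<Rightarrow> hset" where
  "hnum 0 = HSet cempty"
| "hnum (Suc n) = HSet (cinsert (hnum n) cempty)"

primrec htup :: "atom list \<Rightarrow> hset" where
  "htup [] = HSet cempty"
| "htup (a # as) = hpair (Atom a) (htup as)"

lemma sat_ptrue [simp]: "sat ptrue \<sigma>" by (simp add: ptrue_def)

lemma fv_ptrue [simp]: "fv_fm ptrue = {}" by (simp add: ptrue_def)

lemma elements_single [simp]: "elements (single e) \<sigma> = {eval e \<sigma>}"
proof -
  have "(\<forall>x. \<tau> x = \<sigma> x) \<longleftrightarrow> \<tau> = \<sigma>" for \<tau> by (simp add: fun_eq_iff)
  then show ?thesis by (simp add: single_def)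
qed

lemma acset_insert: "acset {} = cempty" "acset {x} = cinsert x cempty" "acset {x, y} = cinsert x (cinsert y cempty)"
proof -
  show "acset {} = cempty" by (metis bot_cset.rep_eq rcset_inverse)
  have "rcset (cinsert x cempty) = {x}" by (simp add: cinsert.rep_eq bot_cset.rep_eq)
  then show "acset {x} = cinsert x cempty" by (metis rcset_inverse)
  show "acset {x, y} = cinsert x (cinsert y cempty)" by (metis rcset_pair rcset_inverse)
qed

lemma eval_epair [simp]: "eval (epair e1 e2) \<sigma> = hpair (eval e1 \<sigma>) (eval e2 \<sigma>)"
  by (simp add: epair_def hpair_def acset_insert insert_commute)

lemma fv_epair [simp]: "fv (epair e1 e2) = fv e1 \<union> fv e2"
  by (auto simp: epair_def single_def)

lemma eval_num [simp]: "eval (num n) \<sigma> = hnum n"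
  by (induction n) (simp_all add: acset_insert)

lemma fv_num [simp]: "fv (num n) = {}"
  by (induction n) (simp_all add: single_def)

lemma eval_evars [simp]: "eval (evars xs) \<sigma> = htup (map \<sigma> xs)"
  by (induction xs) (simp_all add: acset_insert)

lemma fv_evars [simp]: "fv (evars xs) = set xs"
  by (induction xs) simp_all

lemma cinsert_neq_cempty [simp]: "cinsert x A \<noteq> cempty" "cempty \<noteq> cinsert x A"
  by (metis cinsert_iff cempty_iff)+

lemma hnum_inject: "hnum m = hnum n \<longleftrightarrow> m = n"
proof (induction m arbitrary: n)
  case 0
  then show ?case by (cases n) simp_all
next
  case (Suc m)
  have "cinsert x cempty = cinsert y cempty \<longleftrightarrow> x = y" for x y :: hset
    by (metis cinsert_iff cempty_iff)
  then show ?case using Suc by (cases n) simp_all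
qed

lemma hpair_neq_empty: "hpair x y \<noteq> HSet cempty" "HSet cempty \<noteq> hpair x y"
  by (simp_all add: hpair_def)

lemma htup_inject: "htup as = htup bs \<longleftrightarrow> as = bs"
proof (induction "as" arbitrary: bs)
  case Nil
  then show ?case by (cases bs) (simp_all add: hpair_neq_empty)
next
  case (Cons a "as")
  then show ?case by (cases bs) (simp_all add: hpair_neq_empty hpair_inject)
qed

text \<open>The index \<open>i\<close> of a state is kept apart from the tag, since it is all that
  varies with the input; the tag of a vertex in an input block is a constant. Adding 6 avoids the
  tags of the other constructors.\<close>

fun key :: "vtx \<Rightarrow> nat \<times> nat" where
  "key (Lft a) = (0, 0)"
| "key Start = (1, 0)"
| "key (Glue a) = (2, 0)"
| "key (Tok a) = (3, 0)"
| "key (Psh a b) = (4, 0)"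
| "key (Pop a b) = (5, 0)"
| "key (Part p (c, (g, i), as)) = (prod_encode (p, prod_encode (c, g)) + 6, i)"

fun args :: "vtx \<Rightarrow> nat list" where
  "args (Lft a) = [a]"
| "args Start = []"
| "args (Glue a) = [a]"
| "args (Tok a) = [a]"
| "args (Psh a b) = [a, b]"
| "args (Pop a b) = [a, b]"
| "args (Part p (c, q, as)) = as"

definition evtx :: "vtx \<Rightarrow> expr" where
  "evtx v = epair (num (fst (key v))) (epair (num (snd (key v))) (evars (args v)))"

definition enc :: "vtx \<Rightarrow> hset" where
  "enc v = hpair (hnum (fst (key v))) (hpair (hnum (snd (key v))) (htup (args v)))"

lemma key_args_inject: "key v = key w \<Longrightarrow> args v = args w \<Longrightarrow> v = w"
  by (cases v rule: key.cases; cases w rule: key.cases) (auto simp: One_nat_def)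

lemma inj_enc: "inj enc"
  by (auto simp: inj_def enc_def hpair_inject hnum_inject htup_inject intro: key_args_inject prod_eqI)

lemma key_inst: "key (inst \<sigma> v) = key v" and args_inst: "args (inst \<sigma> v) = map \<sigma> (args v)"
  by (cases v rule: key.cases; simp add: inst_step_def)+

lemma eval_evtx [simp]: "eval (evtx v) \<sigma> = enc (inst \<sigma> v)"
  by (simp add: evtx_def enc_def key_inst args_inst)

lemma fv_evtx [simp]: "fv (evtx v) = set (args v)"
  by (simp add: evtx_def)

text \<open>All free variables of \<open>e\<close> are bound, so a valuation may be changed to agree
  with the surrounding one outside \<open>xs\<close>.\<close>

lemma elements_closed:
  assumes "fv e \<subseteq> set xs"
  shows "elements (Builder e xs ptrue) \<sigma> = range (eval e)"
proof -
  have "eval e \<tau> \<in> elements (Builder e xs ptrue) \<sigma>" for \<tau>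
  proof -
    define \<tau>' where "\<tau>' x = (if x \<in> set xs then \<tau> x else \<sigma> x)" for x
    have "eval e \<tau> = eval e \<tau>'" by (rule eval_cong) (use assms in \<open>auto simp: \<tau>'_def\<close>)
    then show ?thesis by (auto simp: \<tau>'_def)
  qed
  then show ?thesis by auto
qed

definition vbuild :: "vtx \<Rightarrow> builder" where
  "vbuild v = Builder (evtx v) (args v) ptrue"

definition ebuild :: "vtx \<times> vtx \<Rightarrow> builder" where
  "ebuild = (\<lambda>(v, w). Builder (epair (evtx v) (evtx w)) (args v @ args w) ptrue)"

definition pres :: "vtx list \<Rightarrow> (vtx \<times> vtx) list \<Rightarrow> presentation" where
  "pres vs es = (epair (EUnion (map vbuild vs)) (EUnion (map ebuild es)), [])"

definition inst_verts :: "vtx list \<Rightarrow> vtx set" where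
  "inst_verts vs = {inst \<sigma> v |\<sigma> v. v \<in> set vs}"

definition inst_arcs :: "(vtx \<times> vtx) list \<Rightarrow> (vtx \<times> vtx) set" where
  "inst_arcs es = {(inst \<sigma> v, inst \<sigma> w) |\<sigma> v w. (v, w) \<in> set es}"

definition pat_graph :: "vtx list \<Rightarrow> (vtx \<times> vtx) list \<Rightarrow> hset pair_pre_digraph" where
  "pat_graph vs es = \<lparr>pverts = enc ` inst_verts vs, parcs = map_prod enc enc ` inst_arcs es\<rparr>"

lemma wf_pres: "wf_presentation (pres vs es)"
  by (auto simp: wf_presentation_def pres_def vbuild_def ebuild_def split: prod.splits)

lemma presents_pat_graph:
  assumes "inst_arcs es \<subseteq> inst_verts vs \<times> inst_verts vs"
  shows "presents_digraph (pres vs es) (pat_graph vs es)"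
proof -
  let ?\<sigma> = "valuation []"
  obtain V where V: "eval (EUnion (map vbuild vs)) ?\<sigma> = HSet V" by simp
  obtain E where E: "eval (EUnion (map ebuild es)) ?\<sigma> = HSet E" by simp
  have "rcset V = (\<Union>v\<in>set vs. elements (vbuild v) ?\<sigma>)" using rcset_eval_EUnion[OF V] by simp
  also have "\<dots> = enc ` inst_verts vs"
    by (auto simp: vbuild_def elements_closed inst_verts_def simp del: elements.simps)
  finally have rV: "rcset V = enc ` inst_verts vs" .
  have "rcset E = (\<Union>e\<in>set es. elements (ebuild e) ?\<sigma>)" using rcset_eval_EUnion[OF E] by simp
  also have "\<dots> = (\<lambda>(x, y). hpair x y) ` map_prod enc enc ` inst_arcs es"
    by (force simp: ebuild_def elements_closed inst_arcs_def simp del: elements.simps)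
  finally have rE: "(\<lambda>(x, y). hpair x y) ` parcs (pat_graph vs es) = rcset E" by (simp add: pat_graph_def)
  have "presented_set (pres vs es) = hpair (HSet V) (HSet E)"
    using V E by (simp add: presented_set_def pres_def del: eval.simps)
  moreover have "parcs (pat_graph vs es) \<subseteq> pverts (pat_graph vs es) \<times> pverts (pat_graph vs es)"
    using assms by (auto simp: pat_graph_def)
  ultimately show ?thesis
    unfolding presents_digraph_def is_digraph_set_def using wf_pres rV rE
    by (intro conjI exI[of _ V] exI[of _ E]) (simp_all add: pat_graph_def)
qed

lemma pat_graph_hamiltonian_iff:
  assumes "inst_arcs es \<subseteq> inst_verts vs \<times> inst_verts vs"
  shows "has_doubly_infinite_hamiltonian_path (pat_graph vs es) \<longleftrightarrow>
    (\<exists>v :: int \<Rightarrow> vtx. bij_betw v UNIV (inst_verts vs) \<and> (\<forall>i. (v i, v (i + 1)) \<in> inst_arcs es))"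
proof -
  have sub: "parcs (pat_graph vs es) \<subseteq> pverts (pat_graph vs es) \<times> pverts (pat_graph vs es)"
    using assms by (auto simp: pat_graph_def)
  have arc: "(enc x, enc y) \<in> parcs (pat_graph vs es) \<longleftrightarrow> (x, y) \<in> inst_arcs es" for x y
    using inj_enc by (auto simp: pat_graph_def inj_def)
  have bij: "bij_betw enc (inst_verts vs) (pverts (pat_graph vs es))"
    using inj_enc by (auto simp: pat_graph_def bij_betw_def intro: inj_on_subset)
  show ?thesis
    unfolding has_doubly_infinite_hamiltonian_path_iff[OF sub]
  proof
    assume "\<exists>v :: int \<Rightarrow> hset. bij_betw v UNIV (pverts (pat_graph vs es)) \<and> (\<forall>i. (v i, v (i + 1)) \<in> parcs (pat_graph vs es))"
    then obtain v :: "int \<Rightarrow> hset" where v: "bij_betw v UNIV (pverts (pat_graph vs es))"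
      and e: "\<And>i. (v i, v (i + 1)) \<in> parcs (pat_graph vs es)" by blast
    define w where "w = the_inv_into (inst_verts vs) enc \<circ> v"
    have "bij_betw w UNIV (inst_verts vs)"
      unfolding w_def by (rule bij_betw_trans[OF v bij_betw_the_inv_into[OF bij]])
    moreover have ew: "enc (w i) = v i" for i
    proof -
      have "v i \<in> enc ` inst_verts vs" using v by (auto simp: bij_betw_def pat_graph_def)
      then show ?thesis unfolding w_def comp_def
        by (intro f_the_inv_into_f inj_on_subset[OF inj_enc]) auto
    qed
    moreover have "(w i, w (i + 1)) \<in> inst_arcs es" for i
      using e[of i] arc[of "w i" "w (i + 1)"] ew by simp
    ultimately show "\<exists>v :: int \<Rightarrow> vtx. bij_betw v UNIV (inst_verts vs) \<and> (\<forall>i. (v i, v (i + 1)) \<in> inst_arcs es)" by blast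
  next
    assume "\<exists>v :: int \<Rightarrow> vtx. bij_betw v UNIV (inst_verts vs) \<and> (\<forall>i. (v i, v (i + 1)) \<in> inst_arcs es)"
    then obtain v :: "int \<Rightarrow> vtx" where v: "bij_betw v UNIV (inst_verts vs)" and e: "\<And>i. (v i, v (i + 1)) \<in> inst_arcs es" by blast
    have "bij_betw (enc \<circ> v) UNIV (pverts (pat_graph vs es))" by (rule bij_betw_trans[OF v bij])
    moreover have "((enc \<circ> v) i, (enc \<circ> v) (i + 1)) \<in> parcs (pat_graph vs es)" for i using e arc by simp
    ultimately show "\<exists>v :: int \<Rightarrow> hset. bij_betw v UNIV (pverts (pat_graph vs es)) \<and> (\<forall>i. (v i, v (i + 1)) \<in> parcs (pat_graph vs es))" by blast
  qed
qed

section \<open>The graph of a machine as a list of patterns\<close>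

definition part_pats :: "nat \<Rightarrow> state \<Rightarrow> vtx list" where
  "part_pats k q = [Part p (c, q, [0..<width k q]). c \<leftarrow> [0, 1, 2], p \<leftarrow> [0, 1, 2, 3, 4, 5]]"

text \<open>\<open>f\<close> is the variable for the atom of the \<open>Glue\<close> vertices. It is
  taken outside the variables of \<open>u\<close>, so that this atom is independent of the
  data.\<close>

definition gadget_pats :: "nat \<Rightarrow> step \<Rightarrow> (vtx \<times> vtx) list" where
  "gadget_pats f u =
    [(Part 0 u, Part 1 u), (Part 1 u, Part 0 u), (Part 1 u, Part 2 u), (Part 2 u, Part 1 u),
     (Part 3 u, Part 4 u), (Part 4 u, Part 3 u), (Part 4 u, Part 5 u), (Part 5 u, Part 4 u),
     (Part 3 u, Part 2 u), (Glue f, Part 5 u), (Part 0 u, Glue f)]"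

text \<open>Arcs are grouped by instruction and do not depend on the rest of the program. A program
  line thus contributes one block of builders, and a longer program only prepends blocks.\<close>

definition instr_pats :: "nat \<Rightarrow> state \<times> instr \<Rightarrow> (vtx \<times> vtx) list" where
  "instr_pats k b = concat (map (\<lambda>c. gadget_pats (width k (fst b)) (c, fst b, [0..<width k (fst b)])) [0, 1, 2])
    @ concat (map (\<lambda>(s, y). [(Part 2 s, y), (y, Part 3 s)]) (res_pats k b))
    @ map (\<lambda>(s, s'). (Part 5 s, Part 0 s')) (nxt_pats k b)
    @ map (\<lambda>s. (Part 5 s, Glue (width k (fst b)))) (fin_pats k b)"

definition base_verts :: "vtx list" where
  "base_verts = [Lft 0, Start, Glue 0, Tok 0, Psh 0 1, Pop 0 1]"

definition base_arcs :: "step \<Rightarrow> (vtx \<times> vtx) list" where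
  "base_arcs u = [(Lft 0, Lft 1), (Lft 0, Start), (Start, Part 0 u), (Glue 0, Glue 1), (Glue 0, Tok 1), (Tok 0, Glue 1),
     (Glue 0, Pop 1 2), (Pop 1 2, Glue 0), (Pop 0 1, Psh 0 1), (Psh 1 2, Glue 0)]"

definition vert_pats :: "nat \<Rightarrow> prog \<Rightarrow> vtx list" where
  "vert_pats k P = concat (map (part_pats k) (map fst P)) @ base_verts"

definition arc_pats :: "nat \<Rightarrow> prog \<Rightarrow> step \<Rightarrow> (vtx \<times> vtx) list" where
  "arc_pats k P u = concat (map (instr_pats k) P) @ base_arcs u"

context machine begin

lemma steps_iff [simp]: "(c, q, as) \<in> steps \<longleftrightarrow> c < 3 \<and> q \<in> fst ` set P \<and> length as = width k q"
  by (simp add: steps_def)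

lemma inst_verts_eq: "inst_verts (vert_pats k P) = verts"
proof
  show "inst_verts (vert_pats k P) \<subseteq> verts"
    by (force simp: inst_verts_def vert_pats_def part_pats_def base_verts_def inst_step_def)
  show "verts \<subseteq> inst_verts (vert_pats k P)"
  proof
    have I: "inst \<sigma> y \<in> inst_verts (vert_pats k P)" if "y \<in> set (vert_pats k P)" for \<sigma> y
      using that by (auto simp: inst_verts_def)
    have B: "base \<in> set (vert_pats k P)" if "base \<in> set base_verts" for base
      using that by (simp add: vert_pats_def)
    fix x assume x: "x \<in> verts"
    show "x \<in> inst_verts (vert_pats k P)"
    proof (cases x)
      case (Lft a) then show ?thesis using I[OF B, of "Lft 0" "\<lambda>_. a"] by (simp add: base_verts_def)
    next
      case Start then show ?thesis using I[OF B, of Start] by (simp add: base_verts_def)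
    next
      case (Glue a) then show ?thesis using I[OF B, of "Glue 0" "\<lambda>_. a"] by (simp add: base_verts_def)
    next
      case (Tok a) then show ?thesis using I[OF B, of "Tok 0" "\<lambda>_. a"] by (simp add: base_verts_def)
    next
      case (Psh a b) then show ?thesis using I[OF B, of "Psh 0 1" "\<lambda>i. if i = 0 then a else b"] by (simp add: base_verts_def)
    next
      case (Pop a b) then show ?thesis using I[OF B, of "Pop 0 1" "\<lambda>i. if i = 0 then a else b"] by (simp add: base_verts_def)
    next
      case (Part p u)
      obtain c q as where u: "u = (c, q, as)" by (cases u) auto
      have c: "c = 0 \<or> c = 1 \<or> c = 2" "q \<in> fst ` set P" and p: "p = 0 \<or> p = 1 \<or> p = 2 \<or> p = 3 \<or> p = 4 \<or> p = 5"
        using x Part u by (auto simp: One_nat_def)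
      have "length as = width k q" using x Part u by simp
      then obtain \<sigma> where s: "as = map \<sigma> [0..<width k q]" using list_as_map by blast
      have "Part p (c, q, [0..<width k q]) \<in> set (part_pats k q)" using c(1) p by (auto simp: part_pats_def)
      then have "Part p (c, q, [0..<width k q]) \<in> set (vert_pats k P)" using c(2) by (auto simp: vert_pats_def)
      from I[OF this, of \<sigma>] show ?thesis using Part u s by (simp add: inst_step_def)
    qed
  qed
qed

end

lemma inst_arcsI: "(v, w) \<in> set es \<Longrightarrow> (inst \<sigma> v, inst \<sigma> w) \<in> inst_arcs es"
  by (auto simp: inst_arcs_def)

context machine begin

lemma mresI: "b \<in> set P \<Longrightarrow> (s, y) \<in> set (res_pats k b) \<Longrightarrow> mres (inst_step \<sigma> s) (inst \<sigma> y)"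
  unfolding mres_def by (rule bexI[of _ b], rule bexI[of _ "(s, y)"]) (simp, blast)

lemma mnxtI: "b \<in> set P \<Longrightarrow> (s, s') \<in> set (nxt_pats k b) \<Longrightarrow> mnxt (inst_step \<sigma> s) (inst_step \<sigma> s')"
  unfolding mnxt_def by (rule bexI[of _ b], rule bexI[of _ "(s, s')"]) (simp, blast)

lemma mfinI: "b \<in> set P \<Longrightarrow> s \<in> set (fin_pats k b) \<Longrightarrow> mfin (inst_step \<sigma> s)"
  unfolding mfin_def by blast

lemma miniI: "mini (inst_step \<sigma> start_pat)"
  unfolding mini_def by blast

lemma mresE:
  assumes "mres u x"
  obtains b s y \<sigma> where "b \<in> set P" "(s, y) \<in> set (res_pats k b)" "u = inst_step \<sigma> s" "x = inst \<sigma> y"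
proof -
  from assms obtain b p where b: "b \<in> set P" "p \<in> set (res_pats k b)"
    and "case p of (s, y) \<Rightarrow> \<exists>\<sigma>. u = inst_step \<sigma> s \<and> x = inst \<sigma> y" unfolding mres_def by (elim bexE)
  moreover obtain s y where p: "p = (s, y)" by (rule prod.exhaust)
  ultimately obtain \<sigma> where "u = inst_step \<sigma> s" "x = inst \<sigma> y" by (simp only: prod.case) (elim exE conjE)
  with b p that show thesis by (simp only:)
qed

lemma mnxtE:
  assumes "mnxt u u'"
  obtains b s s' \<sigma> where "b \<in> set P" "(s, s') \<in> set (nxt_pats k b)" "u = inst_step \<sigma> s" "u' = inst_step \<sigma> s'"
proof -
  from assms obtain b p where b: "b \<in> set P" "p \<in> set (nxt_pats k b)"
    and "case p of (s, s') \<Rightarrow> \<exists>\<sigma>. u = inst_step \<sigma> s \<and> u' = inst_step \<sigma> s'" unfolding mnxt_def by (elim bexE)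
  moreover obtain s s' where p: "p = (s, s')" by (rule prod.exhaust)
  ultimately obtain \<sigma> where "u = inst_step \<sigma> s" "u' = inst_step \<sigma> s'" by (simp only: prod.case) (elim exE conjE)
  with b p that show thesis by (simp only:)
qed

lemma gadget_pats_iff:
  assumes "c < 3" "q \<in> fst ` set P" "(v, w) \<in> set (gadget_pats f (c, q, [0..<width k q]))"
  shows "edge (inst \<sigma> v) (inst \<sigma> w)"
proof -
  have "inst_step \<sigma> (c, q, [0..<width k q]) \<in> steps" using assms by (simp add: inst_step_def)
  then show ?thesis using assms(3) by (auto simp: gadget_pats_def intro: edge.intros)
qed

lemma instr_pats_edge:
  assumes b: "b \<in> set P" and e: "e \<in> set (instr_pats k b)"
  shows "edge (inst \<sigma> (fst e)) (inst \<sigma> (snd e))"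
proof -
  have *: "x \<in> set (concat (map f xs)) \<longleftrightarrow> (\<exists>z\<in>set xs. x \<in> set (f z))"
    for x :: "vtx \<times> vtx" and f :: "'z \<Rightarrow> _" and xs by auto
  from e consider "\<exists>c\<in>set [0, 1, 2]. e \<in> set (gadget_pats (width k (fst b)) (c, fst b, [0..<width k (fst b)]))"
    | "\<exists>p\<in>set (res_pats k b). e \<in> set [(Part 2 (fst p), snd p), (snd p, Part 3 (fst p))]"
    | "e \<in> (\<lambda>p. (Part 5 (fst p), Part 0 (snd p))) ` set (nxt_pats k b)"
    | "e \<in> (\<lambda>s. (Part 5 s, Glue (width k (fst b)))) ` set (fin_pats k b)"
    unfolding instr_pats_def case_prod_unfold set_append Un_iff * set_map by (elim disjE)
  then show ?thesis
  proof cases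
    case 1
    then obtain c where c: "c \<in> set [0, 1, 2]"
      "e \<in> set (gadget_pats (width k (fst b)) (c, fst b, [0..<width k (fst b)]))" by (elim bexE)
    then have "c < 3" by auto
    moreover have "(fst e, snd e) \<in> set (gadget_pats (width k (fst b)) (c, fst b, [0..<width k (fst b)]))" using c(2) by simp
    ultimately show ?thesis using gadget_pats_iff[of c "fst b" "fst e" "snd e" "width k (fst b)"] b by simp
  next
    case 2
    then obtain p where p: "p \<in> set (res_pats k b)" "e \<in> set [(Part 2 (fst p), snd p), (snd p, Part 3 (fst p))]"
      by (elim bexE)
    have "mres (inst_step \<sigma> (fst p)) (inst \<sigma> (snd p))"
      by (rule mresI[OF b]) (simp only: prod.collapse p(1))
    note m = edge.intros(22,23)[OF this]
    have "e = (Part 2 (fst p), snd p) \<or> e = (snd p, Part 3 (fst p))" using p(2) by simp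
    then show ?thesis using m by (elim disjE) simp_all
  next
    case 3
    then obtain p where p: "p \<in> set (nxt_pats k b)" "e = (Part 5 (fst p), Part 0 (snd p))" by (elim imageE)
    have "mnxt (inst_step \<sigma> (fst p)) (inst_step \<sigma> (snd p))"
      by (rule mnxtI[OF b]) (simp only: prod.collapse p(1))
    then show ?thesis using p(2) edge.intros(24) by simp
  next
    case 4
    then obtain s where s: "s \<in> set (fin_pats k b)" "e = (Part 5 s, Glue (width k (fst b)))" by (elim imageE)
    then show ?thesis using mfinI[OF b s(1)] edge.intros(25) by simp
  qed
qed

lemma inst_arcs_eq: "inst_arcs (arc_pats k P start_pat) = {(x, y). edge x y}"
proof
  have "edge (inst \<sigma> v) (inst \<sigma> w)" if vw: "(v, w) \<in> set (arc_pats k P start_pat)" for v w \<sigma>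
  proof -
    have "(v, w) \<in> set (base_arcs start_pat) \<or> (\<exists>b\<in>set P. (v, w) \<in> set (instr_pats k b))"
      using vw by (auto simp: arc_pats_def)
    then show ?thesis
    proof
      assume "(v, w) \<in> set (base_arcs start_pat)"
      then show ?thesis
        by (auto simp: base_arcs_def edge.intros(3)[OF miniI] intro: edge.intros(1,2,4-10))
    next
      assume "\<exists>b\<in>set P. (v, w) \<in> set (instr_pats k b)"
      then show ?thesis using instr_pats_edge by fastforce
    qed
  qed
  then show "inst_arcs (arc_pats k P start_pat) \<subseteq> {(x, y). edge x y}" by (auto simp: inst_arcs_def)
next
  let ?A = "inst_arcs (arc_pats k P start_pat)"
  have base: "(inst \<sigma> v, inst \<sigma> w) \<in> ?A" if "(v, w) \<in> set (base_arcs start_pat)" for v w \<sigma>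
    by (rule inst_arcsI) (use that in \<open>simp add: arc_pats_def\<close>)
  have ins: "(inst \<sigma> v, inst \<sigma> w) \<in> ?A" if "b \<in> set P" "(v, w) \<in> set (instr_pats k b)" for b v w \<sigma>
    by (rule inst_arcsI) (use that in \<open>auto simp: arc_pats_def\<close>)
  define val :: "nat \<Rightarrow> nat \<Rightarrow> nat \<Rightarrow> nat \<Rightarrow> nat" where "val a b c = (\<lambda>i. if i = 0 then a else if i = 1 then b else c)" for a b c
  have val [simp]: "val a b c 0 = a" "val a b c 1 = b" "val a b c 2 = c" for a b c by (simp_all add: val_def)
  \<comment> \<open>The valuation that produces the data of \<open>u\<close> is free at the variable
    \<open>width k (fst b)\<close>, where it takes the atom of the \<open>Glue\<close>
    vertex.\<close>
  have gad: "\<exists>\<sigma> w b. b \<in> set P \<and> u = inst_step \<sigma> w \<and> \<sigma> (width k (fst b)) = a \<and>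
      set (gadget_pats (width k (fst b)) w) \<subseteq> set (instr_pats k b)" if u: "u \<in> steps" for u a
  proof -
    obtain c q as where cq: "u = (c, q, as)" by (cases u) auto
    then have c: "c < 3" "q \<in> fst ` set P" and l: "length as = width k q" using u by simp_all
    then obtain b where b: "b \<in> set P" "fst b = q" by auto
    define \<sigma> where "\<sigma> i = (if i < width k q then as ! i else a)" for i
    have "as = map \<sigma> [0..<width k q]" by (rule nth_equalityI) (simp_all add: l \<sigma>_def)
    then have "u = inst_step \<sigma> (c, q, [0..<width k q])" by (simp add: cq inst_step_def)
    moreover have "c = 0 \<or> c = 1 \<or> c = 2" using c(1) by (auto simp: One_nat_def)
    then have "set (gadget_pats (width k q) (c, q, [0..<width k q])) \<subseteq> set (instr_pats k b)"
      using b(2) unfolding instr_pats_def by auto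
    moreover have "\<sigma> (width k q) = a" by (simp add: \<sigma>_def)
    ultimately show ?thesis using b by blast
  qed
  have parts: "(Part p u, Part p' u) \<in> ?A"
    if u: "u \<in> steps" and p: "(p, p') \<in> {(0, 1), (1, 0), (1, 2), (2, 1), (3, 4), (4, 3), (4, 5), (5, 4), (3, 2)}" for u p p'
  proof -
    obtain \<sigma> w b where b: "b \<in> set P" "u = inst_step \<sigma> w"
      and sub: "set (gadget_pats (width k (fst b)) w) \<subseteq> set (instr_pats k b)" using gad[OF u] by blast
    have "(Part p w, Part p' w) \<in> set (gadget_pats (width k (fst b)) w)" using p unfolding gadget_pats_def by auto
    then have "(inst \<sigma> (Part p w), inst \<sigma> (Part p' w)) \<in> ?A" using ins[OF b(1)] sub by blast
    then show ?thesis by (simp add: b)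
  qed
  have glue: "(Glue a, Part 5 u) \<in> ?A \<and> (Part 0 u, Glue a) \<in> ?A" if u: "u \<in> steps" for u a
  proof -
    obtain \<sigma> w b where b: "b \<in> set P" "u = inst_step \<sigma> w" "\<sigma> (width k (fst b)) = a"
      and sub: "set (gadget_pats (width k (fst b)) w) \<subseteq> set (instr_pats k b)" using gad[OF u, of a] by blast
    have "(Glue (width k (fst b)), Part 5 w) \<in> set (gadget_pats (width k (fst b)) w)"
      "(Part 0 w, Glue (width k (fst b))) \<in> set (gadget_pats (width k (fst b)) w)" unfolding gadget_pats_def by auto
    then have "(inst \<sigma> (Glue (width k (fst b))), inst \<sigma> (Part 5 w)) \<in> ?A"
      "(inst \<sigma> (Part 0 w), inst \<sigma> (Glue (width k (fst b)))) \<in> ?A" using ins[OF b(1)] sub by blast+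
    then show ?thesis by (simp add: b)
  qed
  have "(x, y) \<in> ?A" if "edge x y" for x y
    using that
  proof cases
    case (1 a b) then show ?thesis using base[of "Lft 0" "Lft 1" "val a b b"] by (simp add: base_arcs_def)
  next
    case (2 a) then show ?thesis using base[of "Lft 0" Start "val a a a"] by (simp add: base_arcs_def)
  next
    case (3 u)
    then obtain \<sigma> where "u = inst_step \<sigma> start_pat" by (auto simp: mini_def)
    then show ?thesis using 3 base[of Start "Part 0 start_pat" \<sigma>] by (simp add: base_arcs_def)
  next
    case (4 a b) then show ?thesis using base[of "Glue 0" "Glue 1" "val a b b"] by (simp add: base_arcs_def)
  next
    case (5 a b) then show ?thesis using base[of "Glue 0" "Tok 1" "val a b b"] by (simp add: base_arcs_def)
  next
    case (6 a b) then show ?thesis using base[of "Tok 0" "Glue 1" "val a b b"] by (simp add: base_arcs_def)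
  next
    case (7 a b c) then show ?thesis using base[of "Glue 0" "Pop 1 2" "val a b c"] by (simp add: base_arcs_def)
  next
    case (8 a b c) then show ?thesis using base[of "Pop 1 2" "Glue 0" "val c a b"] by (simp add: base_arcs_def)
  next
    case (9 a b) then show ?thesis using base[of "Pop 0 1" "Psh 0 1" "val a b b"] by (simp add: base_arcs_def)
  next
    case (10 a b c) then show ?thesis using base[of "Psh 1 2" "Glue 0" "val c a b"] by (simp add: base_arcs_def)
  next
    case (22 u)
    then obtain b s v \<sigma> where b: "b \<in> set P" "(s, v) \<in> set (res_pats k b)" "u = inst_step \<sigma> s" "y = inst \<sigma> v"
      by (blast elim: mresE)
    have "(Part 2 s, v) \<in> set (concat (map (\<lambda>(s, y). [(Part 2 s, y), (y, Part 3 s)]) (res_pats k b)))"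
      unfolding set_concat set_map by (rule UnionI[OF imageI[OF imageI[OF b(2)]]]) simp
    then have "(Part 2 s, v) \<in> set (instr_pats k b)" by (simp add: instr_pats_def)
    from ins[OF b(1) this, of \<sigma>] show ?thesis using 22 b by simp
  next
    case (23 u)
    then obtain b s v \<sigma> where b: "b \<in> set P" "(s, v) \<in> set (res_pats k b)" "u = inst_step \<sigma> s" "x = inst \<sigma> v"
      by (blast elim: mresE)
    have "(v, Part 3 s) \<in> set (concat (map (\<lambda>(s, y). [(Part 2 s, y), (y, Part 3 s)]) (res_pats k b)))"
      unfolding set_concat set_map by (rule UnionI[OF imageI[OF imageI[OF b(2)]]]) simp
    then have "(v, Part 3 s) \<in> set (instr_pats k b)" by (simp add: instr_pats_def)
    from ins[OF b(1) this, of \<sigma>] show ?thesis using 23 b by simp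
  next
    case (24 u u')
    then obtain b s s' \<sigma> where b: "b \<in> set P" "(s, s') \<in> set (nxt_pats k b)" "u = inst_step \<sigma> s" "u' = inst_step \<sigma> s'"
      by (blast elim: mnxtE)
    have "(Part 5 s, Part 0 s') \<in> (\<lambda>(s, s'). (Part 5 s, Part 0 s')) ` set (nxt_pats k b)"
      by (rule image_eqI[OF _ b(2)]) simp
    then have "(Part 5 s, Part 0 s') \<in> set (instr_pats k b)" by (simp add: instr_pats_def)
    from ins[OF b(1) this, of \<sigma>] show ?thesis using 24 b by simp
  next
    case (25 u a)
    then obtain q r as where u: "u = (0, q, as)" "(q, Acc r) \<in> set P" "length as = width k q"
      by (cases u) (auto simp: mfin_iff)
    define \<sigma> where "\<sigma> i = (if i < width k q then as ! i else a)" for i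
    have "as = map \<sigma> [0..<width k q]" by (rule nth_equalityI) (simp_all add: u \<sigma>_def)
    then have us: "u = inst_step \<sigma> (0, q, [0..<width k q])" by (simp add: u inst_step_def)
    have "(Part 5 (0, q, [0..<width k q]), Glue (width k q)) \<in> set (instr_pats k (q, Acc r))"
      by (simp add: instr_pats_def)
    from ins[OF u(2) this, of \<sigma>] show ?thesis using 25 us by (simp add: \<sigma>_def)
  qed (simp_all add: parts glue)
  then show "{(x, y). edge x y} \<subseteq> ?A" by auto
qed

theorem hamiltonian_iff_valid_run:
  "has_doubly_infinite_hamiltonian_path (pat_graph (vert_pats k P) (arc_pats k P start_pat)) \<longleftrightarrow>
    (\<exists>us rs. valid_run us rs)"
  and presents_machine:
  "presents_digraph (pres (vert_pats k P) (arc_pats k P start_pat)) (pat_graph (vert_pats k P) (arc_pats k P start_pat))"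
proof -
  have sub: "inst_arcs (arc_pats k P start_pat) \<subseteq> inst_verts (vert_pats k P) \<times> inst_verts (vert_pats k P)"
    unfolding inst_arcs_eq inst_verts_eq using edge_verts by auto
  show "presents_digraph (pres (vert_pats k P) (arc_pats k P start_pat)) (pat_graph (vert_pats k P) (arc_pats k P start_pat))"
    by (rule presents_pat_graph[OF sub])
  show "has_doubly_infinite_hamiltonian_path (pat_graph (vert_pats k P) (arc_pats k P start_pat)) \<longleftrightarrow>
    (\<exists>us rs. valid_run us rs)"
    unfolding pat_graph_hamiltonian_iff[OF sub] inst_arcs_eq inst_verts_eq
  proof
    assume "\<exists>v :: int \<Rightarrow> vtx. bij_betw v UNIV verts \<and> (\<forall>i. (v i, v (i + 1)) \<in> {(x, y). edge x y})"
    then obtain v :: "int \<Rightarrow> vtx" where v: "bij_betw v UNIV verts" "\<And>i. edge (v i) (v (i + 1))" by auto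
    interpret hamiltonian_step_system steps mini mfin mnxt mres v
      by unfold_locales (rule v)+
    show "\<exists>us rs. valid_run us rs" by (rule valid_run_exists)
  next
    assume "\<exists>us rs. valid_run us rs"
    then show "\<exists>v :: int \<Rightarrow> vtx. bij_betw v UNIV verts \<and> (\<forall>i. (v i, v (i + 1)) \<in> {(x, y). edge x y})"
      using valid_run_hamiltonian unfolding mem_Collect_eq prod.case by blast
  qed
qed

end

section \<open>Computability of codes\<close>

definition computable :: "nat \<Rightarrow> (nat list \<Rightarrow> nat) \<Rightarrow> bool" where
  "computable m F \<longleftrightarrow> (\<exists>f. \<forall>xs. length xs = m \<longrightarrow> computes f xs (F xs))"

lemma computable_cong:
  "computable m F \<Longrightarrow> (\<And>xs. length xs = m \<Longrightarrow> F xs = G xs) \<Longrightarrow> computable m G"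
  by (auto simp: computable_def)

lemma computable_nth: "i < m \<Longrightarrow> computable m (\<lambda>xs. xs ! i)"
  unfolding computable_def by (rule exI[of _ "Proj i"]) (auto intro: computes.intros)

lemma computable_comp:
  assumes F: "computable (length Gs) F" and G: "\<And>G. G \<in> set Gs \<Longrightarrow> computable m G"
  shows "computable m (\<lambda>xs. F (map (\<lambda>G. G xs) Gs))"
proof -
  obtain f where f: "\<And>xs. length xs = length Gs \<Longrightarrow> computes f xs (F xs)" using F by (auto simp: computable_def)
  have "\<exists>g. \<forall>G\<in>set Gs. \<forall>xs. length xs = m \<longrightarrow> computes (g G) xs (G xs)"
    using G unfolding computable_def by (intro bchoice) blast
  then obtain g where g: "\<And>G xs. G \<in> set Gs \<Longrightarrow> length xs = m \<Longrightarrow> computes (g G) xs (G xs)" by blast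
  have "computes (Comp f (map g Gs)) xs (F (map (\<lambda>G. G xs) Gs))" if "length xs = m" for xs
    by (rule computes.intros(4)[where ys = "map (\<lambda>G. G xs) Gs"])
      (use f g that in \<open>auto simp: list_all2_conv_all_nth\<close>)
  then show ?thesis unfolding computable_def by blast
qed

lemma computable_Suc: "computable m F \<Longrightarrow> computable m (\<lambda>xs. Suc (F xs))"
proof -
  have "computable 1 (\<lambda>xs. Suc (hd xs))"
    unfolding computable_def by (rule exI[of _ Succ]) (auto simp: length_Suc_conv One_nat_def intro: computes.intros)
  then show "computable m F \<Longrightarrow> computable m (\<lambda>xs. Suc (F xs))"
    using computable_comp[of "[F]" "\<lambda>xs. Suc (hd xs)" m] by (simp add: One_nat_def)
qed

lemma computable_const: "computable m (\<lambda>_. c)"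
proof (induction c)
  case 0
  show ?case unfolding computable_def by (rule exI[of _ Zero]) (auto intro: computes.intros)
qed (rule computable_Suc)

lemma computable_rec:
  assumes N: "computable m N" and F: "computable m F"
    and G: "computable (Suc (Suc m)) (\<lambda>ys. G (ys ! 0) (ys ! 1) (drop 2 ys))"
  shows "computable m (\<lambda>xs. rec_nat (F xs) (\<lambda>n r. G n r xs) (N xs))"
proof -
  obtain f where f: "\<And>xs. length xs = m \<Longrightarrow> computes f xs (F xs)" using F by (auto simp: computable_def)
  obtain g where g: "\<And>n r xs. length xs = m \<Longrightarrow> computes g (n # r # xs) (G n r xs)"
    using G unfolding computable_def by (metis length_Cons nth_Cons_0 nth_Cons_Suc One_nat_def drop0 drop_Suc_Cons numeral_2_eq_2)
  have r: "computes (PrimRec f g) (n # xs) (rec_nat (F xs) (\<lambda>n r. G n r xs) n)" if "length xs = m" for n xs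
    by (induction n) (use that f g in \<open>auto intro: computes.intros\<close>)
  have "computable (Suc m) (\<lambda>ys. rec_nat (F (tl ys)) (\<lambda>n r. G n r (tl ys)) (hd ys))"
    unfolding computable_def by (rule exI[of _ "PrimRec f g"]) (auto simp: length_Suc_conv r)
  \<comment> \<open>\<open>PrimRec\<close> recurses on its first argument, so \<open>N\<close> is
    put in front and the parameters are passed on by projections.\<close>
  then have "computable m (\<lambda>xs. (\<lambda>ys. rec_nat (F (tl ys)) (\<lambda>n r. G n r (tl ys)) (hd ys))
      (map (\<lambda>G. G xs) (N # map (\<lambda>i xs. xs ! i) [0..<m])))"
    by (intro computable_comp) (use N in \<open>auto intro: computable_nth\<close>)
  then show ?thesis
  proof (rule computable_cong)
    fix xs :: "nat list" assume "length xs = m"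
    then have "map ((!) xs) [0..<m] = xs" using map_nth by blast
    then show "(\<lambda>ys. rec_nat (F (tl ys)) (\<lambda>n r. G n r (tl ys)) (hd ys))
      (map (\<lambda>G. G xs) (N # map (\<lambda>i xs. xs ! i) [0..<m])) = rec_nat (F xs) (\<lambda>n r. G n r xs) (N xs)"
      by (simp add: comp_def)
  qed
qed

lemma computable_add:
  assumes "computable m F" "computable m G"
  shows "computable m (\<lambda>xs. F xs + G xs)"
proof -
  have "computable m (\<lambda>xs. rec_nat (F xs) (\<lambda>n r. Suc r) (G xs))"
    by (rule computable_rec[OF assms(2,1)]) (intro computable_Suc computable_nth, simp)
  moreover have "rec_nat a (\<lambda>n r. Suc r) n = a + n" for a n :: nat by (induction n) simp_all
  ultimately show ?thesis by simp
qed

lemma computable_triangle: "computable m F \<Longrightarrow> computable m (\<lambda>xs. triangle (F xs))"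
proof -
  assume F: "computable m F"
  have "computable m (\<lambda>xs. rec_nat 0 (\<lambda>n r. r + Suc n) (F xs))"
    by (rule computable_rec[OF F computable_const]) (intro computable_add computable_Suc computable_nth; simp)
  moreover have "rec_nat 0 (\<lambda>n r. r + Suc n) n = triangle n" for n by (induction n) simp_all
  ultimately show ?thesis by simp
qed

section \<open>Codes of expressions and of builder blocks\<close>

lemma computable_prod_encode:
  "computable m F \<Longrightarrow> computable m G \<Longrightarrow> computable m (\<lambda>xs. prod_encode (F xs, G xs))"
  by (simp add: prod_encode_def computable_add computable_triangle)

text \<open>The effect of \<open>epair\<close> on codes. List codes are written out as nested
  \<open>Suc (prod_encode (_, _))\<close> ending in 0, so that computability is immediate.\<close>

definition code_pair :: "nat \<Rightarrow> nat \<Rightarrow> nat" where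
  "code_pair c d =
    (let single = (\<lambda>e. prod_encode (e, prod_encode (0, code_fm ptrue)))
     in prod_encode (1, Suc (prod_encode (single c,
          Suc (prod_encode (single (prod_encode (1, Suc (prod_encode (single c, Suc (prod_encode (single d, 0)))))), 0))))))"

lemma code_epair: "code_expr (epair e1 e2) = code_pair (code_expr e1) (code_expr e2)"
  by (simp add: epair_def single_def code_pair_def)

lemma computable_code_pair:
  "computable m C \<Longrightarrow> computable m D \<Longrightarrow> computable m (\<lambda>xs. code_pair (C xs) (D xs))"
  unfolding code_pair_def Let_def by (intro computable_prod_encode computable_Suc computable_const)

lemma computable_code_epair:
  assumes "computable m (\<lambda>xs. code_expr (X xs))" "computable m (\<lambda>xs. code_expr (Y xs))"
  shows "computable m (\<lambda>xs. code_expr (epair (X xs) (Y xs)))"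
  unfolding code_epair by (intro computable_code_pair assms)

lemma computable_code_num:
  assumes "computable m N"
  shows "computable m (\<lambda>xs. code_expr (num (N xs)))"
proof -
  have "computable m (\<lambda>xs. rec_nat (code_expr (num 0))
      (\<lambda>n r. prod_encode (1, Suc (prod_encode (prod_encode (r, prod_encode (list_encode [], code_fm ptrue)), list_encode [])))) (N xs))"
    by (rule computable_rec[OF assms computable_const])
      (intro computable_prod_encode computable_Suc computable_const computable_nth, simp)
  moreover have "rec_nat (code_expr (num 0))
      (\<lambda>n r. prod_encode (1, Suc (prod_encode (prod_encode (r, prod_encode (list_encode [], code_fm ptrue)), list_encode [])))) n
      = code_expr (num n)" for n
    by (induction n) (simp_all add: single_def)
  ultimately show ?thesis by simp
qed

text \<open>As the variables of the pattern do not vary, the lists of bound variables in the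
  builders have constant codes.\<close>

definition computable_vtx :: "nat \<Rightarrow> (nat list \<Rightarrow> vtx) \<Rightarrow> bool" where
  "computable_vtx m X \<longleftrightarrow> computable m (\<lambda>xs. code_expr (evtx (X xs))) \<and> (\<exists>l. \<forall>xs. args (X xs) = l)"

lemma computable_vtx_const: "computable_vtx m (\<lambda>_. v)"
  by (auto simp: computable_vtx_def computable_const)

lemma computable_vtx_Part: "computable m I \<Longrightarrow> computable_vtx m (\<lambda>xs. Part p (c, (g, I xs), as))"
  unfolding computable_vtx_def evtx_def
  by (auto intro!: computable_code_epair computable_code_num computable_const)

lemma computable_vbuild:
  assumes "computable_vtx m X"
  shows "computable m (\<lambda>xs. code_builder (vbuild (X xs)))"
proof -
  obtain l where "\<And>xs. args (X xs) = l" using assms by (auto simp: computable_vtx_def)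
  then show ?thesis using assms unfolding vbuild_def code_builder.simps computable_vtx_def
    by (auto intro!: computable_prod_encode computable_const)
qed

lemma computable_ebuild:
  assumes "computable_vtx m X" "computable_vtx m Y"
  shows "computable m (\<lambda>xs. code_builder (ebuild (X xs, Y xs)))"
proof -
  obtain l l' where "\<And>xs. args (X xs) = l" "\<And>xs. args (Y xs) = l'" using assms by (auto simp: computable_vtx_def)
  then show ?thesis using assms unfolding ebuild_def prod.case code_builder.simps computable_vtx_def
    by (auto intro!: computable_prod_encode computable_const computable_code_epair)
qed

text \<open>The code of a list of builders, given the code \<open>n\<close> of the remainder of the list.\<close>

definition prepend :: "builder list \<Rightarrow> nat \<Rightarrow> nat" where
  "prepend bs n = foldr (\<lambda>b t. Suc (prod_encode (code_builder b, t))) bs n"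

lemma list_encode_prepend:
  "list_encode (map code_builder (bs @ cs)) = prepend bs (list_encode (map code_builder cs))"
  by (induction bs) (simp_all add: prepend_def)

lemma prepend_simps: "prepend [] n = n" "prepend (b # bs) n = Suc (prod_encode (code_builder b, prepend bs n))"
  "prepend (bs @ cs) n = prepend bs (prepend cs n)"
  by (simp_all add: prepend_def)

text \<open>Quantifying over the code \<open>N\<close> of the remainder turns appending into
  composition, so no concatenation of list codes has to be computed.\<close>

definition computable_list :: "nat \<Rightarrow> (nat list \<Rightarrow> builder list) \<Rightarrow> bool" where
  "computable_list m L \<longleftrightarrow> (\<forall>N. computable m N \<longrightarrow> computable m (\<lambda>xs. prepend (L xs) (N xs)))"

lemma computable_list_Nil: "computable_list m (\<lambda>_. [])"
  by (simp add: computable_list_def prepend_simps)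

lemma computable_list_Cons:
  "computable m (\<lambda>xs. code_builder (B xs)) \<Longrightarrow> computable_list m L \<Longrightarrow> computable_list m (\<lambda>xs. B xs # L xs)"
  by (auto simp: computable_list_def prepend_simps intro!: computable_Suc computable_prod_encode)

lemma computable_list_append:
  "computable_list m K \<Longrightarrow> computable_list m L \<Longrightarrow> computable_list m (\<lambda>xs. K xs @ L xs)"
  by (auto simp: computable_list_def prepend_simps)

lemma computable_part_pats:
  assumes "computable m I"
  shows "computable_list m (\<lambda>xs. map vbuild (part_pats k (g, I xs)))"
  unfolding part_pats_def list.map concat.simps append.simps append_Nil2 width_def fst_conv
  by (intro computable_list_Cons computable_list_Nil computable_vbuild computable_vtx_Part assms)

lemma computable_gadget_pats:
  assumes "computable m I"
  shows "computable_list m (\<lambda>xs. map ebuild (gadget_pats f (c, (g, I xs), as)))"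
  unfolding gadget_pats_def list.map
  by (intro computable_list_Cons computable_list_Nil computable_ebuild computable_vtx_Part computable_vtx_const assms)

lemma computable_inc_pats:
  assumes I: "computable m I"
  shows "computable_list m (\<lambda>xs. map ebuild (instr_pats k ((g, Suc (I xs)), Inc r (g, I xs))))"
proof -
  \<comment> \<open>The width ignores the index, so the builders form a list of fixed shape in which
    only indices vary.\<close>
  have w: "width k (g, i) = width k (g, 0)" for i by (simp add: width_def)
  show ?thesis
    unfolding instr_pats_def map_append fst_conv res_pats.simps nxt_pats.simps fin_pats.simps enter_pats_def
      list.map concat.simps append.simps append_Nil2 prod.case w[of "Suc _"] w[of "I _"]
    by (intro computable_list_append computable_gadget_pats computable_list_Cons computable_list_Nil computable_ebuild
        computable_vtx_Part computable_vtx_const computable_Suc I)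
qed

lemma computable_jmp_pats:
  assumes I: "computable m I"
  shows "computable_list m (\<lambda>xs. map ebuild (instr_pats k (q, Jmp (g, I xs))))"
proof -
  have w: "width k (g, i) = width k (g, 0)" for i by (simp add: width_def)
  show ?thesis
    unfolding instr_pats_def map_append fst_conv res_pats.simps nxt_pats.simps fin_pats.simps enter_pats_def
      list.map concat.simps append.simps append_Nil2 prod.case w[of "I _"] gadget_pats_def
    by (intro computable_list_append computable_list_Cons computable_list_Nil computable_ebuild
        computable_vtx_Part computable_vtx_const computable_Suc I)
qed

section \<open>Diagonalisation\<close>

text \<open>Loads \<open>m\<close> into register 0 and \<open>n\<close> into register 1 by counting
  down, register 1 first. Unary loading gives all lines the same shape up to the index, and the
  descending order lets recursion over the index prepend one block at a time.\<close>

definition input_prog :: "nat \<Rightarrow> nat \<Rightarrow> prog" where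
  "input_prog m n = ((2, 0), Jmp (1, m + n)) #
     map (\<lambda>i. ((1, Suc i), Inc (if i < m then 0 else 1) (1, i))) (rev [0..<m + n])"

text \<open>The exit \<open>(1, 0)\<close> of the input phase belongs here, because the arcs of its
  \<open>Jmp\<close> depend on the number of registers.\<close>

definition main_prog :: "instr list \<Rightarrow> prog" where
  "main_prog is = ((1, 0), Jmp (0, length is)) # ((0, 0), Acc 2) # map (\<lambda>j. ((0, Suc j), is ! j)) [0..<length is]"

definition code_verts :: "vtx list \<Rightarrow> nat" where
  "code_verts vs = list_encode (map code_builder (map vbuild vs))"

definition code_arcs :: "(vtx \<times> vtx) list \<Rightarrow> nat" where
  "code_arcs es = list_encode (map code_builder (map ebuild es))"

text \<open>The argument 0 of \<open>part_pats\<close> stands in for the number of registers, which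
  the widths of the input states ignore.\<close>

definition extend_verts :: "nat \<Rightarrow> nat \<Rightarrow> nat" where
  "extend_verts m c = prepend (map vbuild (part_pats 0 (2, 0)))
     (rec_nat c (\<lambda>i r. prepend (map vbuild (part_pats 0 (1, Suc i))) r) m)"

definition extend_arcs :: "nat \<Rightarrow> nat \<Rightarrow> nat \<Rightarrow> nat" where
  "extend_arcs m n c = prepend (map ebuild (instr_pats 0 ((2, 0), Jmp (1, m + n))))
     (rec_nat (rec_nat c (\<lambda>i r. prepend (map ebuild (instr_pats 0 ((1, Suc i), Inc 0 (1, i)))) r) m)
       (\<lambda>i r. prepend (map ebuild (instr_pats 0 ((1, Suc (m + i)), Inc 1 (1, m + i)))) r) n)"

text \<open>The code of the presentation for \<open>input_prog m n @ main_prog is\<close>, computed from the codes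
  \<open>c\<close> and \<open>d\<close> of the part for \<open>main_prog is\<close>.\<close>

definition extend_code :: "nat \<Rightarrow> nat \<Rightarrow> nat \<Rightarrow> nat \<Rightarrow> nat" where
  "extend_code m n c d = prod_encode
     (code_pair (prod_encode (1, extend_verts (m + n) c)) (prod_encode (1, extend_arcs m n d)), 0)"

lemma prepend_rev:
  "prepend (concat (map f (rev [0..<n]))) c = rec_nat c (\<lambda>i r. prepend (f i) r) n"
  by (induction n) (simp_all add: prepend_simps)

lemma part_pats_width: "part_pats k (Suc g, i) = part_pats 0 (Suc g, i)"
  by (simp add: part_pats_def width_def)

lemma instr_pats_width:
  "instr_pats k ((Suc g, i), Inc r (Suc g, j)) = instr_pats 0 ((Suc g, i), Inc r (Suc g, j))"
  "instr_pats k ((Suc g, i), Jmp (Suc h, j)) = instr_pats 0 ((Suc g, i), Jmp (Suc h, j))"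
  by (simp_all add: instr_pats_def enter_pats_def width_def)

lemma code_input_verts:
  "code_verts (vert_pats k (input_prog m n @ main_prog is)) = extend_verts (m + n) (code_verts (vert_pats k (main_prog is)))"
proof -
  have w: "part_pats k (1, i) = part_pats 0 (1, i)" "part_pats k (2, i) = part_pats 0 (2, i)" for i
    using part_pats_width[of k 0] part_pats_width[of k 1] by (simp_all add: One_nat_def numeral_2_eq_2)
  have "map vbuild (vert_pats k (input_prog m n @ main_prog is)) =
      map vbuild (part_pats 0 (2, 0)) @ concat (map (\<lambda>i. map vbuild (part_pats 0 (1, Suc i))) (rev [0..<m + n]))
      @ map vbuild (vert_pats k (main_prog is))"
    by (simp add: vert_pats_def input_prog_def w map_concat comp_def)
  then show ?thesis
    by (simp only: code_verts_def list_encode_prepend prepend_rev extend_verts_def)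
qed

lemma rec_nat_split:
  "rec_nat c (\<lambda>i. if i < m then f i else g i) (m + n) = rec_nat (rec_nat c f m) (\<lambda>i. g (m + i)) n"
proof (induction n)
  case 0
  have "k \<le> m \<Longrightarrow> rec_nat c (\<lambda>i. if i < m then f i else g i) k = rec_nat c f k" for k
    by (induction k) simp_all
  then show ?case by simp
qed simp

lemma code_input_arcs:
  "code_arcs (arc_pats k (input_prog m n @ main_prog is) u) = extend_arcs m n (code_arcs (arc_pats k (main_prog is) u))"
proof -
  have w: "instr_pats k ((1, i), Inc r (1, j)) = instr_pats 0 ((1, i), Inc r (1, j))"
    "instr_pats k ((2, i), Jmp (1, j)) = instr_pats 0 ((2, i), Jmp (1, j))" for i j r
    using instr_pats_width(1)[of k 0 i r j] instr_pats_width(2)[of k 1 i 0 j]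
    by (simp_all add: One_nat_def numeral_2_eq_2)
  let ?f = "\<lambda>i. map ebuild (instr_pats 0 ((1, Suc i), Inc (if i < m then 0 else 1) (1, i)))"
  have "map ebuild (arc_pats k (input_prog m n @ main_prog is) u) =
      map ebuild (instr_pats 0 ((2, 0), Jmp (1, m + n))) @ concat (map ?f (rev [0..<m + n]))
      @ map ebuild (arc_pats k (main_prog is) u)"
    by (simp add: arc_pats_def input_prog_def w map_concat comp_def)
  moreover have "rec_nat c (\<lambda>i. prepend (?f i)) (m + n) =
     rec_nat (rec_nat c (\<lambda>i r. prepend (map ebuild (instr_pats 0 ((1, Suc i), Inc 0 (1, i)))) r) m)
       (\<lambda>i r. prepend (map ebuild (instr_pats 0 ((1, Suc (m + i)), Inc 1 (1, m + i)))) r) n" for c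
  proof -
    have "(\<lambda>i. prepend (?f i)) = (\<lambda>i. if i < m then prepend (map ebuild (instr_pats 0 ((1, Suc i), Inc 0 (1, i))))
        else prepend (map ebuild (instr_pats 0 ((1, Suc i), Inc 1 (1, i)))))" by auto
    then show ?thesis by (simp only: rec_nat_split)
  qed
  ultimately show ?thesis
    by (simp only: code_arcs_def list_encode_prepend prepend_rev extend_arcs_def)
qed

lemma code_input_prog:
  "code_presentation (pres (vert_pats k (input_prog m n @ main_prog is)) (arc_pats k (input_prog m n @ main_prog is) u)) =
    extend_code m n (code_verts (vert_pats k (main_prog is))) (code_arcs (arc_pats k (main_prog is) u))"
  using code_input_verts[of k m n "is"] code_input_arcs[of k m n "is" u]
  by (simp add: code_presentation_def pres_def code_epair extend_code_def code_verts_def code_arcs_def)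

text \<open>Each input serves twice, as a number to be loaded and as a code to be extended: this is
  the self-application.\<close>

lemma computable_extend_code:
  "computable 2 (\<lambda>xs. extend_code (xs ! 0) (xs ! 1) (xs ! 0) (xs ! 1))"
proof -
  have L: "computable m (\<lambda>xs. prepend (X xs) (N xs))" if "computable_list m X" "computable m N" for m X N
    using that by (auto simp: computable_list_def)
  have nth: "computable m (\<lambda>ys. drop 2 ys ! i)" if "2 + i < m" for m i
    by (rule computable_cong[OF computable_nth[OF that]]) (use that in simp)
  show ?thesis
    unfolding extend_code_def extend_verts_def extend_arcs_def
    by (intro computable_prod_encode computable_code_pair computable_const computable_rec L computable_part_pats
        computable_inc_pats computable_jmp_pats computable_add computable_Suc computable_nth nth) simp_all
qed

lemma distinct_input_main: "distinct (map fst (input_prog m n @ main_prog is))"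
  by (auto simp: input_prog_def main_prog_def comp_def distinct_map inj_on_def One_nat_def)

lemma states_input_main:
  "fst ` set (input_prog m n @ main_prog is) = {(2, 0)} \<union> Pair 1 ` {..m + n} \<union> Pair 0 ` {..length is}"
proof -
  have eq: "Pair c ` {..M} = insert (c, 0) ((\<lambda>i. (c, Suc i)) ` {0..<M})" for c :: nat and M :: nat
    by (simp add: lessThan_Suc_atMost[symmetric] lessThan_Suc_eq_insert_0 image_image atLeast0LessThan)
  have "fst ` set (input_prog m n @ main_prog is) = insert (2, 0) ((\<lambda>i. (1, Suc i)) ` {0..<m + n}
      \<union> insert (1, 0) (insert (0, 0) ((\<lambda>j. (0, Suc j)) ` {0..<length is})))"
    by (simp add: input_prog_def main_prog_def image_Un image_image)
  moreover have "insert a (A \<union> insert b (insert c B)) = {a} \<union> insert b A \<union> insert c B" for a b c :: state and A B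
    by blast
  ultimately show ?thesis unfolding eq by (rule trans)
qed

section \<open>Determinism of register machines and the input phase\<close>

lemma mstep_deterministic:
  assumes "single_valued (set P)" "mstep P c d" "mstep P c d'"
  shows "d = d'"
  using assms(2)
proof cases
  case (1 q r q' \<rho>)
  from assms(3)[unfolded 1(1)] show ?thesis
    unfolding 1(2) by cases (auto dest: single_valuedD[OF assms(1) 1(3)])
next
  case (2 q r q' l \<rho>)
  from assms(3)[unfolded 2(1)] show ?thesis
    unfolding 2(2) by cases (use 2(4) in \<open>auto dest: single_valuedD[OF assms(1) 2(3)]\<close>)
next
  case (3 q r q' l \<rho> n)
  from assms(3)[unfolded 3(1)] show ?thesis
    unfolding 3(2) by cases (use 3(4) in \<open>auto dest: single_valuedD[OF assms(1) 3(3)]\<close>)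
next
  case (4 q q' \<rho>)
  from assms(3)[unfolded 4(1)] show ?thesis
    unfolding 4(2) by cases (auto dest: single_valuedD[OF assms(1) 4(3)])
qed

text \<open>Identifies the accepting computation read off from a Hamiltonian path with the known run
  of the diagonal program.\<close>

lemma mstep_halting_unique:
  assumes P: "single_valued (set P)"
    and "(mstep P)\<^sup>*\<^sup>* c d" "(mstep P)\<^sup>*\<^sup>* c d'" "\<And>e. \<not> mstep P d e" "\<And>e. \<not> mstep P d' e"
  shows "d = d'"
  using assms(2,3)
proof (induction rule: converse_rtranclp_induct)
  case base
  then show ?case by (cases rule: converse_rtranclpE) (use assms(4) in blast)+
next
  case (step b c)
  from step.prems show ?case
  proof (cases rule: converse_rtranclpE)
    case base
    then show ?thesis using step.hyps(1) assms(5) by blast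
  next
    fix c' assume c': "mstep P b c'" "(mstep P)\<^sup>*\<^sup>* c' d'"
    have "c = c'" by (rule mstep_deterministic[OF P step.hyps(1) c'(1)])
    then show ?thesis using step.IH c'(2) by blast
  qed
qed

lemma input_prog_run:
  assumes "set (input_prog m n) \<subseteq> set P"
  shows "(mstep P)\<^sup>*\<^sup>* ((1, m + n), \<lambda>_. 0) ((1, 0), (\<lambda>_. 0)(0 := m, 1 := n))"
proof -
  have ins: "((1, Suc i), Inc (if i < m then 0 else 1) (1, i)) \<in> set P" if "i < m + n" for i
  proof -
    have "((1, Suc i), Inc (if i < m then 0 else 1) (1, i)) \<in> set (input_prog m n)"
      using that by (auto simp: input_prog_def)
    then show ?thesis using assms by blast
  qed
  have "(mstep P)\<^sup>*\<^sup>* ((1, m + i), \<rho>) ((1, m), \<rho>(1 := \<rho> 1 + i))" if "i \<le> n" for i \<rho>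
    using that
  proof (induction i arbitrary: \<rho>)
    case (Suc i)
    have "mstep P ((1, m + Suc i), \<rho>) ((1, m + i), \<rho>(1 := Suc (\<rho> 1)))"
      using mstep.intros(1)[OF ins[of "m + i"], of \<rho>] Suc.prems by simp
    also have "(mstep P)\<^sup>*\<^sup>* \<dots> ((1, m), (\<rho>(1 := Suc (\<rho> 1)))(1 := (\<rho>(1 := Suc (\<rho> 1))) 1 + i))"
      by (rule Suc.IH) (use Suc.prems in simp)
    finally show ?case by (simp add: fun_upd_same del: fun_upd_apply)
  qed simp
  from this[of n "\<lambda>_. 0"] have A: "(mstep P)\<^sup>*\<^sup>* ((1, m + n), \<lambda>_. 0) ((1, m), (\<lambda>_. 0)(1 := n))" by simp
  have "(mstep P)\<^sup>*\<^sup>* ((1, i), \<rho>) ((1, 0), \<rho>(0 := \<rho> 0 + i))" if "i \<le> m" for i \<rho>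
    using that
  proof (induction i arbitrary: \<rho>)
    case (Suc i)
    have "mstep P ((1, Suc i), \<rho>) ((1, i), \<rho>(0 := Suc (\<rho> 0)))"
      using mstep.intros(1)[OF ins[of i], of \<rho>] Suc.prems by simp
    also have "(mstep P)\<^sup>*\<^sup>* \<dots> ((1, 0), (\<rho>(0 := Suc (\<rho> 0)))(0 := (\<rho>(0 := Suc (\<rho> 0))) 0 + i))"
      by (rule Suc.IH) (use Suc.prems in simp)
    finally show ?case by (simp add: fun_upd_same del: fun_upd_apply)
  qed simp
  from this[of m "(\<lambda>_. 0)(1 := n)"] have "(mstep P)\<^sup>*\<^sup>* ((1, m), (\<lambda>_. 0)(1 := n)) ((1, 0), (\<lambda>_. 0)(0 := m, 1 := n))"
    by (simp add: fun_upd_twist)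
  with A show ?thesis by simp
qed

theorem theorem3p16:
  shows "\<not> (\<exists>f :: recf. \<forall>p G. presents_digraph p G \<longrightarrow>
           computes f [code_presentation p]
             (if has_doubly_infinite_hamiltonian_path G then 1 else 0))"
proof
  assume "\<exists>f :: recf. \<forall>p G. presents_digraph p G \<longrightarrow>
    computes f [code_presentation p] (if has_doubly_infinite_hamiltonian_path G then 1 else 0)"
  then obtain f where f: "\<And>p G. presents_digraph p G \<Longrightarrow>
    computes f [code_presentation p] (if has_doubly_infinite_hamiltonian_path G then 1 else 0)" by blast
  obtain d where "\<forall>xs. length xs = 2 \<longrightarrow> computes d xs (extend_code (xs ! 0) (xs ! 1) (xs ! 0) (xs ! 1))"
    using computable_extend_code unfolding computable_def by blast
  then have d: "computes d [m, n] (extend_code m n m n)" for m n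
    by (elim allE[of _ "[m, n]"]) (simp add: One_nat_def)
  define h where "h = Comp f [d]"
  have h: "computes h [m, n] w" if "computes f [extend_code m n m n] w" for m n w
    unfolding h_def by (rule computes.intros(4)[where ys = "[extend_code m n m n]"]) (use d that in auto)
  \<comment> \<open>The inputs are in registers 0 and 1, the result goes to register 2, and scratch
    space starts at 3.\<close>
  define "is" where "is = flat (compile h [0, 1] 2 3) 0"
  \<comment> \<open>Exceeds every register in use; the summand 3 covers registers 0 to 2.\<close>
  define k where "k = 3 + (\<Sum>i\<leftarrow>is. reg_of i)"
  have reg_k: "reg_of i < k" if "i \<in> set is" for i
    using member_le_sum_list[of "reg_of i" "map reg_of is"] that by (auto simp: k_def)
  let ?u = "(0, (2, 0), [0, 0, 0, 0]) :: step"
  \<comment> \<open>There is no circularity: \<open>main_prog is\<close> does not mention its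
    inputs, so its codes exist before the input phase that loads them is built.\<close>
  define m n where "m = code_verts (vert_pats k (main_prog is))" and "n = code_arcs (arc_pats k (main_prog is) ?u)"
  define P where "P = input_prog m n @ main_prog is"
  have functional: "i = i'" if "(q, i) \<in> set P" "(q, i') \<in> set P" for q i i'
    using distinct_input_main[of m n "is"] that unfolding P_def[symmetric] by (rule eq_key_imp_eq_value)
  have states: "fst ` set P = {(2, 0)} \<union> Pair 1 ` {..m + n} \<union> Pair 0 ` {..length is}"
    unfolding P_def by (rule states_input_main)
  have sv: "single_valued (set P)" using functional by (rule single_valuedI)
  interpret machine k P "(2, 0)" "(1, m + n)"
  proof
    show "2 \<le> k" by (simp add: k_def)
    show "((2, 0), Jmp (1, m + n)) \<in> set P" by (simp add: P_def input_prog_def)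
    show "width k (2, 0) = 4" by (simp add: width_def)
    show "(q, i) \<in> set P \<Longrightarrow> (q, i') \<in> set P \<Longrightarrow> i = i'" for q i i' by (rule functional)
    fix q i assume qi: "(q, i) \<in> set P"
    then consider "q = (2, 0)" "i = Jmp (1, m + n)"
      | j where "j < m + n" "q = (1, Suc j)" "i = Inc (if j < m then 0 else 1) (1, j)"
      | "q = (1, 0)" "i = Jmp (0, length is)" | "q = (0, 0)" "i = Acc 2"
      | j where "j < length is" "q = (0, Suc j)" "i = is ! j"
      by (auto simp: P_def input_prog_def main_prog_def)
    note cs = this
    show "reg_of i + 2 < width k q"
      using cs
    proof cases
      case (5 j)
      then show ?thesis using reg_k[of i] by (simp add: width_def)
    qed (auto simp: width_def k_def)
    show "q' \<in> fst ` set P \<and> width k q \<le> width k q'" if "q' \<in> set (targets i)" for q'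
      using cs
    proof cases
      case (5 j)
      then have "fst q' = 0 \<and> snd q' \<le> length is"
        using flat_targets[of i "compile h [0, 1] 2 3" 0 q'] that by (simp add: is_def)
      then show ?thesis using 5 by (cases q') (auto simp: states width_def)
    qed (use that in \<open>auto simp: states width_def k_def\<close>)
  qed
  let ?p = "pres (vert_pats k P) (arc_pats k P start_pat)"
  let ?G = "pat_graph (vert_pats k P) (arc_pats k P start_pat)"
  define w :: nat where "w = (if has_doubly_infinite_hamiltonian_path ?G then 1 else 0)"
  \<comment> \<open>What the main program computes from its inputs is therefore the code of its own
    graph, input phase included.\<close>
  have "code_presentation ?p = extend_code m n m n"
    unfolding P_def start_pat_def m_def n_def by (rule code_input_prog)
  then have "computes f [extend_code m n m n] w"
    using f[OF presents_machine] by (simp add: w_def)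
  then have hw: "computes h [m, n] w" by (rule h)
  let ?\<rho> = "(\<lambda>_. 0)(0 := m, 1 := n) :: nat \<Rightarrow> nat"
  have ex: "exec (compile h [0, 1] 2 3) ?\<rho> (?\<rho>(2 := w))"
    by (rule compilesD[OF compile_correct hw]) (auto simp: fits_def)
  have "has_code P 0 is" by (auto simp: has_code_def P_def main_prog_def)
  then have co: "has_code P 0 (flat (compile h [0, 1] 2 3) 0)" by (simp only: is_def)
  have main: "(mstep P)\<^sup>*\<^sup>* ((0, length is), ?\<rho>) ((0, 0), ?\<rho>(2 := w))"
    using flat_correct[OF ex co] unfolding is_def add_0 .
  have "mstep P ((1, 0), ?\<rho>) ((0, length is), ?\<rho>)"
    by (rule mstep.intros(4)) (simp add: P_def main_prog_def)
  then have main: "(mstep P)\<^sup>*\<^sup>* ((1, 0), ?\<rho>) ((0, 0), ?\<rho>(2 := w))"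
    using main by (rule converse_rtranclp_into_rtranclp)
  have "(mstep P)\<^sup>*\<^sup>* ((1, m + n), \<lambda>_. 0) ((1, 0), ?\<rho>)"
    by (rule input_prog_run) (simp add: P_def)
  then have run: "(mstep P)\<^sup>*\<^sup>* ((1, m + n), \<lambda>_. 0) ((0, 0), ?\<rho>(2 := w))"
    using main by (rule rtranclp_trans)
  have acc: "((0, 0), Acc 2) \<in> set P" by (simp add: P_def main_prog_def)
  show False
  proof (cases "has_doubly_infinite_hamiltonian_path ?G")
    case True
    then obtain us rs where "valid_run us rs" using hamiltonian_iff_valid_run by blast
    from valid_run_accepts[OF this] obtain q \<rho> r where
      q: "(mstep P)\<^sup>*\<^sup>* ((2, 0), \<lambda>_. 0) (q, \<rho>)" "(q, Acc r) \<in> set P" "\<rho> r = 0" by blast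
    have start: "(mstep P)\<^sup>*\<^sup>* ((2, 0), \<lambda>_. 0) ((0, 0), ?\<rho>(2 := w))"
      using mstep.intros(4)[OF q0] run by (rule converse_rtranclp_into_rtranclp)
    have halt: "\<not> mstep P (q, \<rho>) e" if "(q, Acc r) \<in> set P" for q \<rho> r e
    proof
      assume "mstep P (q, \<rho>) e"
      then show False by cases (auto dest: functional[OF that])
    qed
    \<comment> \<open>Acceptance found through the path has to happen in the configuration that the
      program really reaches, where register 2 holds 1.\<close>
    have "(q, \<rho>) = ((0, 0), ?\<rho>(2 := w))"
      using mstep_halting_unique[OF sv q(1) start halt[OF q(2)] halt[OF acc]] .
    moreover from this have "r = 2" using functional[OF q(2)] acc by auto
    ultimately show False using q(3) True by (simp add: w_def)
  next
    case False
    then have "(?\<rho>(2 := w)) 2 = 0" by (simp add: w_def)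
    from accepts_valid_run[OF run acc this] show False using False hamiltonian_iff_valid_run by blast
  qed
qed

end
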